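(* Let $V^{[*]}$ be a dg vertex operator algebra. There is a natural transformation $\Psi:\eta_{F^\bullet W_\bullet}\circ R^{[*]}(-)\to\operatorname{gr}_*\operatorname{gr}^{[*]}A(-)$ of functors from the category of graded dg $V^{[*]}$-modules to the category of graded $\operatorname{gr}_*\operatorname{gr}^{[*]}A(V^{[*]})$-modules such that, for any graded dg $V^{[*]}$-module $M^{[*]}$, the morphism $$\Psi_{M^{[*]}}:\eta_{F^\bullet W_\bullet}(R^{[*]}(M^{[*]}))\to\operatorname{gr}_*\operatorname{gr}^{[*]}A(M^{[*]})$$ sending $m+C_2^{[|m|]}(M^{[*]})_{\operatorname{wt}(m)}+\left((\operatorname{Ker}\eta_{F^\bullet W_\bullet})R^{[*]}(M^{[*]})\right)^{[|m|]}_{\operatorname{wt}(m)}$ to $$m+O(M^{[*]})+\bigoplus_{q\le|m|,\,n<\operatorname{wt}(m)}M^{[q]}(n)+\bigoplus_{q<|m|,\,n\le\operatorname{wt}(m)}M^{[q]}(n)$$ (for $m$ homogeneous in degree and weight) is a surjective morphism of weight graded dg Poisson $\operatorname{gr}_*\operatorname{gr}^{[*]}A(V^{[*]})$-modules.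
   Context: All vector spaces are over $\mathbb C$. A (cochain) complex $V^{[*]}=\bigoplus_{p\in\mathbb Z}V^{[p]}$ has a differential $d_V$ of degree $+1$ with $d_V^2=0$; $|v|=p$ for $v\in V^{[p]}$ (dg homogeneous elements). $\operatorname{End}^{[*]}(V^{[*]})=\bigoplus_p\operatorname{End}^{[p]}(V^{[*]})$, where $\operatorname{End}^{[p]}$ is the space of linear maps of degree $p$. A dg vertex algebra $(V^{[*]},d_V,Y(\cdot,x),\mathbf 1)$ is a complex with a linear map $v\mapsto Y(v,x)=\sum_{n\in\mathbb Z}v_nx^{-n-1}\in\operatorname{End}^{[*]}(V^{[*]})[[x,x^{-1}]]$ such that for $v\in V^{[p]}$ one has $v_n\in\operatorname{End}^{[p-2n-2]}(V^{[*]})$ and $(d_Vv)_n=d_V\circ v_n-(-1)^{p}v_n\circ d_V$, and a vector $\mathbf 1\in V^{[0]}$ with $d_V\mathbf 1=0$, such that: $u_nv=0$ for $n$ sufficiently large; $Y(\mathbf 1,x)=\operatorname{id}$; $Y(v,x)\mathbf 1\in V^{[*]}[[x]]$ with constant term $v$; and (Jacobi identity) for homogeneous $u,v$ and all $l,m,n\in\mathbb Z$, $$\sum_{i\ge0}(-1)^i\binom li\left(u_{m+l-i}v_{n+i}-(-1)^{l}(-1)^{|u||v|}v_{n+l-i}u_{m+i}\right)=\sum_{i\ge0}\binom mi(u_{l+i}v)_{m+n-i}.$$ A dg vertex operator algebra is a dg vertex algebra with $\omega\in V^{[4]}$, $d_V\omega=0$, such that, writing $Y(\omega,x)=\sum_nL(n)x^{-n-2}$: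 $[L(m),L(n)]=(m-n)L(m+n)+\frac1{12}(m^3-m)\delta_{m+n,0}c_V$ for some $c_V\in\mathbb C$; $L(0)$ is semisimple with $V^{[*]}=\bigoplus_{n\in\frac12\mathbb Z}V_n^{[*]}$, $V_n^{[*]}$ the eigenspace of eigenvalue (weight) $n$, $\omega\in V_2^{[*]}$, $\dim V_n^{[*]}<\infty$, $V_n^{[*]}=0$ for $n\ll0$; and $L(-1)v=v_{-2}\mathbf 1$. Put $V_n^{[p]}=V_n^{[*]}\cap V^{[p]}$ and $\operatorname{wt}(u)=n$ for $u\in V_n^{[*]}$. A weak dg module over $V^{[*]}$ is a complex $(M^{[*]},d_M)$ with a linear map $v\mapsto Y_M(v,x)=\sum_nv_nx^{-n-1}\in\operatorname{End}^{[*]}(M^{[*]})[[x,x^{-1}]]$ such that for $v\in V^{[p]}$, $v_n\in\operatorname{End}^{[p-2n-2]}(M^{[*]})$ and $(d_Vv)_n=d_M\circ v_n-(-1)^pv_n\circ d_M$; $v_nm=0$ for $n$ sufficiently large; $Y_M(\mathbf 1,x)=\operatorname{id}$; and the displayed Jacobi identity holds for operators on $M^{[*]}$. A graded dg module is a weak dg module with a decomposition $M^{[*]}=\bigoplus_{n\in\frac12\mathbb Z}M^{[*]}(n)$ into subcomplexes such that $u_m(M^{[*]}(r))\subseteq M^{[*]}(r+n-m-1)$ for $u\in V_n^{[*]}$; $M^{[p]}(n)$ is the degree $p$ part of $M^{[*]}(n)$ and $\operatorname{wt}(m)=n$ for $m\in M^{[*]}(n)$. Morphisms of graded dg modules are chain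 maps $f$ with $f(v_nm)=v_nf(m)$ preserving the decomposition. $C_2$-algebra: $C_2^{[*]}(V^{[*]})=\operatorname{Span}\{u_{-2}v\}$, $C_2^{[*]}(M^{[*]})=\operatorname{Span}\{v_{-2}m\}$ (bigraded subcomplexes; superscript $[p]$ and subscript $n$ denote degree $p$, weight $n$ parts), $R^{[*]}(V^{[*]})=V^{[*]}/C_2^{[*]}(V^{[*]})$ is a weight graded, graded commutative dg Poisson algebra with $\overline u\cdot\overline v=\overline{u_{-1}v}$, $\{\overline u,\overline v\}=\overline{u_0v}$, and $R^{[*]}(M^{[*]})=M^{[*]}/C_2^{[*]}(M^{[*]})$ is a weight graded dg Poisson module over it with $\overline v\cdot\overline m=\overline{v_{-1}m}$, $\{\overline v,\overline m\}=\overline{v_0m}$. Zhu algebra: for $u\in V^{[*]}$ weight homogeneous and $m$ in $V^{[*]}$ or $M^{[*]}$, put $u\ast_lm=\sum_{n\ge0}\binom{\operatorname{wt}(u)}{n}u_{n-1}m$, $u\circ m=\sum_{n\ge0}\binom{\operatorname{wt}(u)}{n}u_{n-2}m$, and, for $u,m$ also dg homogeneous, $m\ast_ru=(-1)^{|u||m|}\sum_{n\ge0}\binom{\operatorname{wt}(u)-1}{n}u_{n-1}m$ (extended linearly). $O(V^{[*]})$, $O(M^{[*]})$ are the spans of all $u\circ v$, resp. $u\circ m$; $A(V^{[*]})=V^{[*]}/O(V^{[*]})$ with product $\ast=\ast_l$, $A(M^{[*]})=M^{[*]}/O(M^{[*]})$. The associated bigraded objects for the filtrations by cohomological degree and weight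 are $$\operatorname{gr}_*\operatorname{gr}^{[*]}A(V^{[*]})=\bigoplus_{p,n}\left(V_n^{[p]}\bmod I_n^{[p]}\right),\qquad I_n^{[p]}=O(V^{[*]})+\bigoplus_{q\le p,\,m<n}V_m^{[q]}+\bigoplus_{q<p,\,m\le n}V_m^{[q]},$$ $$\operatorname{gr}_*\operatorname{gr}^{[*]}A(M^{[*]})=\bigoplus_{p,n}\left(M^{[p]}(n)\bmod J_n^{[p]}\right),\qquad J_n^{[p]}=O(M^{[*]})+\bigoplus_{q\le p,\,m<n}M^{[q]}(m)+\bigoplus_{q<p,\,m\le n}M^{[q]}(m)$$ ("$\bmod$" meaning the image in the quotient of $V^{[*]}$, resp. $M^{[*]}$). The first is a weight graded dg Poisson algebra with product induced by $\ast$, differential by $d_V$, and bracket of the classes of $u\in V_{n_1}^{[p_1]}$, $v\in V_{n_2}^{[p_2]}$ equal to the class of $u\ast v-(-1)^{p_1p_2}v\ast u$ modulo $I_{n_1+n_2-1}^{[p_1+p_2-2]}$; the second is a weight graded dg Poisson module over it with action induced by $\ast_l$, differential by $d_M$, and bracket of the classes of $u\in V_{n_1}^{[p_1]}$, $m\in M^{[p_2]}(n_2)$ equal to the class of $u\ast_lm-(-1)^{p_1p_2}m\ast_ru$ modulo $J_{n_1+n_2-1}^{[p_1+p_2-2]}$. $\eta_{F^\bullet W_\bullet}:R^{[*]}(V^{[*]})\to\operatorname{gr}_*\operatorname{gr}^{[*]}A(V^{[*]})$ is the surjective morphism of weight graded dg Poisson algebras sending the class of $u\in V_n^{[p]}$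 to its class modulo $I_n^{[p]}$. For a weight graded dg $R^{[*]}(V^{[*]})$-module $W$, $\eta_{F^\bullet W_\bullet}(W)=\operatorname{gr}_*\operatorname{gr}^{[*]}A(V^{[*]})\otimes_{R^{[*]}(V^{[*]})}W\cong W/((\operatorname{Ker}\eta_{F^\bullet W_\bullet})W)$; for $W=R^{[*]}(M^{[*]})$ it carries the gradings, differential, action and bracket induced from $R^{[*]}(M^{[*]})$. A dg Poisson module over a graded commutative dg Poisson algebra $R^{[*]}$ with bracket of even degree (here $-2$) is a left dg $R^{[*]}$-module with a bracket satisfying $\{\{a,b\},m\}=\{a,\{b,m\}\}-(-1)^{|a||b|}\{b,\{a,m\}\}$, $d\{a,m\}=\{da,m\}+(-1)^{|a|}\{a,dm\}$, $\{a,bm\}=\{a,b\}m+(-1)^{|a||b|}b\{a,m\}$, $\{ab,m\}=a\{b,m\}+(-1)^{|a||b|}b\{a,m\}$; weight graded means with a compatible $\frac12\mathbb Z$-grading (action additive in weight, bracket of weight $-1$). Morphisms preserve gradings, differential, action and bracket.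
   Formalization: Ψ_M is a Poisson morphism over gr A(V) only if {Ker η, R(M)} ⊆ (Ker η)R(M), since otherwise the bracket on η(R(M)) is undefined (this can fail for lattice VOAs); without this, Ψ_M is a surjective dg gr A(V)-module morphism and Poisson over R(V). *)

theory Defs
  imports
    Complex_Main
    "HOL-Library.Groups_Big_Fun"
    "HOL-Library.Set_Algebras"
    "HOL-Library.Product_Plus"
    "HOL-Algebra.Module"
begin

section \<open>Complexes, dg vertex operator algebras and graded dg modules\<close>

definition half_ints :: "real set" where
  "half_ints = {n. 2 * n \<in> \<int>}"

definition ksign :: "int \<Rightarrow> int \<Rightarrow> complex" where
  "ksign p q = (-1) powi (p * q)"

definition direct_sum_on ::
    "(complex \<Rightarrow> 'a::ab_group_add \<Rightarrow> 'a) \<Rightarrow> 'a set \<Rightarrow> 'i set \<Rightarrow> ('i \<Rightarrow> 'a set) \<Rightarrow> bool" where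
  "direct_sum_on s X I A \<longleftrightarrow>
     (\<forall>i\<in>I. module.subspace s (A i)) \<and>
     X = module.span s (\<Union>i\<in>I. A i) \<and>
     (\<forall>F f. finite F \<and> F \<subseteq> I \<and> (\<forall>i\<in>F. f i \<in> A i) \<and> (\<Sum>i\<in>F. f i) = 0
        \<longrightarrow> (\<forall>i\<in>F. f i = 0))"

definition linear_on ::
    "(complex \<Rightarrow> 'a::ab_group_add \<Rightarrow> 'a) \<Rightarrow> (complex \<Rightarrow> 'b::ab_group_add \<Rightarrow> 'b)
       \<Rightarrow> 'a set \<Rightarrow> ('a \<Rightarrow> 'b) \<Rightarrow> bool" where
  "linear_on s t X f \<longleftrightarrow>
     (\<forall>x\<in>X. \<forall>y\<in>X. f (x + y) = f x + f y) \<and> (\<forall>c. \<forall>x\<in>X. f (s c x) = t c (f x))"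

text \<open>
  The underlying space \<open>car\<close> of a complex is a subspace of an ambient type, so that complexes
  of different sizes, and hence a whole category of modules, live over one type.  Maps are
  only constrained on \<open>car\<close>.
\<close>

record 'a cochain =
  scl :: "complex \<Rightarrow> 'a \<Rightarrow> 'a"
  car :: "'a set"
  dgr :: "int \<Rightarrow> 'a set"
  dif :: "'a \<Rightarrow> 'a"

locale cochain_complex =
  fixes C :: "('a::ab_group_add, 'z) cochain_scheme"
  assumes vector_space: "vector_space (scl C)"
    and degree_decomposition: "direct_sum_on (scl C) (car C) UNIV (dgr C)"
    and dif_linear: "linear_on (scl C) (scl C) (car C) (dif C)"
    and dif_degree: "x \<in> dgr C p \<Longrightarrow> dif C x \<in> dgr C (p + 1)"
    and dif_dif: "x \<in> car C \<Longrightarrow> dif C (dif C x) = 0"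

text \<open>\<open>vmode V u n\<close> is the operator \<open>u\<^sub>n\<close>.\<close>

record 'v dgva = "'v cochain" +
  vmode :: "'v \<Rightarrow> int \<Rightarrow> 'v \<Rightarrow> 'v"
  vac :: 'v

record 'v dgvoa = "'v dgva" +
  conf :: 'v

text \<open>
  The Jacobi identity for homogeneous \<open>u\<close>, \<open>v\<close> of degrees \<open>p\<close>, \<open>q\<close>, with operators acting by \<open>Y\<close> on
  \<open>X\<close>.  By the truncation axiom all three series have finitely many nonzero terms.
\<close>

definition jacobi_identity ::
    "('v::ab_group_add \<Rightarrow> int \<Rightarrow> 'v \<Rightarrow> 'v) \<Rightarrow> (complex \<Rightarrow> 'm::ab_group_add \<Rightarrow> 'm) \<Rightarrow> 'm set
       \<Rightarrow> ('v \<Rightarrow> int \<Rightarrow> 'm \<Rightarrow> 'm) \<Rightarrow> int \<Rightarrow> int \<Rightarrow> 'v \<Rightarrow> 'v \<Rightarrow> bool" where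
  "jacobi_identity YV s X Y p q u v \<longleftrightarrow>
     (\<forall>l m n. \<forall>w\<in>X.
        Sum_any (\<lambda>i::nat. s ((-1) ^ i * (of_int l gchoose i))
           (Y u (m + l - int i) (Y v (n + int i) w)
            - s ((-1) powi l * ksign p q) (Y v (n + l - int i) (Y u (m + int i) w))))
        = Sum_any (\<lambda>i::nat. s (of_int m gchoose i) (Y (YV u (l + int i) v) (m + n - int i) w)))"

locale dg_vertex_algebra = cochain_complex V
  for V :: "('v::ab_group_add, 'z) dgva_scheme" +
  assumes car_UNIV: "car V = UNIV"
    and mode_linear_left: "linear_on (scl V) (scl V) UNIV (\<lambda>u. vmode V u n w)"
    and mode_linear_right: "linear_on (scl V) (scl V) UNIV (vmode V u n)"
    and mode_degree:
      "\<lbrakk>u \<in> dgr V p; w \<in> dgr V q\<rbrakk> \<Longrightarrow> vmode V u n w \<in> dgr V (p - 2 * n - 2 + q)"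
    and mode_dif:
      "u \<in> dgr V p \<Longrightarrow>
         vmode V (dif V u) n w
         = dif V (vmode V u n w) - scl V ((-1) powi p) (vmode V u n (dif V w))"
    and vac_degree: "vac V \<in> dgr V 0"
    and vac_dif: "dif V (vac V) = 0"
    and truncation: "\<exists>N. \<forall>n\<ge>N. vmode V u n w = 0"
    and vacuum: "vmode V (vac V) n w = (if n = -1 then w else 0)"
    and creation: "n \<ge> 0 \<Longrightarrow> vmode V u n (vac V) = 0" "vmode V u (-1) (vac V) = u"
    and jacobi:
      "\<lbrakk>u \<in> dgr V p; v \<in> dgr V q\<rbrakk>
         \<Longrightarrow> jacobi_identity (vmode V) (scl V) UNIV (vmode V) p q u v"

definition Lop :: "'v dgvoa \<Rightarrow> int \<Rightarrow> 'v \<Rightarrow> 'v" where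
  "Lop V n = vmode V (conf V) (n + 1)"

definition wtspace :: "'v dgvoa \<Rightarrow> real \<Rightarrow> 'v set" where
  "wtspace V n = {v. Lop V 0 v = scl V (of_real n) v}"

locale dg_vertex_operator_algebra = dg_vertex_algebra V
  for V :: "'v::ab_group_add dgvoa" +
  assumes conf_degree: "conf V \<in> dgr V 4"
    and conf_dif: "dif V (conf V) = 0"
    and virasoro:
      "\<exists>c::complex. \<forall>m n w.
         Lop V m (Lop V n w) - Lop V n (Lop V m w)
         = scl V (of_int (m - n)) (Lop V (m + n) w)
           + scl V (if m + n = 0 then of_int (m ^ 3 - m) / 12 * c else 0) w"
    and weight_decomposition: "direct_sum_on (scl V) UNIV half_ints (wtspace V)"
    and conf_weight: "conf V \<in> wtspace V 2"
    and weight_finite: "\<exists>B. finite B \<and> wtspace V n \<subseteq> module.span (scl V) B"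
    and weight_bounded: "\<exists>N. \<forall>n<N. wtspace V n = {0}"
    and translation: "Lop V (-1) v = vmode V v (-2) (vac V)"

text \<open>\<open>mwt M n\<close> is the summand \<open>M(n)\<close>.\<close>

record ('v, 'm) weak_mod = "'m cochain" +
  mmode :: "'v \<Rightarrow> int \<Rightarrow> 'm \<Rightarrow> 'm"

record ('v, 'm) graded_mod = "('v, 'm) weak_mod" +
  mwt :: "real \<Rightarrow> 'm set"

locale weak_dg_module = V: dg_vertex_operator_algebra V + M: cochain_complex M
  for V :: "'v::ab_group_add dgvoa" and M :: "('v, 'm::ab_group_add, 'z) weak_mod_scheme" +
  assumes mode_linear_left: "w \<in> car M \<Longrightarrow> linear_on (scl V) (scl M) UNIV (\<lambda>u. mmode M u n w)"
    and mode_linear_right: "linear_on (scl M) (scl M) (car M) (mmode M u n)"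
    and mode_degree:
      "\<lbrakk>u \<in> dgr V p; w \<in> dgr M q\<rbrakk> \<Longrightarrow> mmode M u n w \<in> dgr M (p - 2 * n - 2 + q)"
    and mode_dif:
      "\<lbrakk>u \<in> dgr V p; w \<in> car M\<rbrakk> \<Longrightarrow>
         mmode M (dif V u) n w
         = dif M (mmode M u n w) - scl M ((-1) powi p) (mmode M u n (dif M w))"
    and truncation: "w \<in> car M \<Longrightarrow> \<exists>N. \<forall>n\<ge>N. mmode M u n w = 0"
    and vacuum: "w \<in> car M \<Longrightarrow> mmode M (vac V) n w = (if n = -1 then w else 0)"
    and jacobi:
      "\<lbrakk>u \<in> dgr V p; v \<in> dgr V q\<rbrakk>
         \<Longrightarrow> jacobi_identity (vmode V) (scl M) (car M) (mmode M) p q u v"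

text \<open>
  The family \<open>M(n)\<close> is indexed by half-integers; \<open>mwt_off\<close> extends it by zero to real indices.
  (For \<open>V\<close> the weight spaces off the half-integers vanish automatically.)
\<close>

locale graded_dg_module = weak_dg_module V M
  for V :: "'v::ab_group_add dgvoa" and M :: "('v, 'm::ab_group_add) graded_mod" +
  assumes mwt_decomposition: "direct_sum_on (scl M) (car M) half_ints (mwt M)"
    and mwt_off: "n \<notin> half_ints \<Longrightarrow> mwt M n = {0}"
    and mwt_graded: "mwt M n = module.span (scl M) (\<Union>p. mwt M n \<inter> dgr M p)"
    and mwt_dif: "w \<in> mwt M n \<Longrightarrow> dif M w \<in> mwt M n"
    and mwt_mode:
      "\<lbrakk>u \<in> wtspace V n; w \<in> mwt M r\<rbrakk> \<Longrightarrow> mmode M u m w \<in> mwt M (r + n - of_int m - 1)"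

definition graded_dg_module_hom ::
    "'v::ab_group_add dgvoa \<Rightarrow> ('v, 'm::ab_group_add) graded_mod \<Rightarrow> ('v, 'm) graded_mod
       \<Rightarrow> ('m \<Rightarrow> 'm) \<Rightarrow> bool" where
  "graded_dg_module_hom V M N f \<longleftrightarrow>
     graded_dg_module V M \<and> graded_dg_module V N \<and>
     linear_on (scl M) (scl N) (car M) f \<and>
     (\<forall>p. f ` dgr M p \<subseteq> dgr N p) \<and>
     (\<forall>w\<in>car M. f (dif M w) = dif N (f w)) \<and>
     (\<forall>v n. \<forall>w\<in>car M. f (mmode M v n w) = mmode N v n (f w)) \<and>
     (\<forall>n. f ` mwt M n \<subseteq> mwt N n)"


section \<open>Weight graded dg Poisson algebras and modules\<close>

text \<open>
  A bigraded object is the family of its homogeneous components, indexed by (degree, weight);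
  operations on the direct sum are given by their restrictions to components.  A component is
  a module over the ring of complex numbers.  \<open>dmap W g\<close> is the differential out of
  component \<open>g\<close>; products and brackets take the bidegrees of their arguments as arguments.
  As with \<open>M(n)\<close>, the weight index is extended by zero from half-integers to reals.
\<close>

type_synonym bideg = "int \<times> real"

definition C_ring :: "complex ring" where
  "C_ring = \<lparr>carrier = UNIV, mult = (*), one = 1, zero = 0, add = (+)\<rparr>"

abbreviation (input) up :: "bideg \<Rightarrow> bideg" where
  "up g \<equiv> g + (1, 0)"

abbreviation (input) brdeg :: "bideg \<Rightarrow> bideg \<Rightarrow> bideg" where
  "brdeg g h \<equiv> g + h - (2, 1)"

abbreviation (input) gsign :: "bideg \<Rightarrow> bideg \<Rightarrow> complex" where
  "gsign g h \<equiv> ksign (fst g) (fst h)"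

definition linear_map :: "(complex, 'a) module \<Rightarrow> (complex, 'b) module \<Rightarrow> ('a \<Rightarrow> 'b) \<Rightarrow> bool" where
  "linear_map P Q f \<longleftrightarrow>
     (\<forall>x\<in>carrier P. f x \<in> carrier Q) \<and>
     (\<forall>x\<in>carrier P. \<forall>y\<in>carrier P. f (x \<oplus>\<^bsub>P\<^esub> y) = f x \<oplus>\<^bsub>Q\<^esub> f y) \<and>
     (\<forall>c. \<forall>x\<in>carrier P. f (c \<odot>\<^bsub>P\<^esub> x) = c \<odot>\<^bsub>Q\<^esub> f x)"

definition bilinear_map ::
    "(complex, 'a) module \<Rightarrow> (complex, 'b) module \<Rightarrow> (complex, 'c) module
       \<Rightarrow> ('a \<Rightarrow> 'b \<Rightarrow> 'c) \<Rightarrow> bool" where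
  "bilinear_map P Q T f \<longleftrightarrow>
     (\<forall>x\<in>carrier P. linear_map Q T (f x)) \<and> (\<forall>y\<in>carrier Q. linear_map P T (\<lambda>x. f x y))"

record 'a bigraded =
  piece :: "bideg \<Rightarrow> (complex, 'a) module"
  dmap :: "bideg \<Rightarrow> 'a \<Rightarrow> 'a"

record 'a pois_alg = "'a bigraded" +
  punit :: 'a
  pmult :: "bideg \<Rightarrow> bideg \<Rightarrow> 'a \<Rightarrow> 'a \<Rightarrow> 'a"
  pbrk :: "bideg \<Rightarrow> bideg \<Rightarrow> 'a \<Rightarrow> 'a \<Rightarrow> 'a"

record ('a, 'w) bg_mod = "'w bigraded" +
  act :: "bideg \<Rightarrow> bideg \<Rightarrow> 'a \<Rightarrow> 'w \<Rightarrow> 'w"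

record ('a, 'w) pois_mod = "('a, 'w) bg_mod" +
  mbrk :: "bideg \<Rightarrow> bideg \<Rightarrow> 'a \<Rightarrow> 'w \<Rightarrow> 'w"

abbreviation elts :: "('a, 'z) bigraded_scheme \<Rightarrow> bideg \<Rightarrow> 'a set" where
  "elts W g \<equiv> carrier (piece W g)"

locale bigraded_complex =
  fixes W :: "('a, 'z) bigraded_scheme"
  assumes piece_module: "module C_ring (piece W g)"
    and piece_off: "snd g \<notin> half_ints \<Longrightarrow> elts W g = {\<zero>\<^bsub>piece W g\<^esub>}"
    and dmap_linear: "linear_map (piece W g) (piece W (up g)) (dmap W g)"
    and dmap_dmap: "x \<in> elts W g \<Longrightarrow> dmap W (up g) (dmap W g x) = \<zero>\<^bsub>piece W (up (up g))\<^esub>"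

locale wg_dg_poisson_algebra = bigraded_complex A
  for A :: "('a, 'z) pois_alg_scheme" +
  assumes unit_closed: "punit A \<in> elts A 0"
    and mult_bilinear: "bilinear_map (piece A g) (piece A h) (piece A (g + h)) (pmult A g h)"
    and brk_bilinear: "bilinear_map (piece A g) (piece A h) (piece A (brdeg g h)) (pbrk A g h)"
    and mult_unit: "a \<in> elts A g \<Longrightarrow> pmult A 0 g (punit A) a = a"
    and mult_assoc:
      "\<lbrakk>a \<in> elts A g; b \<in> elts A h; c \<in> elts A k\<rbrakk> \<Longrightarrow>
         pmult A (g + h) k (pmult A g h a b) c = pmult A g (h + k) a (pmult A h k b c)"
    and mult_comm:
      "\<lbrakk>a \<in> elts A g; b \<in> elts A h\<rbrakk> \<Longrightarrow>
         pmult A g h a b = gsign g h \<odot>\<^bsub>piece A (g + h)\<^esub> pmult A h g b a"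
    and dmap_mult:
      "\<lbrakk>a \<in> elts A g; b \<in> elts A h\<rbrakk> \<Longrightarrow>
         dmap A (g + h) (pmult A g h a b)
         = pmult A (up g) h (dmap A g a) b
           \<oplus>\<^bsub>piece A (up (g + h))\<^esub>
           (-1) powi fst g \<odot>\<^bsub>piece A (up (g + h))\<^esub> pmult A g (up h) a (dmap A h b)"
    and brk_skew:
      "\<lbrakk>a \<in> elts A g; b \<in> elts A h\<rbrakk> \<Longrightarrow>
         pbrk A g h a b = (- gsign g h) \<odot>\<^bsub>piece A (brdeg g h)\<^esub> pbrk A h g b a"
    and brk_jacobi:
      "\<lbrakk>a \<in> elts A g; b \<in> elts A h; c \<in> elts A k\<rbrakk> \<Longrightarrow>
         pbrk A (brdeg g h) k (pbrk A g h a b) c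
         = pbrk A g (brdeg h k) a (pbrk A h k b c)
           \<oplus>\<^bsub>piece A (brdeg g (brdeg h k))\<^esub>
           (- gsign g h) \<odot>\<^bsub>piece A (brdeg g (brdeg h k))\<^esub>
             pbrk A h (brdeg g k) b (pbrk A g k a c)"
    and dmap_brk:
      "\<lbrakk>a \<in> elts A g; b \<in> elts A h\<rbrakk> \<Longrightarrow>
         dmap A (brdeg g h) (pbrk A g h a b)
         = pbrk A (up g) h (dmap A g a) b
           \<oplus>\<^bsub>piece A (up (brdeg g h))\<^esub>
           (-1) powi fst g \<odot>\<^bsub>piece A (up (brdeg g h))\<^esub> pbrk A g (up h) a (dmap A h b)"
    and brk_mult:
      "\<lbrakk>a \<in> elts A g; b \<in> elts A h; c \<in> elts A k\<rbrakk> \<Longrightarrow>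
         pbrk A g (h + k) a (pmult A h k b c)
         = pmult A (brdeg g h) k (pbrk A g h a b) c
           \<oplus>\<^bsub>piece A (brdeg g (h + k))\<^esub>
           gsign g h \<odot>\<^bsub>piece A (brdeg g (h + k))\<^esub> pmult A h (brdeg g k) b (pbrk A g k a c)"

text \<open>Left modules over the underlying graded commutative dg algebra.\<close>

locale wg_dg_module = A: wg_dg_poisson_algebra A + W: bigraded_complex W
  for A :: "('a, 'y) pois_alg_scheme" and W :: "('a, 'w, 'z) bg_mod_scheme" +
  assumes act_bilinear: "bilinear_map (piece A g) (piece W h) (piece W (g + h)) (act W g h)"
    and act_unit: "x \<in> elts W g \<Longrightarrow> act W 0 g (punit A) x = x"
    and act_assoc:
      "\<lbrakk>a \<in> elts A g; b \<in> elts A h; x \<in> elts W k\<rbrakk> \<Longrightarrow>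
         act W (g + h) k (pmult A g h a b) x = act W g (h + k) a (act W h k b x)"
    and dmap_act:
      "\<lbrakk>a \<in> elts A g; x \<in> elts W h\<rbrakk> \<Longrightarrow>
         dmap W (g + h) (act W g h a x)
         = act W (up g) h (dmap A g a) x
           \<oplus>\<^bsub>piece W (up (g + h))\<^esub>
           (-1) powi fst g \<odot>\<^bsub>piece W (up (g + h))\<^esub> act W g (up h) a (dmap W h x)"

locale wg_dg_poisson_module = wg_dg_module A W
  for A :: "('a, 'y) pois_alg_scheme" and W :: "('a, 'w, 'z) pois_mod_scheme" +
  assumes mbrk_bilinear:
      "bilinear_map (piece A g) (piece W h) (piece W (brdeg g h)) (mbrk W g h)"
    and mbrk_jacobi:
      "\<lbrakk>a \<in> elts A g; b \<in> elts A h; x \<in> elts W k\<rbrakk> \<Longrightarrow>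
         mbrk W (brdeg g h) k (pbrk A g h a b) x
         = mbrk W g (brdeg h k) a (mbrk W h k b x)
           \<oplus>\<^bsub>piece W (brdeg g (brdeg h k))\<^esub>
           (- gsign g h) \<odot>\<^bsub>piece W (brdeg g (brdeg h k))\<^esub>
             mbrk W h (brdeg g k) b (mbrk W g k a x)"
    and dmap_mbrk:
      "\<lbrakk>a \<in> elts A g; x \<in> elts W h\<rbrakk> \<Longrightarrow>
         dmap W (brdeg g h) (mbrk W g h a x)
         = mbrk W (up g) h (dmap A g a) x
           \<oplus>\<^bsub>piece W (up (brdeg g h))\<^esub>
           (-1) powi fst g \<odot>\<^bsub>piece W (up (brdeg g h))\<^esub> mbrk W g (up h) a (dmap W h x)"
    and mbrk_act:
      "\<lbrakk>a \<in> elts A g; b \<in> elts A h; x \<in> elts W k\<rbrakk> \<Longrightarrow>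
         mbrk W g (h + k) a (act W h k b x)
         = act W (brdeg g h) k (pbrk A g h a b) x
           \<oplus>\<^bsub>piece W (brdeg g (h + k))\<^esub>
           gsign g h \<odot>\<^bsub>piece W (brdeg g (h + k))\<^esub> act W h (brdeg g k) b (mbrk W g k a x)"
    and mult_mbrk:
      "\<lbrakk>a \<in> elts A g; b \<in> elts A h; x \<in> elts W k\<rbrakk> \<Longrightarrow>
         mbrk W (g + h) k (pmult A g h a b) x
         = act W g (brdeg h k) a (mbrk W h k b x)
           \<oplus>\<^bsub>piece W (brdeg g (h + k))\<^esub>
           gsign g h \<odot>\<^bsub>piece W (brdeg g (h + k))\<^esub> act W h (brdeg g k) b (mbrk W g k a x)"

definition wg_dg_module_hom ::
    "('a, 'y) pois_alg_scheme \<Rightarrow> ('a, 'w, 'z) bg_mod_scheme \<Rightarrow> ('a, 'w2, 'z2) bg_mod_scheme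
       \<Rightarrow> (bideg \<Rightarrow> 'w \<Rightarrow> 'w2) \<Rightarrow> bool" where
  "wg_dg_module_hom A W U F \<longleftrightarrow>
     wg_dg_module A W \<and> wg_dg_module A U \<and>
     (\<forall>g. linear_map (piece W g) (piece U g) (F g)) \<and>
     (\<forall>g. \<forall>x\<in>elts W g. F (up g) (dmap W g x) = dmap U g (F g x)) \<and>
     (\<forall>g h. \<forall>a\<in>elts A g. \<forall>x\<in>elts W h. F (g + h) (act W g h a x) = act U g h a (F h x))"

definition wg_dg_poisson_module_hom ::
    "('a, 'y) pois_alg_scheme \<Rightarrow> ('a, 'w, 'z) pois_mod_scheme \<Rightarrow> ('a, 'w2, 'z2) pois_mod_scheme
       \<Rightarrow> (bideg \<Rightarrow> 'w \<Rightarrow> 'w2) \<Rightarrow> bool" where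
  "wg_dg_poisson_module_hom A W U F \<longleftrightarrow>
     wg_dg_poisson_module A W \<and> wg_dg_poisson_module A U \<and> wg_dg_module_hom A W U F \<and>
     (\<forall>g h. \<forall>a\<in>elts A g. \<forall>x\<in>elts W h.
        F (brdeg g h) (mbrk W g h a x) = mbrk U g h a (F h x))"

definition surjective_hom ::
    "('w, 'z) bigraded_scheme \<Rightarrow> ('w2, 'z2) bigraded_scheme \<Rightarrow> (bideg \<Rightarrow> 'w \<Rightarrow> 'w2) \<Rightarrow> bool" where
  "surjective_hom W U F \<longleftrightarrow> (\<forall>g. F g ` elts W g = elts U g)"

text \<open>Restriction of scalars along \<open>\<phi>\<close>.\<close>

definition restrict_scalars ::
    "(bideg \<Rightarrow> 'b \<Rightarrow> 'a) \<Rightarrow> ('a, 'w) pois_mod \<Rightarrow> ('b, 'w) pois_mod" where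
  "restrict_scalars \<phi> W =
     \<lparr>piece = piece W, dmap = dmap W,
      act = (\<lambda>g h b. act W g h (\<phi> g b)), mbrk = (\<lambda>g h b. mbrk W g h (\<phi> g b))\<rparr>"


section \<open>Quotients\<close>

text \<open>
  \<open>quot s X J\<close> is the image of the subspace \<open>X\<close> in the quotient by \<open>J\<close>; \<open>J\<close> need not be
  contained in \<open>X\<close>.  Elements are cosets \<open>x +o J\<close>, added as sets.
  The fields \<open>mult\<close> and \<open>one\<close> play no role.
\<close>

definition quot :: "(complex \<Rightarrow> 'a \<Rightarrow> 'a) \<Rightarrow> 'a::plus set \<Rightarrow> 'a set \<Rightarrow> (complex, 'a set) module" where
  "quot s X J =
     \<lparr>carrier = (\<lambda>x. x +o J) ` X, mult = undefined, one = undefined, zero = J, add = (+),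
      smult = (\<lambda>c A. s c ` A + J)\<rparr>"

text \<open>
  The operation on classes induced by an operation \<open>F\<close> on representatives.  A value is
  specified only if \<open>F\<close> does not depend on the choice of representatives.
\<close>

definition induced :: "'x set \<Rightarrow> ('x \<Rightarrow> 'a) \<Rightarrow> ('x \<Rightarrow> 'c) \<Rightarrow> 'a \<Rightarrow> 'c" where
  "induced X cl F a = (THE c. \<forall>x\<in>X. cl x = a \<longrightarrow> c = F x)"

definition induced2 ::
    "'x set \<Rightarrow> ('x \<Rightarrow> 'a) \<Rightarrow> 'y set \<Rightarrow> ('y \<Rightarrow> 'b) \<Rightarrow> ('x \<Rightarrow> 'y \<Rightarrow> 'c) \<Rightarrow> 'a \<Rightarrow> 'b \<Rightarrow> 'c" where
  "induced2 X cl Y cl' F a b = (THE c. \<forall>x\<in>X. \<forall>y\<in>Y. cl x = a \<and> cl' y = b \<longrightarrow> c = F x y)"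

definition module_span :: "(complex, 'a) module \<Rightarrow> 'a set \<Rightarrow> 'a set" where
  "module_span P S = \<Inter>{N. submodule N C_ring P \<and> S \<subseteq> N}"

definition Vp :: "'v dgvoa \<Rightarrow> bideg \<Rightarrow> 'v set" where
  "Vp V g = dgr V (fst g) \<inter> wtspace V (snd g)"

definition Mp :: "('v, 'm) graded_mod \<Rightarrow> bideg \<Rightarrow> 'm set" where
  "Mp M g = dgr M (fst g) \<inter> mwt M (snd g)"


section \<open>The \<open>C\<^sub>2\<close>-algebra\<close>

definition C2 ::
    "(complex \<Rightarrow> 'm::ab_group_add \<Rightarrow> 'm) \<Rightarrow> 'm set \<Rightarrow> ('v \<Rightarrow> int \<Rightarrow> 'm \<Rightarrow> 'm) \<Rightarrow> 'm set" where
  "C2 s X Y = module.span s {Y u (-2) x | u x. x \<in> X}"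

definition C2V :: "'v::ab_group_add dgvoa \<Rightarrow> 'v set" where
  "C2V V = C2 (scl V) UNIV (vmode V)"

definition C2M :: "('v, 'm::ab_group_add) graded_mod \<Rightarrow> 'm set" where
  "C2M M = C2 (scl M) (car M) (mmode M)"

definition R_alg :: "'v::ab_group_add dgvoa \<Rightarrow> 'v set pois_alg" where
  "R_alg V =
     \<lparr>piece = (\<lambda>g. quot (scl V) (Vp V g) (C2V V)),
      dmap = (\<lambda>g. induced (Vp V g) (\<lambda>u. u +o C2V V) (\<lambda>u. dif V u +o C2V V)),
      punit = vac V +o C2V V,
      pmult = (\<lambda>g h. induced2 (Vp V g) (\<lambda>u. u +o C2V V) (Vp V h) (\<lambda>v. v +o C2V V)
                 (\<lambda>u v. vmode V u (-1) v +o C2V V)),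
      pbrk = (\<lambda>g h. induced2 (Vp V g) (\<lambda>u. u +o C2V V) (Vp V h) (\<lambda>v. v +o C2V V)
                 (\<lambda>u v. vmode V u 0 v +o C2V V))\<rparr>"

definition R_mod ::
    "'v::ab_group_add dgvoa \<Rightarrow> ('v, 'm::ab_group_add) graded_mod \<Rightarrow> ('v set, 'm set) pois_mod" where
  "R_mod V M =
     \<lparr>piece = (\<lambda>g. quot (scl M) (Mp M g) (C2M M)),
      dmap = (\<lambda>g. induced (Mp M g) (\<lambda>m. m +o C2M M) (\<lambda>m. dif M m +o C2M M)),
      act = (\<lambda>g h. induced2 (Vp V g) (\<lambda>u. u +o C2V V) (Mp M h) (\<lambda>m. m +o C2M M)
                 (\<lambda>u m. mmode M u (-1) m +o C2M M)),
      mbrk = (\<lambda>g h. induced2 (Vp V g) (\<lambda>u. u +o C2V V) (Mp M h) (\<lambda>m. m +o C2M M)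
                 (\<lambda>u m. mmode M u 0 m +o C2M M))\<rparr>"

definition R_map ::
    "('v, 'm::ab_group_add) graded_mod \<Rightarrow> ('v, 'm) graded_mod \<Rightarrow> ('m \<Rightarrow> 'm)
       \<Rightarrow> bideg \<Rightarrow> 'm set \<Rightarrow> 'm set" where
  "R_map M N f g = induced (Mp M g) (\<lambda>m. m +o C2M M) (\<lambda>m. f m +o C2M N)"


section \<open>The Zhu algebra and its associated bigraded object\<close>

text \<open>
  \<open>zhu s Y a r u x\<close> is the sum over \<open>n \<ge> 0\<close> of \<open>(a choose n) u\<^bsub>n - r\<^esub> x\<close>: for \<open>u\<close> of weight \<open>n\<close>
  this is the left product for \<open>a = n\<close>, \<open>r = 1\<close>, the circle product for \<open>a = n\<close>, \<open>r = 2\<close>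
  and, up to sign, the right product for \<open>a = n - 1\<close>, \<open>r = 1\<close>.
\<close>

definition zhu ::
    "(complex \<Rightarrow> 'm::ab_group_add \<Rightarrow> 'm) \<Rightarrow> ('v \<Rightarrow> int \<Rightarrow> 'm \<Rightarrow> 'm)
       \<Rightarrow> real \<Rightarrow> int \<Rightarrow> 'v \<Rightarrow> 'm \<Rightarrow> 'm" where
  "zhu s Y a r u x = Sum_any (\<lambda>n::nat. s (of_real a gchoose n) (Y u (int n - r) x))"

definition circ ::
    "(complex \<Rightarrow> 'm::ab_group_add \<Rightarrow> 'm) \<Rightarrow> ('v \<Rightarrow> int \<Rightarrow> 'm \<Rightarrow> 'm) \<Rightarrow> real \<Rightarrow> 'v \<Rightarrow> 'm \<Rightarrow> 'm" where
  "circ s Y n u x = zhu s Y n 2 u x"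

definition star_l ::
    "(complex \<Rightarrow> 'm::ab_group_add \<Rightarrow> 'm) \<Rightarrow> ('v \<Rightarrow> int \<Rightarrow> 'm \<Rightarrow> 'm)
       \<Rightarrow> bideg \<Rightarrow> 'v \<Rightarrow> 'm \<Rightarrow> 'm" where
  "star_l s Y g u x = zhu s Y (snd g) 1 u x"

text \<open>\<open>star_r s Y g h x u\<close> is the right product of \<open>x\<close> of bidegree \<open>h\<close> with \<open>u\<close> of bidegree \<open>g\<close>.\<close>

definition star_r ::
    "(complex \<Rightarrow> 'm::ab_group_add \<Rightarrow> 'm) \<Rightarrow> ('v \<Rightarrow> int \<Rightarrow> 'm \<Rightarrow> 'm)
       \<Rightarrow> bideg \<Rightarrow> bideg \<Rightarrow> 'm \<Rightarrow> 'v \<Rightarrow> 'm" where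
  "star_r s Y g h x u = s (gsign g h) (zhu s Y (snd g - 1) 1 u x)"

definition OV :: "'v::ab_group_add dgvoa \<Rightarrow> 'v set" where
  "OV V = module.span (scl V) {circ (scl V) (vmode V) n u v | n u v. u \<in> wtspace V n}"

definition OM :: "'v::ab_group_add dgvoa \<Rightarrow> ('v, 'm::ab_group_add) graded_mod \<Rightarrow> 'm set" where
  "OM V M =
     module.span (scl M) {circ (scl M) (mmode M) n u x | n u x. u \<in> wtspace V n \<and> x \<in> car M}"

definition IV :: "'v::ab_group_add dgvoa \<Rightarrow> bideg \<Rightarrow> 'v set" where
  "IV V g =
     OV V + module.span (scl V) (\<Union>{Vp V (q, m) | q m. q \<le> fst g \<and> m < snd g})
          + module.span (scl V) (\<Union>{Vp V (q, m) | q m. q < fst g \<and> m \<le> snd g})"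

definition JM :: "'v::ab_group_add dgvoa \<Rightarrow> ('v, 'm::ab_group_add) graded_mod \<Rightarrow> bideg \<Rightarrow> 'm set" where
  "JM V M g =
     OM V M + module.span (scl M) (\<Union>{Mp M (q, m) | q m. q \<le> fst g \<and> m < snd g})
            + module.span (scl M) (\<Union>{Mp M (q, m) | q m. q < fst g \<and> m \<le> snd g})"

definition grA_alg :: "'v::ab_group_add dgvoa \<Rightarrow> 'v set pois_alg" where
  "grA_alg V =
     \<lparr>piece = (\<lambda>g. quot (scl V) (Vp V g) (IV V g)),
      dmap = (\<lambda>g. induced (Vp V g) (\<lambda>u. u +o IV V g) (\<lambda>u. dif V u +o IV V (up g))),
      punit = vac V +o IV V 0,
      pmult = (\<lambda>g h. induced2 (Vp V g) (\<lambda>u. u +o IV V g) (Vp V h) (\<lambda>v. v +o IV V h)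
                 (\<lambda>u v. star_l (scl V) (vmode V) g u v +o IV V (g + h))),
      pbrk = (\<lambda>g h. induced2 (Vp V g) (\<lambda>u. u +o IV V g) (Vp V h) (\<lambda>v. v +o IV V h)
                 (\<lambda>u v. (star_l (scl V) (vmode V) g u v
                          - scl V (gsign g h) (star_l (scl V) (vmode V) h v u))
                        +o IV V (brdeg g h)))\<rparr>"

definition grA_mod ::
    "'v::ab_group_add dgvoa \<Rightarrow> ('v, 'm::ab_group_add) graded_mod \<Rightarrow> ('v set, 'm set) pois_mod" where
  "grA_mod V M =
     \<lparr>piece = (\<lambda>g. quot (scl M) (Mp M g) (JM V M g)),
      dmap = (\<lambda>g. induced (Mp M g) (\<lambda>m. m +o JM V M g) (\<lambda>m. dif M m +o JM V M (up g))),
      act = (\<lambda>g h. induced2 (Vp V g) (\<lambda>u. u +o IV V g) (Mp M h) (\<lambda>m. m +o JM V M h)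
                 (\<lambda>u m. star_l (scl M) (mmode M) g u m +o JM V M (g + h))),
      mbrk = (\<lambda>g h. induced2 (Vp V g) (\<lambda>u. u +o IV V g) (Mp M h) (\<lambda>m. m +o JM V M h)
                 (\<lambda>u m. (star_l (scl M) (mmode M) g u m
                          - scl M (gsign g h) (star_r (scl M) (mmode M) g h m u))
                        +o JM V M (brdeg g h)))\<rparr>"

definition grA_map ::
    "'v::ab_group_add dgvoa \<Rightarrow> ('v, 'm::ab_group_add) graded_mod \<Rightarrow> ('v, 'm) graded_mod
       \<Rightarrow> ('m \<Rightarrow> 'm) \<Rightarrow> bideg \<Rightarrow> 'm set \<Rightarrow> 'm set" where
  "grA_map V M N f g = induced (Mp M g) (\<lambda>m. m +o JM V M g) (\<lambda>m. f m +o JM V N g)"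


section \<open>The functor \<open>\<eta>\<close> applied to \<open>R(M)\<close>\<close>

definition eta :: "'v::ab_group_add dgvoa \<Rightarrow> bideg \<Rightarrow> 'v set \<Rightarrow> 'v set" where
  "eta V g = induced (Vp V g) (\<lambda>u. u +o C2V V) (\<lambda>u. u +o IV V g)"

definition ker_eta :: "'v::ab_group_add dgvoa \<Rightarrow> bideg \<Rightarrow> 'v set set" where
  "ker_eta V g = {a \<in> elts (R_alg V) g. eta V g a = \<zero>\<^bsub>piece (grA_alg V) g\<^esub>}"

text \<open>The component of bidegree \<open>g\<close> of \<open>(Ker \<eta>) R(M)\<close>.\<close>

definition KR ::
    "'v::ab_group_add dgvoa \<Rightarrow> ('v, 'm::ab_group_add) graded_mod \<Rightarrow> bideg \<Rightarrow> 'm set set" where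
  "KR V M g =
     module_span (piece (R_mod V M) g)
       {act (R_mod V M) h k a x | h k a x.
          h + k = g \<and> a \<in> ker_eta V h \<and> x \<in> elts (R_mod V M) k}"

definition eta_bigraded ::
    "'v::ab_group_add dgvoa \<Rightarrow> ('v, 'm::ab_group_add) graded_mod \<Rightarrow> 'm set set bigraded" where
  "eta_bigraded V M =
     \<lparr>piece = (\<lambda>g. quot (smult (piece (R_mod V M) g)) (elts (R_mod V M) g) (KR V M g)),
      dmap = (\<lambda>g. induced (elts (R_mod V M) g) (\<lambda>x. x +o KR V M g)
                 (\<lambda>x. dmap (R_mod V M) g x +o KR V M (up g)))\<rparr>"

text \<open>
  \<open>R(M)/(Ker \<eta>)R(M)\<close> with the operations of \<open>gr A(V)\<close>: an element of \<open>gr A(V)\<close> acts, and has a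
  bracket, through its preimages under \<open>\<eta>\<close>.  The action does not depend on the preimage.  The
  bracket does not depend on it precisely when \<open>eta_brackets_descend\<close> below holds.
\<close>

definition eta_mod ::
    "'v::ab_group_add dgvoa \<Rightarrow> ('v, 'm::ab_group_add) graded_mod \<Rightarrow> ('v set, 'm set set) pois_mod" where
  "eta_mod V M =
     \<lparr>piece = piece (eta_bigraded V M), dmap = dmap (eta_bigraded V M),
      act = (\<lambda>g h. induced2 (elts (R_alg V) g) (eta V g)
                 (elts (R_mod V M) h) (\<lambda>x. x +o KR V M h)
                 (\<lambda>a x. act (R_mod V M) g h a x +o KR V M (g + h))),
      mbrk = (\<lambda>g h. induced2 (elts (R_alg V) g) (eta V g)
                 (elts (R_mod V M) h) (\<lambda>x. x +o KR V M h)
                 (\<lambda>a x. mbrk (R_mod V M) g h a x +o KR V M (brdeg g h)))\<rparr>"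

definition eta_brackets_descend ::
    "'v::ab_group_add dgvoa \<Rightarrow> ('v, 'm::ab_group_add) graded_mod \<Rightarrow> bool" where
  "eta_brackets_descend V M \<longleftrightarrow>
     (\<forall>g h. \<forall>a\<in>ker_eta V g. \<forall>x\<in>elts (R_mod V M) h.
        mbrk (R_mod V M) g h a x \<in> KR V M (brdeg g h))"

text \<open>
  The same quotient with the action and bracket of \<open>R(V)\<close> induced from \<open>R(M)\<close>.  This is a dg
  Poisson \<open>R(V)\<close>-module without any condition on \<open>M\<close>.
\<close>

definition eta_mod_R ::
    "'v::ab_group_add dgvoa \<Rightarrow> ('v, 'm::ab_group_add) graded_mod \<Rightarrow> ('v set, 'm set set) pois_mod" where
  "eta_mod_R V M =
     \<lparr>piece = piece (eta_bigraded V M), dmap = dmap (eta_bigraded V M),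
      act = (\<lambda>g h a. induced (elts (R_mod V M) h) (\<lambda>x. x +o KR V M h)
                 (\<lambda>x. act (R_mod V M) g h a x +o KR V M (g + h))),
      mbrk = (\<lambda>g h a. induced (elts (R_mod V M) h) (\<lambda>x. x +o KR V M h)
                 (\<lambda>x. mbrk (R_mod V M) g h a x +o KR V M (brdeg g h)))\<rparr>"

definition eta_map ::
    "'v::ab_group_add dgvoa \<Rightarrow> ('v, 'm::ab_group_add) graded_mod \<Rightarrow> ('v, 'm) graded_mod
       \<Rightarrow> ('m \<Rightarrow> 'm) \<Rightarrow> bideg \<Rightarrow> 'm set set \<Rightarrow> 'm set set" where
  "eta_map V M N f g =
     induced (elts (R_mod V M) g) (\<lambda>x. x +o KR V M g) (\<lambda>x. R_map M N f g x +o KR V N g)"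


section \<open>Functors and natural transformations\<close>

text \<open>
  Functors, given on objects and morphisms, from graded dg \<open>V\<close>-modules to weight graded dg
  \<open>A\<close>-modules.
\<close>

definition functor_to_modules ::
    "'v::ab_group_add dgvoa \<Rightarrow> ('a, 'y) pois_alg_scheme
       \<Rightarrow> (('v, 'm::ab_group_add) graded_mod \<Rightarrow> ('a, 'w, 'z) bg_mod_scheme)
       \<Rightarrow> (('v, 'm) graded_mod \<Rightarrow> ('v, 'm) graded_mod \<Rightarrow> ('m \<Rightarrow> 'm) \<Rightarrow> bideg \<Rightarrow> 'w \<Rightarrow> 'w) \<Rightarrow> bool" where
  "functor_to_modules V A Fo Fm \<longleftrightarrow>
     (\<forall>M. graded_dg_module V M \<longrightarrow> wg_dg_module A (Fo M)) \<and>
     (\<forall>M N f. graded_dg_module_hom V M N f \<longrightarrow> wg_dg_module_hom A (Fo M) (Fo N) (Fm M N f)) \<and>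
     (\<forall>M. graded_dg_module V M \<longrightarrow> (\<forall>g. \<forall>x\<in>elts (Fo M) g. Fm M M id g x = x)) \<and>
     (\<forall>M N L f k. graded_dg_module_hom V M N f \<and> graded_dg_module_hom V N L k \<longrightarrow>
        (\<forall>g. \<forall>x\<in>elts (Fo M) g. Fm M L (k \<circ> f) g x = Fm N L k g (Fm M N f g x)))"

definition natural_transformation ::
    "'v::ab_group_add dgvoa \<Rightarrow> ('a, 'y) pois_alg_scheme
       \<Rightarrow> (('v, 'm::ab_group_add) graded_mod \<Rightarrow> ('a, 'w, 'z) bg_mod_scheme)
       \<Rightarrow> (('v, 'm) graded_mod \<Rightarrow> ('v, 'm) graded_mod \<Rightarrow> ('m \<Rightarrow> 'm) \<Rightarrow> bideg \<Rightarrow> 'w \<Rightarrow> 'w)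
       \<Rightarrow> (('v, 'm) graded_mod \<Rightarrow> ('a, 'w2, 'z2) bg_mod_scheme)
       \<Rightarrow> (('v, 'm) graded_mod \<Rightarrow> ('v, 'm) graded_mod \<Rightarrow> ('m \<Rightarrow> 'm) \<Rightarrow> bideg \<Rightarrow> 'w2 \<Rightarrow> 'w2)
       \<Rightarrow> (('v, 'm) graded_mod \<Rightarrow> bideg \<Rightarrow> 'w \<Rightarrow> 'w2) \<Rightarrow> bool" where
  "natural_transformation V A Fo Fm Go Gm \<Psi> \<longleftrightarrow>
     functor_to_modules V A Fo Fm \<and> functor_to_modules V A Go Gm \<and>
     (\<forall>M. graded_dg_module V M \<longrightarrow> wg_dg_module_hom A (Fo M) (Go M) (\<Psi> M)) \<and>
     (\<forall>M N f. graded_dg_module_hom V M N f \<longrightarrow>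
        (\<forall>g. \<forall>x\<in>elts (Fo M) g. \<Psi> N g (Fm M N f g x) = Gm M N f g (\<Psi> M g x)))"

end

theory Submission
  imports Defs "HOL-Computational_Algebra.Formal_Power_Series"
begin

text \<open>
  The filtration on \<open>A(M)\<close> is chosen so that Zhu's operations, which are infinite combinations of modes,
  have a single mode as leading term: modulo lower bidegree the product \<open>u * m\<close> is \<open>u\<^bsub>-1\<^esub>m\<close>, the commutator
  is \<open>u\<^sub>0m\<close>, and the relation \<open>u \<circ> m\<close> is \<open>u\<^bsub>-2\<^esub>m\<close>.  Hence both \<open>R(M)\<close> and the graded space of \<open>A(M)\<close> are, in
  every bidegree, quotients of the same component of \<open>M\<close> with operations induced by the modes \<open>-1\<close> and \<open>0\<close>,
  and the relations of the second contain those of the first (\<open>C2M_Mp_JM\<close>).  The map sending the class of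
  \<open>m\<close> to the class of \<open>m\<close> is then a surjection compatible with everything, and it kills
  \<open>(Ker \<eta>) R(M)\<close> because an element of \<open>V\<close> that vanishes in the graded algebra also acts by zero on the graded
  module (\<open>IV_product\<close>).

  This splits the proof into three parts.  First, the modes \<open>-1\<close> and \<open>0\<close> satisfy the axioms of a dg Poisson
  module up to \<open>C\<^sub>2(M)\<close>; apart from the compatibility with the differential each axiom is an instance of the Jacobi
  identity in which all but the leading terms end with a mode below \<open>-1\<close>.  A quotient with well defined operations and with relations containing
  \<open>C\<^sub>2(M)\<close> is therefore a dg Poisson module; the locales of presentations record this once, and it is used for
  \<open>R(M)\<close>, the graded module, its restriction along \<open>\<eta>\<close>, and both structures on the quotient of \<open>R(M)\<close>.

  Secondly, the operations on the graded module are well defined.  This is where the Zhu algebra enters: the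
  left product and the commutator with an element of \<open>V\<close> preserve \<open>O(M)\<close>, and those with an element of \<open>O(V)\<close> map
  \<open>M\<close> into \<open>O(M)\<close>.  All four statements are instances of one identity, \<open>zhu_jacobi\<close>, the Jacobi identity weighted
  by powers of \<open>1 + x\<close>.  The exponents are weights, hence half-integers, and on coefficients the identity is
  Vandermonde's convolution for generalized binomial coefficients.  For the algebra the bracket is defined through
  the commutator of left products, whose leading term is found by skew symmetry (\<open>star_commutator_IV\<close>).

  Thirdly, \<open>(Ker \<eta>) R(M)\<close> has to be described by representatives in \<open>M\<close> (\<open>KR_eq\<close>), after which it is
  seen to be stable under the operations that must descend.

  The algebra is a graded dg module over itself, which turns most statements on modules into statements on it.
\<close>

section \<open>Linear maps, direct sums and finitely supported sums\<close>

lemma linear_on_add: "linear_on s t X f \<Longrightarrow> x \<in> X \<Longrightarrow> y \<in> X \<Longrightarrow> f (x + y) = f x + f y"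
  and linear_on_scale: "linear_on s t X f \<Longrightarrow> x \<in> X \<Longrightarrow> f (s c x) = t c (f x)"
  by (auto simp: linear_on_def)

lemma linear_on_subset: "linear_on s t X f \<Longrightarrow> Y \<subseteq> X \<Longrightarrow> linear_on s t Y f"
  unfolding linear_on_def by blast

lemma linear_on_zero:
  fixes f :: "'a::ab_group_add \<Rightarrow> 'b::ab_group_add"
  assumes "linear_on s t X f" "0 \<in> X" shows "f 0 = 0"
  using linear_on_add[OF assms(1,2,2)] by simp

lemma linear_on_sum:
  fixes f :: "'a::ab_group_add \<Rightarrow> 'b::ab_group_add"
  assumes vs: "vector_space s" and f: "linear_on s t X f" and X: "module.subspace s X"
    and "finite F" "\<And>i. i \<in> F \<Longrightarrow> x i \<in> X"
  shows "f (\<Sum>i\<in>F. x i) = (\<Sum>i\<in>F. f (x i))"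
proof -
  interpret vector_space s by (rule vs)
  show ?thesis using assms(4,5)
  proof (induction F)
    case empty
    then show ?case using linear_on_zero[OF f] subspace_0[OF X] by simp
  next
    case (insert i F)
    then have "(\<Sum>i\<in>F. x i) \<in> X" by (intro subspace_sum[OF X]) auto
    with insert show ?case by (simp add: linear_on_add[OF f])
  qed
qed

lemma linear_on_diff:
  fixes f :: "'a::ab_group_add \<Rightarrow> 'b::ab_group_add"
  assumes vs: "vector_space s" and f: "linear_on s t X f" and X: "module.subspace s X"
    and "x \<in> X" "y \<in> X"
  shows "f (x - y) = f x - f y"
proof -
  interpret vector_space s by (rule vs)
  have "f (x - y) + f y = f x"
    using linear_on_add[OF f, of "x - y" y] subspace_diff[OF X] assms(4,5) by simp
  then show ?thesis by (simp add: algebra_simps)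
qed

text \<open>
  A map that is linear only on the underlying space of a complex is not an instance of the linear maps between types,
  so the standard facts on images of spans do not apply to it.
\<close>

lemma linear_on_span_into:
  fixes f :: "'a::ab_group_add \<Rightarrow> 'b::ab_group_add"
  assumes vs: "vector_space s" "vector_space t" and f: "linear_on s t X f"
    and X: "module.subspace s X" and S: "S \<subseteq> X" and T: "module.subspace t T"
    and ST: "\<And>x. x \<in> S \<Longrightarrow> f x \<in> T" and x: "x \<in> module.span s S"
  shows "f x \<in> T"
proof -
  interpret s: vector_space s by (rule vs)
  interpret t: vector_space t by (rule vs)
  have "s.subspace {x \<in> X. f x \<in> T}"
    using s.subspace_0[OF X] s.subspace_add[OF X] s.subspace_scale[OF X]
      t.subspace_0[OF T] t.subspace_add[OF T] t.subspace_scale[OF T]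
    by (auto simp: s.subspace_def linear_on_zero[OF f] linear_on_add[OF f] linear_on_scale[OF f])
  then have "module.span s S \<subseteq> {x \<in> X. f x \<in> T}"
    using S ST by (intro s.span_minimal) auto
  with x show ?thesis by auto
qed

lemma direct_sum_subspace:
  assumes "vector_space s" "direct_sum_on s X I A"
  shows "i \<in> I \<Longrightarrow> module.subspace s (A i)" "module.subspace s X" "i \<in> I \<Longrightarrow> A i \<subseteq> X"
proof -
  interpret vector_space s by (rule assms)
  show "i \<in> I \<Longrightarrow> subspace (A i)" "subspace X" "i \<in> I \<Longrightarrow> A i \<subseteq> X"
    using assms(2) by (auto simp: direct_sum_on_def intro: subspace_span span_base)
qed

text \<open>
  A family indexed by all summands, rather than a sum over some finite set of them: two decompositions can then be
  added and compared.
\<close>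

definition components :: "(complex \<Rightarrow> 'a::ab_group_add \<Rightarrow> 'a) \<Rightarrow> 'i set \<Rightarrow> ('i \<Rightarrow> 'a set) \<Rightarrow> 'a \<Rightarrow> ('i \<Rightarrow> 'a) \<Rightarrow> bool"
  where "components s I A x f \<longleftrightarrow>
    finite {i. f i \<noteq> 0} \<and> {i. f i \<noteq> 0} \<subseteq> I \<and> (\<forall>i\<in>I. f i \<in> A i) \<and> x = Sum_any f"

lemma components_add:
  assumes "vector_space s" "direct_sum_on s X I A" "components s I A x f" "components s I A y g"
  shows "components s I A (x + y) (\<lambda>i. f i + g i)"
proof -
  interpret vector_space s by (rule assms)
  have sub: "{i. f i + g i \<noteq> 0} \<subseteq> {i. f i \<noteq> 0} \<union> {i. g i \<noteq> 0}" by auto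
  have fin: "finite {i. f i \<noteq> 0}" "finite {i. g i \<noteq> 0}"
    using assms(3,4) by (simp_all add: components_def)
  show ?thesis
    unfolding components_def
  proof (intro conjI ballI)
    show "finite {i. f i + g i \<noteq> 0}"
      by (rule finite_subset[OF sub]) (simp add: fin)
    show "{i. f i + g i \<noteq> 0} \<subseteq> I"
      using sub assms(3,4) by (auto simp: components_def)
    show "f i + g i \<in> A i" if "i \<in> I" for i
      using that assms(3,4) by (intro subspace_add[OF direct_sum_subspace(1)[OF assms(1,2)]])
        (auto simp: components_def)
    show "x + y = Sum_any (\<lambda>i. f i + g i)"
      using assms(3,4) by (simp add: components_def Sum_any.distrib[OF fin])
  qed
qed

lemma components_scale:
  assumes "vector_space s" "direct_sum_on s X I A" "components s I A x f"
  shows "components s I A (s c x) (\<lambda>i. s c (f i))"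
proof -
  interpret vector_space s by (rule assms)
  have sub: "{i. s c (f i) \<noteq> 0} \<subseteq> {i. f i \<noteq> 0}" by auto
  have fin: "finite {i. f i \<noteq> 0}" using assms(3) by (simp add: components_def)
  have "Sum_any (\<lambda>i. s c (f i)) = (\<Sum>i\<in>{i. f i \<noteq> 0}. s c (f i))"
    by (rule Sum_any.expand_superset[OF fin sub])
  then have "Sum_any (\<lambda>i. s c (f i)) = s c x"
    using assms(3) by (simp add: components_def Sum_any.expand_set scale_sum_right)
  then show ?thesis
    using assms(3) direct_sum_subspace[OF assms(1,2)] sub finite_subset[OF sub fin]
    by (auto simp: components_def intro: subspace_scale)
qed

lemma components_single:
  assumes "vector_space s" "direct_sum_on s X I A" "i \<in> I" "x \<in> A i"
  shows "components s I A x (\<lambda>j. if j = i then x else 0)"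
proof -
  interpret vector_space s by (rule assms)
  have "{j. (if j = i then x else 0) \<noteq> 0} \<subseteq> {i}" by auto
  then show ?thesis
    using assms(3,4) direct_sum_subspace(1)[OF assms(1,2)] finite_subset
    by (auto simp: components_def subspace_0)
qed

lemma components_exist:
  assumes "vector_space s" "direct_sum_on s X I A" "x \<in> X"
  shows "\<exists>f. components s I A x f"
proof -
  interpret vector_space s by (rule assms)
  have "x \<in> span (\<Union>i\<in>I. A i)" using assms(2,3) by (simp add: direct_sum_on_def)
  then show ?thesis
  proof (induction rule: span_induct_alt)
    case base
    have "components s I A 0 (\<lambda>_. 0)"
      using direct_sum_subspace(1)[OF assms(1,2)] by (auto simp: components_def subspace_0)
    then show ?case by blast
  next
    case (step c x y)
    then obtain i where "i \<in> I" "x \<in> A i" by auto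
    with step show ?case
      using components_add[OF assms(1,2) components_scale[OF assms(1,2) components_single[OF assms(1,2)]]]
      by blast
  qed
qed

lemma components_unique:
  assumes vs: "vector_space s" and ds: "direct_sum_on s X I A"
    and f: "components s I A x f" and g: "components s I A x g"
  shows "f = g"
proof -
  interpret vector_space s by (rule assms)
  let ?F = "{i. f i \<noteq> 0} \<union> {i. g i \<noteq> 0}"
  have F: "finite ?F" "?F \<subseteq> I" using f g by (auto simp: components_def)
  have "(\<Sum>i\<in>?F. f i - g i) = 0"
    using f g F(1) Sum_any.expand_superset[OF F(1), of f] Sum_any.expand_superset[OF F(1), of g]
    by (auto simp: components_def sum_subtractf)
  moreover have "\<forall>i\<in>?F. f i - g i \<in> A i"
    using f g F(2) direct_sum_subspace(1)[OF vs ds] by (auto simp: components_def intro!: subspace_diff)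
  ultimately have "\<forall>i\<in>?F. f i - g i = 0"
    using ds F unfolding direct_sum_on_def by meson
  then show ?thesis by (intro ext) (metis (mono_tags) UnCI eq_iff_diff_eq_0 mem_Collect_eq)
qed

text \<open>
  The universal property of a direct sum.  It extends Zhu's operators, which are given by a formula on each weight
  space, to all of \<open>V\<close>.
\<close>

lemma direct_sum_linear_extension:
  fixes \<phi> :: "'i \<Rightarrow> 'a::ab_group_add \<Rightarrow> 'b::ab_group_add"
  assumes vs: "vector_space s" and vt: "vector_space t" and ds: "direct_sum_on s X I A"
    and lin: "\<And>i. i \<in> I \<Longrightarrow> linear_on s t (A i) (\<phi> i)"
  obtains \<Phi> where "linear_on s t X \<Phi>" "\<And>i x. i \<in> I \<Longrightarrow> x \<in> A i \<Longrightarrow> \<Phi> x = \<phi> i x"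
proof -
  interpret s: vector_space s by (rule vs)
  interpret t: vector_space t by (rule vt)
  define co where "co x = (SOME f. components s I A x f)" for x
  have co: "components s I A x (co x)" if "x \<in> X" for x
    unfolding co_def using components_exist[OF vs ds that] by (rule someI_ex)
  have co_eq: "co x = f" if "x \<in> X" "components s I A x f" for x f
    using components_unique[OF vs ds co[OF that(1)] that(2)] .
  have sub: "s.subspace X" by (rule direct_sum_subspace[OF vs ds])
  define \<Phi> where "\<Phi> x = (\<Sum>i\<in>{i. co x i \<noteq> 0}. \<phi> i (co x i))" for x
  have z: "\<phi> i 0 = 0" if "i \<in> I" for i
    by (rule linear_on_zero[OF lin[OF that]]) (use that direct_sum_subspace(1)[OF vs ds] s.subspace_0 in blast)
  have \<Phi>: "\<Phi> x = (\<Sum>i\<in>F. \<phi> i (co x i))" if "finite F" "{i. co x i \<noteq> 0} \<subseteq> F" "F \<subseteq> I" for x F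
    unfolding \<Phi>_def using that by (intro sum.mono_neutral_left) (auto simp: z)
  show ?thesis
  proof
    show "linear_on s t X \<Phi>"
      unfolding linear_on_def
    proof (intro conjI ballI allI)
      fix x y assume xy: "x \<in> X" "y \<in> X"
      let ?F = "{i. co x i \<noteq> 0} \<union> {i. co y i \<noteq> 0}"
      have c: "co (x + y) = (\<lambda>i. co x i + co y i)"
        by (intro co_eq components_add[OF vs ds] co s.subspace_add[OF sub] xy)
      have F: "finite ?F" "?F \<subseteq> I" using co[OF xy(1)] co[OF xy(2)] by (auto simp: components_def)
      have "\<Phi> (x + y) = (\<Sum>i\<in>?F. \<phi> i (co x i + co y i))"
        by (subst \<Phi>[OF F(1) _ F(2)]) (auto simp: c)
      also have "\<dots> = (\<Sum>i\<in>?F. \<phi> i (co x i) + \<phi> i (co y i))"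
        using co[OF xy(1)] co[OF xy(2)] F(2)
        by (intro sum.cong refl linear_on_add[OF lin]) (auto simp: components_def)
      also have "\<dots> = \<Phi> x + \<Phi> y"
        using \<Phi>[OF F(1) _ F(2), of x] \<Phi>[OF F(1) _ F(2), of y] by (simp add: sum.distrib)
      finally show "\<Phi> (x + y) = \<Phi> x + \<Phi> y" .
    next
      fix c x assume x: "x \<in> X"
      let ?F = "{i. co x i \<noteq> 0}"
      have e: "co (s c x) = (\<lambda>i. s c (co x i))"
        by (intro co_eq components_scale[OF vs ds] co s.subspace_scale[OF sub] x)
      have F: "finite ?F" "?F \<subseteq> I" using co[OF x] by (auto simp: components_def)
      have "\<Phi> (s c x) = (\<Sum>i\<in>?F. \<phi> i (s c (co x i)))"
        using \<Phi>[OF F(1) _ F(2), of "s c x"] by (auto simp: e)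
      also have "\<dots> = (\<Sum>i\<in>?F. t c (\<phi> i (co x i)))"
        using co[OF x] F(2)
        by (intro sum.cong refl linear_on_scale[OF lin]) (auto simp: components_def)
      also have "\<dots> = t c (\<Phi> x)"
        by (simp add: \<Phi>_def t.scale_sum_right)
      finally show "\<Phi> (s c x) = t c (\<Phi> x)" .
    qed
    fix i x assume ix: "i \<in> I" "x \<in> A i"
    have "co x = (\<lambda>j. if j = i then x else 0)"
      using ix direct_sum_subspace(3)[OF vs ds] by (intro co_eq components_single[OF vs ds]) auto
    then show "\<Phi> x = \<phi> i x" using ix by (subst \<Phi>[of "{i}"]) auto
  qed
qed

lemma eventually_zero_finite:
  assumes "\<exists>N. \<forall>n\<ge>N. f n = (0::'a::zero)" shows "finite {n::nat. f n \<noteq> 0}"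
proof -
  obtain N where "\<forall>n\<ge>N. f n = 0" using assms by blast
  then have "{n. f n \<noteq> 0} \<subseteq> {..<N}" by (auto simp: not_le[symmetric])
  then show ?thesis by (rule finite_subset) simp
qed

lemma Sum_any_only_0:
  assumes "\<And>i. i \<noteq> 0 \<Longrightarrow> f i = 0"
  shows "Sum_any f = f (0::nat)"
proof -
  have "Sum_any f = sum f {0}"
    by (rule Sum_any.expand_superset) (use assms in auto)
  then show ?thesis by simp
qed

lemma Sum_any_eq_lessThan:
  assumes "\<And>i. i \<ge> N \<Longrightarrow> f i = 0" shows "Sum_any f = (\<Sum>i<(N::nat). f i)"
proof (rule Sum_any.expand_superset)
  show "{i. f i \<noteq> 0} \<subseteq> {..<N}" using assms not_less by blast
qed simp

lemma (in vector_space) Sum_any_initial: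
  assumes S: "subspace S" and fin: "finite {i::nat. f i \<noteq> 0}" and tail: "\<And>i. i \<ge> N \<Longrightarrow> f i \<in> S"
  shows "Sum_any f - (\<Sum>i<N. f i) \<in> S"
proof -
  have "Sum_any f = sum f ({..<N} \<union> ({i. f i \<noteq> 0} - {..<N}))"
    by (rule Sum_any.expand_superset) (use fin in auto)
  also have "\<dots> = (\<Sum>i<N. f i) + sum f ({i. f i \<noteq> 0} - {..<N})"
    using fin by (intro sum.union_disjoint) auto
  finally have "Sum_any f - (\<Sum>i<N. f i) = sum f ({i. f i \<noteq> 0} - {..<N})" by simp
  also have "\<dots> \<in> S" by (rule subspace_sum[OF S]) (use tail in auto)
  finally show ?thesis .
qed

lemma (in vector_space) Sum_any_head:
  assumes "subspace S" "finite {i::nat. f i \<noteq> 0}" "\<And>i. i > 0 \<Longrightarrow> f i \<in> S"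
  shows "Sum_any f - f 0 \<in> S"
  using Sum_any_initial[of S f 1] assms by simp

lemma (in vector_space) Sum_any_in_subspace:
  assumes S: "subspace S" and "\<And>i. f i \<in> S"
  shows "Sum_any f \<in> S"
  by (auto simp: Sum_any.expand_set intro: subspace_sum[OF S] assms)

lemma (in vector_space) subspace_set_plus:
  assumes "subspace A" "subspace B" shows "subspace (A + B)"
proof -
  have "A + B = {x + y | x y. x \<in> A \<and> y \<in> B}" by (auto simp: set_plus_def)
  then show ?thesis using subspace_sums[OF assms] by simp
qed

section \<open>Consequences of the Jacobi identity\<close>

sublocale cochain_complex \<subseteq> vs: vector_space "scl C"
  by (rule vector_space)

context cochain_complex
begin

lemma car_subspace: "vs.subspace (car C)"
  and dgr_subspace: "vs.subspace (dgr C p)"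
  and dgr_car: "dgr C p \<subseteq> car C"
  using direct_sum_subspace[OF vector_space degree_decomposition] by auto

lemma car_eq_span: "car C = vs.span (\<Union>p. dgr C p)"
  using degree_decomposition by (simp add: direct_sum_on_def)

lemma dif_car: "x \<in> car C \<Longrightarrow> dif C x \<in> car C"
  using linear_on_span_into[OF vector_space vector_space dif_linear car_subspace _ car_subspace, of "\<Union>p. dgr C p" x]
    dif_degree dgr_car by (auto simp: car_eq_span[symmetric])

end

lemma minus_one_powi: "(-1) powi n = (if even n then 1 else -1 :: complex)"
  by (simp add: power_int_def minus_one_power_iff even_nat_iff)

lemma ksign_simps [simp]: "ksign 0 q = 1" "ksign p 0 = 1" "ksign 4 q = 1" "ksign p 4 = 1"
  by (simp_all add: ksign_def minus_one_powi)

lemma ksign_square [simp]: "ksign p q * ksign p q = 1"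
  by (simp add: ksign_def minus_one_powi)

context weak_dg_module
begin

lemma mode_add_left: "w \<in> car M \<Longrightarrow> mmode M (u + v) n w = mmode M u n w + mmode M v n w"
  and mode_scale_left: "w \<in> car M \<Longrightarrow> mmode M (scl V c u) n w = scl M c (mmode M u n w)"
  using linear_on_add[OF mode_linear_left] linear_on_scale[OF mode_linear_left] by simp_all

lemma mode_add_right: "w \<in> car M \<Longrightarrow> x \<in> car M \<Longrightarrow> mmode M u n (w + x) = mmode M u n w + mmode M u n x"
  and mode_scale_right: "w \<in> car M \<Longrightarrow> mmode M u n (scl M c w) = scl M c (mmode M u n w)"
  and mode_zero_right [simp]: "mmode M u n 0 = 0"
  and mode_diff_right: "w \<in> car M \<Longrightarrow> x \<in> car M \<Longrightarrow> mmode M u n (w - x) = mmode M u n w - mmode M u n x"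
  using linear_on_add[OF mode_linear_right] linear_on_scale[OF mode_linear_right]
    linear_on_zero[OF mode_linear_right] linear_on_diff[OF M.vector_space mode_linear_right M.car_subspace]
    M.vs.subspace_0[OF M.car_subspace] by simp_all

lemma mode_zero_left [simp]: "w \<in> car M \<Longrightarrow> mmode M 0 n w = 0"
  and mode_diff_left: "w \<in> car M \<Longrightarrow> mmode M (u - v) n w = mmode M u n w - mmode M v n w"
  using linear_on_zero[OF mode_linear_left] linear_on_diff[OF V.vector_space mode_linear_left V.vs.subspace_UNIV]
  by simp_all

lemma V_span_dgr: "u \<in> V.vs.span (\<Union>p. dgr V p)"
  using V.car_eq_span V.car_UNIV by auto

text \<open>
  The Jacobi identity is given for homogeneous vectors; statements linear in a vector extend from these to all vectors.
\<close>

lemma linear_homogeneous_into: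
  assumes "linear_on (scl V) (scl M) UNIV f" "M.vs.subspace T" "\<And>p u. u \<in> dgr V p \<Longrightarrow> f u \<in> T"
  shows "f u \<in> T"
  by (rule linear_on_span_into[OF V.vector_space M.vector_space assms(1) V.vs.subspace_UNIV _ assms(2) _ V_span_dgr])
    (use assms(3) in auto)

lemma linear_homogeneous_eq:
  assumes "linear_on (scl V) (scl M) UNIV f" "linear_on (scl V) (scl M) UNIV g"
    "\<And>p u. u \<in> dgr V p \<Longrightarrow> f u = g u"
  shows "f u = g u"
proof -
  have "linear_on (scl V) (scl M) UNIV (\<lambda>u. f u - g u)"
    using assms(1,2) by (simp add: linear_on_def M.vs.scale_right_diff_distrib)
  from linear_homogeneous_into[OF this M.vs.subspace_single_0] assms(3) show ?thesis by simp
qed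

lemma mode_car: "w \<in> car M \<Longrightarrow> mmode M u n w \<in> car M"
proof -
  assume w: "w \<in> car M"
  have "mmode M u n w \<in> car M" if u: "u \<in> dgr V p" for u p
    by (rule linear_on_span_into[OF M.vector_space M.vector_space mode_linear_right M.car_subspace _ M.car_subspace,
          of "\<Union>q. dgr M q"])
      (use w M.car_eq_span M.dgr_car mode_degree[OF u] in blast)+
  then show ?thesis
    by (rule linear_homogeneous_into[OF mode_linear_left[OF w] M.car_subspace])
qed

lemma mode_finite:
  assumes "w \<in> car M" "\<And>i. mmode M u (int i + r) w = 0 \<Longrightarrow> f i = 0"
  shows "finite {i. f i \<noteq> 0}"
proof (rule eventually_zero_finite)
  obtain N where N: "\<forall>n\<ge>N. mmode M u n w = 0" using truncation[OF assms(1)] by blast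
  have "\<forall>i\<ge>nat (N - r). f i = 0"
    using N by (auto intro!: assms(2))
  then show "\<exists>N. \<forall>i\<ge>N. f i = 0" by blast
qed

lemma commutator_finite:
  assumes "w \<in> car M"
  shows "finite {i. scl M (of_int m gchoose i) (mmode M (vmode V u (l + int i) v) (k - int i) w) \<noteq> 0}"
proof (rule eventually_zero_finite)
  obtain N where N: "\<forall>n\<ge>N. vmode V u n v = 0" using V.truncation by blast
  have "\<forall>i\<ge>nat (N - l). scl M (of_int m gchoose i) (mmode M (vmode V u (l + int i) v) (k - int i) w) = 0"
    using N assms by auto
  then show "\<exists>N. \<forall>i\<ge>N. scl M (of_int m gchoose i) (mmode M (vmode V u (l + int i) v) (k - int i) w) = 0" by blast
qed

lemma associator_finite:
  assumes "w \<in> car M"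
  shows "finite {i. scl M (c i) (mmode M u (l - int i) (mmode M v (n + int i) w)
                - scl M d (mmode M v (k - int i) (mmode M u (int i) w))) \<noteq> 0}" (is "finite {i. ?f i \<noteq> 0}")
proof (rule finite_subset)
  let ?A = "{i. mmode M v (int i + n) w \<noteq> 0}" and ?B = "{i. mmode M u (int i + 0) w \<noteq> 0}"
  show "{i. ?f i \<noteq> 0} \<subseteq> ?A \<union> ?B" by (auto simp: add.commute)
  show "finite (?A \<union> ?B)"
    using mode_finite[OF assms, of v n] mode_finite[OF assms, of u 0] by auto
qed

lemma commutator:
  assumes "u \<in> dgr V p" "v \<in> dgr V q" "w \<in> car M"
  shows "mmode M u m (mmode M v n w) - scl M (ksign p q) (mmode M v n (mmode M u m w))
    = Sum_any (\<lambda>i. scl M (of_int m gchoose i) (mmode M (vmode V u (int i) v) (m + n - int i) w))"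
proof -
  have "Sum_any (\<lambda>i::nat. scl M ((-1) ^ i * (of_int 0 gchoose i))
           (mmode M u (m + 0 - int i) (mmode M v (n + int i) w)
            - scl M ((-1) powi 0 * ksign p q) (mmode M v (n + 0 - int i) (mmode M u (m + int i) w))))
    = mmode M u m (mmode M v n w) - scl M (ksign p q) (mmode M v n (mmode M u m w))"
    by (subst Sum_any_only_0) (auto simp: gbinomial_0_left)
  moreover have "jacobi_identity (vmode V) (scl M) (car M) (mmode M) p q u v"
    by (rule jacobi[OF assms(1,2)])
  ultimately show ?thesis
    using assms(3) unfolding jacobi_identity_def by (metis (no_types, lifting) add_0 Sum_any.cong)
qed

lemma associator:
  assumes "u \<in> dgr V p" "v \<in> dgr V q" "w \<in> car M"
  shows "mmode M (vmode V u l v) n w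
    = Sum_any (\<lambda>i::nat. scl M ((-1) ^ i * (of_int l gchoose i))
           (mmode M u (l - int i) (mmode M v (n + int i) w)
            - scl M ((-1) powi l * ksign p q) (mmode M v (n + l - int i) (mmode M u (int i) w))))"
proof -
  have "Sum_any (\<lambda>i::nat. scl M (of_int 0 gchoose i) (mmode M (vmode V u (l + int i) v) (0 + n - int i) w))
    = mmode M (vmode V u l v) n w"
    by (subst Sum_any_only_0) (auto simp: gbinomial_0_left)
  moreover have "jacobi_identity (vmode V) (scl M) (car M) (mmode M) p q u v"
    by (rule jacobi[OF assms(1,2)])
  ultimately show ?thesis
    using assms(3) unfolding jacobi_identity_def by (metis (no_types, lifting) add_0 Sum_any.cong)
qed

text \<open>
  The derivative of the field of \<open>u\<close> is the field of \<open>u\<^bsub>-2\<^esub>\<one>\<close>: the associator with the vacuum has at most one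
  nonzero term, with coefficient \<open>(-1)\<^sup>i (-2 choose i) = i + 1\<close>.
\<close>

lemma translation_mode:
  assumes w: "w \<in> car M"
  shows "mmode M (vmode V u (-2) (vac V)) n w = scl M (- of_int n) (mmode M u (n - 1) w)"
proof (rule linear_homogeneous_eq)
  show "linear_on (scl V) (scl M) UNIV (\<lambda>u. mmode M (vmode V u (-2) (vac V)) n w)"
    using w linear_on_add[OF V.mode_linear_left] linear_on_scale[OF V.mode_linear_left]
    by (simp add: linear_on_def mode_add_left mode_scale_left)
  show "linear_on (scl V) (scl M) UNIV (\<lambda>u. scl M (- of_int n) (mmode M u (n - 1) w))"
    using w by (simp add: linear_on_def mode_add_left mode_scale_left M.vs.scale_right_distrib mult.commute
        del: M.vs.scale_minus_left)
  fix p u assume u: "u \<in> dgr V p"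
  have c: "(-1) ^ i * ((-2::complex) gchoose i) = of_nat i + 1" for i
    using binomial_gbinomial[of "Suc i" i, where 'a=complex]
    by (subst gbinomial_negated_upper) (simp add: power_mult_distrib[symmetric] mult.assoc[symmetric] add.commute)
  define F where "F i = scl M (of_nat i + 1) (mmode M u (-2 - int i) (mmode M (vac V) (n + int i) w)
            - mmode M (vac V) (n + -2 - int i) (mmode M u (int i) w))" for i :: nat
  have F: "F i = (if int i = -1 - n then scl M (of_nat i + 1) (mmode M u (-2 - int i) w)
      else if int i = n - 1 then - scl M (of_nat i + 1) (mmode M u (int i) w) else 0)" for i
    using w by (auto simp: F_def vacuum mode_car)
  have "mmode M (vmode V u (-2) (vac V)) n w = Sum_any F"
    by (subst associator[OF u V.vac_degree w]) (simp add: c F_def)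
  also have "\<dots> = scl M (- of_int n) (mmode M u (n - 1) w)"
  proof (cases n "0::int" rule: linorder_cases)
    case less
    have "Sum_any F = sum F {nat (-1 - n)}"
      by (rule Sum_any.expand_superset) (use less in \<open>auto simp: F split: if_splits\<close>)
    then show ?thesis using less by (simp add: F)
  next
    case equal
    then have "F i = 0" for i by (auto simp: F)
    then show ?thesis using equal by simp
  next
    case greater
    have "Sum_any F = sum F {nat (n - 1)}"
      by (rule Sum_any.expand_superset) (use greater in \<open>auto simp: F split: if_splits\<close>)
    then show ?thesis using greater by (simp add: F)
  qed
  finally show "mmode M (vmode V u (-2) (vac V)) n w = scl M (- of_int n) (mmode M u (n - 1) w)" .
qed

end


section \<open>The adjoint module\<close>

lemma components_map:
  assumes vs: "vector_space s" and ds: "direct_sum_on s X I A" and \<phi>: "linear_on s s X \<phi>"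
    and A: "\<And>i x. i \<in> I \<Longrightarrow> x \<in> A i \<Longrightarrow> \<phi> x \<in> A i" and c: "components s I A x f"
  shows "components s I A (\<phi> x) (\<lambda>i. \<phi> (f i))"
proof -
  interpret vector_space s by (rule vs)
  note X = direct_sum_subspace[OF vs ds]
  have z: "\<phi> 0 = 0" by (rule linear_on_zero[OF \<phi> subspace_0[OF X(2)]])
  have sub: "{i. \<phi> (f i) \<noteq> 0} \<subseteq> {i. f i \<noteq> 0}" using z by auto
  have fin: "finite {i. f i \<noteq> 0}" using c by (simp add: components_def)
  have "\<phi> x = (\<Sum>i\<in>{i. f i \<noteq> 0}. \<phi> (f i))"
    using c X(3) linear_on_sum[OF vs \<phi> X(2) fin, of f]
    by (auto simp: components_def Sum_any.expand_set)
  then have "\<phi> x = Sum_any (\<lambda>i. \<phi> (f i))"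
    by (simp add: Sum_any.expand_superset[OF fin sub])
  then show ?thesis
    using c A sub finite_subset[OF sub fin] by (auto simp: components_def)
qed

text \<open>
  \<open>V\<close> as a graded dg module over itself.  Results on modules specialize to results on \<open>V\<close> along this record.
\<close>

definition adjoint_module :: "'v::ab_group_add dgvoa \<Rightarrow> ('v, 'v) graded_mod" where
  "adjoint_module V =
     \<lparr>scl = scl V, car = UNIV, dgr = dgr V, dif = dif V, mmode = vmode V, mwt = wtspace V\<rparr>"

lemma adjoint_module_simps [simp]:
  "scl (adjoint_module V) = scl V" "car (adjoint_module V) = UNIV"
  "dgr (adjoint_module V) = dgr V" "dif (adjoint_module V) = dif V"
  "mmode (adjoint_module V) = vmode V" "mwt (adjoint_module V) = wtspace V"
  by (simp_all add: adjoint_module_def)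

context dg_vertex_operator_algebra
begin

lemma adjoint_weak_dg_module: "weak_dg_module V (adjoint_module V)"
proof -
  have "cochain_complex (adjoint_module V)"
    using vector_space degree_decomposition dif_linear dif_degree dif_dif car_UNIV
    by (simp add: cochain_complex_def)
  moreover have "weak_dg_module_axioms V (adjoint_module V)"
    using mode_linear_left mode_linear_right mode_degree mode_dif truncation vacuum jacobi
    by (simp add: weak_dg_module_axioms_def)
  ultimately show ?thesis
    using dg_vertex_operator_algebra_axioms by (simp add: weak_dg_module_def)
qed

interpretation adj: weak_dg_module V "adjoint_module V"
  by (rule adjoint_weak_dg_module)

lemma Lop_linear: "linear_on (scl V) (scl V) UNIV (Lop V n)"
  unfolding Lop_def by (rule mode_linear_right)

lemma wtspace_subspace: "vs.subspace (wtspace V n)"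
  using linear_on_add[OF Lop_linear] linear_on_scale[OF Lop_linear] linear_on_zero[OF Lop_linear]
  by (auto simp: wtspace_def vs.subspace_def vs.scale_right_distrib mult.commute)

lemma Lop_0_wtspace: "v \<in> wtspace V n \<Longrightarrow> Lop V 0 v \<in> wtspace V n"
  using vs.subspace_scale[OF wtspace_subspace, of v n "of_real n"] by (simp add: wtspace_def)

text \<open>
  The components of an eigenvector of \<open>L(0)\<close> in the decomposition into eigenspaces are eigenvectors for the same
  eigenvalue, hence zero if that eigenvalue does not occur.
\<close>

lemma wtspace_off:
  assumes "n \<notin> half_ints" shows "wtspace V n = {0}"
proof -
  note ds = weight_decomposition
  have "v = 0" if v: "v \<in> wtspace V n" for v
  proof -
    obtain f where f: "components (scl V) half_ints (wtspace V) v f"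
      using components_exist[OF vector_space ds] by blast
    have "components (scl V) half_ints (wtspace V) (Lop V 0 v) (\<lambda>i. Lop V 0 (f i))"
      by (rule components_map[OF vector_space ds Lop_linear Lop_0_wtspace f])
    moreover have "components (scl V) half_ints (wtspace V) (Lop V 0 v) (\<lambda>i. scl V (of_real n) (f i))"
      using components_scale[OF vector_space ds f] v by (simp add: wtspace_def)
    ultimately have eq: "(\<lambda>i. Lop V 0 (f i)) = (\<lambda>i. scl V (of_real n) (f i))"
      by (rule components_unique[OF vector_space ds])
    have "f i = 0" for i
    proof (cases "i \<in> half_ints")
      case True
      then have "scl V (of_real i) (f i) = scl V (of_real n) (f i)"
        using f fun_cong[OF eq, of i] by (simp add: components_def wtspace_def)
      then show ?thesis using True assms by auto
    qed (use f in \<open>auto simp: components_def\<close>)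
    then show "v = 0" using f by (simp add: components_def)
  qed
  then show ?thesis using vs.subspace_0[OF wtspace_subspace] by blast
qed

text \<open>
  The operator \<open>L(0) = \<omega>\<^sub>1\<close> has degree 0, so the components of an eigenvector for the cohomological grading are
  eigenvectors again.
\<close>

lemma wtspace_graded: "wtspace V n = vs.span (\<Union>p. wtspace V n \<inter> dgr V p)"
proof
  note ds = degree_decomposition[unfolded car_UNIV]
  show "vs.span (\<Union>p. wtspace V n \<inter> dgr V p) \<subseteq> wtspace V n"
    by (rule vs.span_minimal[OF _ wtspace_subspace]) auto
  show "wtspace V n \<subseteq> vs.span (\<Union>p. wtspace V n \<inter> dgr V p)"
  proof
    fix v assume v: "v \<in> wtspace V n"
    obtain f where f: "components (scl V) UNIV (dgr V) v f"
      using components_exist[OF vector_space ds] by blast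
    have "components (scl V) UNIV (dgr V) (Lop V 0 v) (\<lambda>i. Lop V 0 (f i))"
      by (intro components_map[OF vector_space ds Lop_linear _ f])
        (use mode_degree[OF conf_degree, of _ _ 1] in \<open>auto simp: Lop_def\<close>)
    moreover have "components (scl V) UNIV (dgr V) (Lop V 0 v) (\<lambda>i. scl V (of_real n) (f i))"
      using components_scale[OF vector_space ds f] v by (simp add: wtspace_def)
    ultimately have "(\<lambda>i. Lop V 0 (f i)) = (\<lambda>i. scl V (of_real n) (f i))"
      by (rule components_unique[OF vector_space ds])
    then have "f i \<in> wtspace V n \<inter> dgr V i" for i
      using f by (auto simp: components_def wtspace_def dest: fun_cong)
    then show "v \<in> vs.span (\<Union>p. wtspace V n \<inter> dgr V p)"
      using f by (auto simp: components_def intro!: vs.Sum_any_in_subspace[OF vs.subspace_span] intro: vs.span_base)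
  qed
qed

lemma wtspace_dif: "w \<in> wtspace V n \<Longrightarrow> dif V w \<in> wtspace V n"
  using mode_dif[OF conf_degree, of 1 w] linear_on_scale[OF dif_linear, of w]
  by (simp add: conf_dif adj.mode_zero_left[simplified] wtspace_def Lop_def minus_one_powi car_UNIV)

text \<open>
  From \<open>[\<omega>\<^sub>1, u\<^sub>m] = (\<omega>\<^sub>0u)\<^bsub>m + 1\<^esub> + (\<omega>\<^sub>1u)\<^sub>m\<close>, where \<open>\<omega>\<^sub>0u = L(-1)u\<close> is the translate of \<open>u\<close> and \<open>\<omega>\<^sub>1u\<close> a multiple of \<open>u\<close>.
\<close>

lemma wtspace_mode:
  assumes u: "u \<in> wtspace V n" and w: "w \<in> wtspace V r"
  shows "vmode V u m w \<in> wtspace V (r + n - of_int m - 1)"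
proof -
  have "vmode V u m w \<in> wtspace V (r + n - of_int m - 1)" if u: "u \<in> wtspace V n \<inter> dgr V p" for u p
  proof -
    have c: "(1::complex) gchoose i = (if i \<le> 1 then 1 else 0)" for i
      using binomial_gbinomial[of 1 i, where 'a = complex] by (cases "i \<le> 1") (auto simp: le_Suc_eq binomial_eq_0)
    have *: "Sum_any (\<lambda>i. scl V (of_int 1 gchoose i) (vmode V (vmode V (conf V) (int i) u) (1 + m - int i) w))
       = (\<Sum>i\<in>{0,1}. scl V (of_int 1 gchoose i) (vmode V (vmode V (conf V) (int i) u) (1 + m - int i) w))"
      by (intro Sum_any.expand_superset) (auto simp: c)
    have "vmode V (conf V) 1 (vmode V u m w) - vmode V u m (vmode V (conf V) 1 w)
      = vmode V (Lop V (-1) u) (m + 1) w + vmode V (Lop V 0 u) m w"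
      using adj.commutator[of "conf V" 4 u p w 1 m] u conf_degree unfolding adjoint_module_simps *
      by (simp add: Lop_def add.commute)
    also have "vmode V (Lop V (-1) u) (m + 1) w = scl V (- of_int (m + 1)) (vmode V u m w)"
      using adj.translation_mode[of w u "m + 1"] by (simp add: translation)
    also have "vmode V (Lop V 0 u) m w = scl V (of_real n) (vmode V u m w)"
      using u adj.mode_scale_left by (simp add: wtspace_def)
    also have "scl V (- of_int (m + 1)) (vmode V u m w) + scl V (of_real n) (vmode V u m w)
        = scl V (of_real n - of_int m - 1) (vmode V u m w)"
      by (simp add: vs.scale_left_distrib[symmetric])
    finally have "vmode V (conf V) 1 (vmode V u m w) - vmode V u m (vmode V (conf V) 1 w)
        = scl V (of_real n - of_int m - 1) (vmode V u m w)" .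
    moreover have "vmode V u m (vmode V (conf V) 1 w) = scl V (of_real r) (vmode V u m w)"
      using w adj.mode_scale_right by (simp add: wtspace_def Lop_def)
    ultimately have "vmode V (conf V) 1 (vmode V u m w)
        = scl V (of_real n - of_int m - 1) (vmode V u m w) + scl V (of_real r) (vmode V u m w)"
      by (metis diff_add_cancel)
    also have "\<dots> = scl V (of_real (r + n - of_int m - 1)) (vmode V u m w)"
      unfolding vs.scale_left_distrib[symmetric] by simp
    finally show ?thesis by (simp add: wtspace_def Lop_def)
  qed
  note hom = this
  have "u \<in> vs.span (\<Union>p. wtspace V n \<inter> dgr V p)"
    by (rule subsetD[OF equalityD1[OF wtspace_graded] u])
  then show ?thesis
    by (rule linear_on_span_into[where f = "\<lambda>u. vmode V u m w", OF vector_space vector_space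
          mode_linear_left vs.subspace_UNIV subset_UNIV wtspace_subspace, rotated])
      (use hom in blast)
qed

theorem adjoint_graded_dg_module: "graded_dg_module V (adjoint_module V)"
proof (intro graded_dg_module.intro adjoint_weak_dg_module graded_dg_module_axioms.intro)
  show "mwt (adjoint_module V) n = module.span (scl (adjoint_module V))
      (\<Union>p. mwt (adjoint_module V) n \<inter> dgr (adjoint_module V) p)" for n
    unfolding adjoint_module_simps by (rule wtspace_graded)
qed (simp_all add: weight_decomposition wtspace_off wtspace_dif wtspace_mode)

end

context graded_dg_module
begin

lemma mwt_subspace: "M.vs.subspace (mwt M n)"
proof (cases "n \<in> half_ints")
  case True
  then show ?thesis using direct_sum_subspace(1)[OF M.vector_space mwt_decomposition] by blast
qed (simp add: mwt_off M.vs.subspace_single_0)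

lemma mwt_car: "mwt M n \<subseteq> car M"
  using mwt_off[of n] direct_sum_subspace(3)[OF M.vector_space mwt_decomposition, of n]
    M.vs.subspace_0[OF M.car_subspace] by (cases "n \<in> half_ints") auto

lemma Mp_subspace: "M.vs.subspace (Mp M g)"
  unfolding Mp_def by (intro M.vs.subspace_inter M.dgr_subspace mwt_subspace)

lemma Vp_subspace: "V.vs.subspace (Vp V g)"
  unfolding Vp_def by (intro V.vs.subspace_inter V.dgr_subspace V.wtspace_subspace)

lemma Mp_car: "x \<in> Mp M g \<Longrightarrow> x \<in> car M"
  using mwt_car by (auto simp: Mp_def)

lemma Mp_mode:
  assumes "u \<in> Vp V g" "x \<in> Mp M h" "k = g + h - (2 * n + 2, of_int n + 1)"
  shows "mmode M u n x \<in> Mp M k"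
proof -
  have k: "fst k = fst g - 2 * n - 2 + fst h" "snd k = snd h + snd g - of_int n - 1"
    using assms(3) by simp_all
  have "mmode M u n x \<in> mwt M (snd k)"
    unfolding k using mwt_mode[of u "snd g" x "snd h" n] assms(1,2) by (auto simp: Mp_def Vp_def)
  moreover have "mmode M u n x \<in> dgr M (fst k)"
    unfolding k using mode_degree[of u "fst g" x "fst h" n] assms(1,2) by (auto simp: Mp_def Vp_def)
  ultimately show ?thesis by (simp add: Mp_def)
qed

lemma Mp_dif: "x \<in> Mp M g \<Longrightarrow> dif M x \<in> Mp M (up g)"
  using M.dif_degree mwt_dif by (auto simp: Mp_def)

lemma car_eq_span_Mp: "car M = M.vs.span (\<Union>g. Mp M g)"
proof
  have "mwt M n \<subseteq> M.vs.span (\<Union>g. Mp M g)" for n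
    by (subst mwt_graded, rule M.vs.span_mono) (auto simp: Mp_def intro!: exI[of _ "(_, n)"])
  then have "M.vs.span (\<Union>n\<in>half_ints. mwt M n) \<subseteq> M.vs.span (\<Union>g. Mp M g)"
    by (intro M.vs.span_minimal) auto
  then show "car M \<subseteq> M.vs.span (\<Union>g. Mp M g)"
    using mwt_decomposition by (simp add: direct_sum_on_def)
  show "M.vs.span (\<Union>g. Mp M g) \<subseteq> car M"
    by (rule M.vs.span_minimal[OF _ M.car_subspace]) (auto dest: Mp_car)
qed

end

lemma Mp_adjoint [simp]: "Mp (adjoint_module V) = Vp V"
  by (auto simp: Mp_def Vp_def)

section \<open>Congruences modulo \<open>C\<^sub>2\<close>\<close>

lemma C2M_adjoint [simp]: "C2M (adjoint_module V) = C2V V"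
  by (simp add: C2M_def C2V_def)

context graded_dg_module
begin

lemma C2M_subspace: "M.vs.subspace (C2M M)"
  by (simp add: C2M_def C2_def)

lemma C2M_car: "C2M M \<subseteq> car M"
  unfolding C2M_def C2_def by (rule M.vs.span_minimal[OF _ M.car_subspace]) (auto intro: mode_car)

lemma C2M_mode_minus_2: "x \<in> car M \<Longrightarrow> mmode M u (-2) x \<in> C2M M"
  by (auto simp: C2M_def C2_def intro: M.vs.span_base)

text \<open>All modes below \<open>-1\<close> are iterated derivatives of the mode \<open>-2\<close>.\<close>

lemma C2M_mode_low:
  assumes x: "x \<in> car M" and n: "n \<le> -2" shows "mmode M u n x \<in> C2M M"
proof -
  have "mmode M u (-2 - int k) x \<in> C2M M" for k
  proof (induction k arbitrary: u)
    case 0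
    show ?case using C2M_mode_minus_2[OF x] by simp
  next
    case (Suc k)
    define c :: complex where "c = of_nat (k + 2)"
    have "c \<noteq> 0" unfolding c_def of_nat_eq_0_iff by simp
    moreover have "mmode M (vmode V u (-2) (vac V)) (-2 - int k) x = scl M c (mmode M u (-2 - int (Suc k)) x)"
      by (subst translation_mode[OF x]) (simp add: c_def algebra_simps)
    ultimately have "mmode M u (-2 - int (Suc k)) x
        = scl M (inverse c) (mmode M (vmode V u (-2) (vac V)) (-2 - int k) x)"
      by simp
    then show ?case using Suc M.vs.subspace_scale[OF C2M_subspace] by metis
  qed
  from this[of "nat (-2 - n)"] n show ?thesis by simp
qed

lemma C2M_into:
  assumes f: "linear_on (scl M) (scl M) (car M) f" and T: "M.vs.subspace T"
    and gen: "\<And>p u w. u \<in> dgr V p \<Longrightarrow> w \<in> car M \<Longrightarrow> f (mmode M u (-2) w) \<in> T"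
    and x: "x \<in> C2M M"
  shows "f x \<in> T"
proof -
  have "f (mmode M u (-2) w) \<in> T" if w: "w \<in> car M" for u w
  proof (rule linear_homogeneous_into[where f = "\<lambda>u. f (mmode M u (-2) w)", OF _ T])
    show "linear_on (scl V) (scl M) UNIV (\<lambda>u. f (mmode M u (-2) w))"
      using w linear_on_add[OF f] linear_on_scale[OF f]
      by (simp add: linear_on_def mode_add_left mode_scale_left mode_car)
  qed (rule gen[OF _ w])
  then show ?thesis
    using x unfolding C2M_def C2_def
    by (rule_tac linear_on_span_into[where f = f, OF M.vector_space M.vector_space f M.car_subspace _ T])
      (auto intro: mode_car)
qed

lemma C2V_into:
  assumes f: "linear_on (scl V) (scl M) UNIV f" and T: "M.vs.subspace T"
    and gen: "\<And>p u q v. u \<in> dgr V p \<Longrightarrow> v \<in> dgr V q \<Longrightarrow> f (vmode V u (-2) v) \<in> T"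
    and a: "a \<in> C2V V"
  shows "f a \<in> T"
proof -
  have lin: "linear_on (scl V) (scl M) UNIV (\<lambda>u. f (vmode V u (-2) v))"
    "linear_on (scl V) (scl M) UNIV (\<lambda>v. f (vmode V u (-2) v))" for u v
    using linear_on_add[OF f] linear_on_scale[OF f]
      linear_on_add[OF V.mode_linear_left] linear_on_scale[OF V.mode_linear_left]
      linear_on_add[OF V.mode_linear_right] linear_on_scale[OF V.mode_linear_right]
    by (simp_all add: linear_on_def)
  have "f (vmode V u (-2) v) \<in> T" for u v
    by (rule linear_homogeneous_into[OF lin(1) T], rule linear_homogeneous_into[OF lin(2) T], rule gen)
  then show ?thesis
    using a unfolding C2V_def C2_def
    by (rule_tac linear_on_span_into[where f = f, OF V.vector_space M.vector_space f V.vs.subspace_UNIV _ T]) auto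
qed

text \<open>
  All modes in the commutator of \<open>u\<^sub>m\<close> with \<open>v\<^bsub>-2\<^esub>\<close> have index at most \<open>-2\<close> if \<open>m \<le> 0\<close>.
\<close>

lemma mode_C2M:
  assumes m: "m \<le> 0" and x: "x \<in> C2M M"
  shows "mmode M u m x \<in> C2M M"
proof -
  have hom: "mmode M u m (mmode M v (-2) w) \<in> C2M M"
    if "u \<in> dgr V p" "v \<in> dgr V q" "w \<in> car M" for u p v q w
  proof -
    have "mmode M u m (mmode M v (-2) w) - scl M (ksign p q) (mmode M v (-2) (mmode M u m w)) \<in> C2M M"
      unfolding commutator[OF that] using m mode_car[OF that(3)] that(3)
      by (intro M.vs.Sum_any_in_subspace M.vs.subspace_scale C2M_subspace C2M_mode_low) auto
    moreover have "scl M (ksign p q) (mmode M v (-2) (mmode M u m w)) \<in> C2M M"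
      using that(3) by (intro M.vs.subspace_scale C2M_subspace C2M_mode_minus_2 mode_car)
    ultimately show ?thesis using M.vs.subspace_add[OF C2M_subspace] by fastforce
  qed
  have *: "mmode M u m x \<in> C2M M" if u: "u \<in> dgr V p" for u p
    by (rule C2M_into[OF mode_linear_right C2M_subspace hom[OF u] x])
  show ?thesis
    by (rule linear_homogeneous_into[OF mode_linear_left C2M_subspace *])
      (use x C2M_car in auto)
qed

text \<open>
  In the associator formula for \<open>(u\<^bsub>-2\<^esub>v)\<^sub>n\<close> the operator applied last is \<open>u\<^bsub>-2 - i\<^esub>\<close> or \<open>v\<^bsub>n - 2 - i\<^esub>\<close>.
\<close>

lemma C2V_mode:
  assumes n: "n \<le> 0" and a: "a \<in> C2V V" and w: "w \<in> car M"
  shows "mmode M a n w \<in> C2M M"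
proof -
  have hom: "mmode M (vmode V u (-2) v) n w \<in> C2M M" if "u \<in> dgr V p" "v \<in> dgr V q" for u p v q
    unfolding associator[OF that w] using n w mode_car[OF w]
    by (intro M.vs.Sum_any_in_subspace M.vs.subspace_scale M.vs.subspace_diff C2M_subspace C2M_mode_low mode_car)
      auto
  show ?thesis
    by (rule C2V_into[OF mode_linear_left[OF w] C2M_subspace hom a])
qed

lemma dif_C2M: "x \<in> C2M M \<Longrightarrow> dif M x \<in> C2M M"
proof (rule C2M_into[OF M.dif_linear C2M_subspace])
  fix u p w assume u: "u \<in> dgr V p" and w: "w \<in> car M"
  have "dif M (mmode M u (-2) w)
      = mmode M (dif V u) (-2) w + scl M ((-1) powi p) (mmode M u (-2) (dif M w))"
    using mode_dif[OF u w, of "-2"] by simp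
  then show "dif M (mmode M u (-2) w) \<in> C2M M"
    using w by (auto intro!: M.vs.subspace_add M.vs.subspace_scale C2M_subspace C2M_mode_minus_2 M.dif_car)
qed

text \<open>
  In this lemma and the next one only the first term of the associator formula survives modulo \<open>C\<^sub>2(M)\<close>.
\<close>

lemma product_assoc_C2M:
  assumes "u \<in> dgr V p" "v \<in> dgr V q" "w \<in> car M"
  shows "mmode M (vmode V u (-1) v) (-1) w - mmode M u (-1) (mmode M v (-1) w) \<in> C2M M"
proof -
  note w = assms(3) mode_car[OF assms(3)]
  define f where "f i = scl M ((-1) ^ i * (of_int (-1) gchoose i))
           (mmode M u (-1 - int i) (mmode M v (-1 + int i) w)
            - scl M ((-1) powi (-1) * ksign p q) (mmode M v (-1 + -1 - int i) (mmode M u (int i) w)))" for i :: nat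
  have fin: "finite {i. f i \<noteq> 0}" unfolding f_def by (rule associator_finite[OF assms(3)])
  have eq: "mmode M (vmode V u (-1) v) (-1) w = Sum_any f"
    unfolding f_def by (rule associator[OF assms])
  have "f i \<in> C2M M" if "i > 0" for i
    unfolding f_def using that w
    by (intro M.vs.subspace_scale M.vs.subspace_diff C2M_subspace C2M_mode_low mode_car) auto
  then have "Sum_any f - f 0 \<in> C2M M" by (rule M.vs.Sum_any_head[OF C2M_subspace fin])
  moreover have "f 0 - mmode M u (-1) (mmode M v (-1) w) \<in> C2M M"
    using w by (simp add: f_def C2M_mode_low M.vs.subspace_scale[OF C2M_subspace] M.vs.subspace_neg[OF C2M_subspace])
  ultimately show ?thesis
    using M.vs.subspace_add[OF C2M_subspace] unfolding eq by fastforce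
qed

lemma product_bracket_C2M:
  assumes "u \<in> dgr V p" "v \<in> dgr V q" "w \<in> car M"
  shows "mmode M (vmode V u (-1) v) 0 w
    - (mmode M u (-1) (mmode M v 0 w) + scl M (ksign p q) (mmode M v (-1) (mmode M u 0 w))) \<in> C2M M"
proof -
  note w = assms(3) mode_car[OF assms(3)]
  define f where "f i = scl M ((-1) ^ i * (of_int (-1) gchoose i))
           (mmode M u (-1 - int i) (mmode M v (0 + int i) w)
            - scl M ((-1) powi (-1) * ksign p q) (mmode M v (0 + -1 - int i) (mmode M u (int i) w)))" for i :: nat
  have fin: "finite {i. f i \<noteq> 0}" unfolding f_def by (rule associator_finite[OF assms(3)])
  have eq: "mmode M (vmode V u (-1) v) 0 w = Sum_any f"
    unfolding f_def by (rule associator[OF assms])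
  have "f i \<in> C2M M" if "i > 0" for i
    unfolding f_def using that w
    by (intro M.vs.subspace_scale M.vs.subspace_diff C2M_subspace C2M_mode_low mode_car) auto
  then have "Sum_any f - f 0 \<in> C2M M" by (rule M.vs.Sum_any_head[OF C2M_subspace fin])
  moreover have "f 0 = mmode M u (-1) (mmode M v 0 w) + scl M (ksign p q) (mmode M v (-1) (mmode M u 0 w))"
    by (simp add: f_def)
  ultimately show ?thesis unfolding eq by simp
qed

lemma mode_0_commutator:
  assumes "u \<in> dgr V p" "v \<in> dgr V q" "w \<in> car M"
  shows "mmode M u 0 (mmode M v n w)
    = mmode M (vmode V u 0 v) n w + scl M (ksign p q) (mmode M v n (mmode M u 0 w))"
proof -
  have "Sum_any (\<lambda>i::nat. scl M (of_int 0 gchoose i) (mmode M (vmode V u (int i) v) (0 + n - int i) w))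
      = mmode M (vmode V u 0 v) n w"
    by (subst Sum_any_only_0) (auto simp: gbinomial_0_left)
  with commutator[OF assms, of 0 n] show ?thesis by (simp add: algebra_simps)
qed

end

context dg_vertex_operator_algebra
begin

interpretation adj: graded_dg_module V "adjoint_module V"
  by (rule adjoint_graded_dg_module)

lemmas C2V_subspace = adj.C2M_subspace[simplified]

text \<open>
  Applied to the vacuum, \<open>v\<^sub>n\<close> gives \<open>v\<close> for \<open>n = -1\<close> and zero for \<open>n \<ge> 0\<close>, so the commutators \<open>[u\<^bsub>-1\<^esub>, v\<^bsub>-1\<^esub>]\<one>\<close>
  and \<open>[u\<^bsub>-1\<^esub>, v\<^sub>0]\<one>\<close> express commutativity and skew symmetry.
\<close>

lemma product_commutes_C2V:
  assumes "u \<in> dgr V p" "v \<in> dgr V q"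
  shows "vmode V u (-1) v - scl V (ksign p q) (vmode V v (-1) u) \<in> C2V V"
proof -
  have "Sum_any (\<lambda>i::nat. scl V (of_int (-1) gchoose i) (vmode V (vmode V u (int i) v) (-1 + -1 - int i) (vac V))) \<in> C2V V"
    using adj.C2M_mode_low[of "vac V"] by (intro vs.Sum_any_in_subspace vs.subspace_scale C2V_subspace) auto
  then show ?thesis
    using adj.commutator[OF assms, of "vac V" "-1" "-1"] by (simp add: creation)
qed

lemma bracket_skew_C2V:
  assumes "u \<in> dgr V p" "v \<in> dgr V q"
  shows "vmode V u 0 v + scl V (ksign p q) (vmode V v 0 u) \<in> C2V V"
proof -
  define f where "f i = scl V (of_int (-1) gchoose i) (vmode V (vmode V u (int i) v) (-1 + 0 - int i) (vac V))" for i :: nat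
  have "finite {i. f i \<noteq> 0}"
    unfolding f_def using adj.commutator_finite[of "vac V" "-1" u 0 v "-1 + 0"] by simp
  moreover have "f i \<in> C2V V" if "i > 0" for i
    unfolding f_def using that adj.C2M_mode_low[of "vac V"]
    by (intro vs.subspace_scale C2V_subspace) auto
  ultimately have "Sum_any f - f 0 \<in> C2V V" by (intro vs.Sum_any_head[OF C2V_subspace])
  moreover have "Sum_any f = - scl V (ksign p q) (vmode V v 0 u)"
    using adj.commutator[OF assms, of "vac V" "-1" 0] adj.mode_zero_right
    by (simp add: creation f_def)
  moreover have "f 0 = vmode V u 0 v" by (simp add: f_def creation)
  ultimately show ?thesis
    using vs.subspace_neg[OF C2V_subspace] by (fastforce simp: algebra_simps)
qed

end

section \<open>The weighted Jacobi identity\<close>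


text \<open>
  The revision \<open>(a choose m) (m choose j) = (a choose j) (a - j choose m - j)\<close> separates \<open>j\<close> from the sum over \<open>m\<close> and \<open>t\<close>,
  and Vandermonde's convolution evaluates what is left.
\<close>

lemma vandermonde_regroup:
  fixes s :: "complex \<Rightarrow> 'm::ab_group_add \<Rightarrow> 'm" and a b :: complex
  assumes vs: "vector_space s" and g: "\<And>k. k \<ge> N \<Longrightarrow> g (int k) = 0" and P: "N + j \<le> P"
  shows "(\<Sum>m<P. \<Sum>t<P. s ((a gchoose m) * (b gchoose t) * (of_nat m gchoose j)) (g (int m + int t - int j)))
    = (\<Sum>k<N. s ((a gchoose j) * (a + b - of_nat j gchoose k)) (g (int k)))"
    (is "(\<Sum>m<P. ?L m) = _")
proof -
  interpret vector_space s by (rule vs)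
  define G where "G i t = s ((a gchoose j) * (a - of_nat j gchoose i) * (b gchoose t)) (g (int (i + t)))" for i t
  have G0: "i + t < N" if "G i t \<noteq> 0" for i t
    using g[of "i + t"] that by (cases "i + t < N") (simp_all add: G_def)
  have L0: "?L m = 0" if "m < j" for m
    using that binomial_gbinomial[of m j, where 'a = complex] by (simp add: binomial_eq_0)
  have L: "?L (i + j) = (\<Sum>t<P. G i t)" for i
  proof (rule sum.cong[OF refl])
    fix t
    have "(a gchoose (i + j)) * (of_nat (i + j) gchoose j) = (a gchoose j) * (a - of_nat j gchoose i)"
      using gbinomial_trinomial_revision[of j "i + j" a] by simp
    then have "(a gchoose (i + j)) * (b gchoose t) * (of_nat (i + j) gchoose j)
        = (a gchoose j) * (a - of_nat j gchoose i) * (b gchoose t)"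
      by (metis mult.assoc mult.commute)
    then show "s ((a gchoose (i + j)) * (b gchoose t) * (of_nat (i + j) gchoose j)) (g (int (i + j) + int t - int j)) = G i t"
      by (simp only: G_def) (simp add: algebra_simps)
  qed
  have "(\<Sum>m<P. ?L m) = (\<Sum>m\<in>{j..<P}. ?L m)"
    by (rule sum.mono_neutral_right) (auto intro: L0)
  also have "\<dots> = (\<Sum>i\<in>{0..<P - j}. ?L (i + j))"
    using sum.shift_bounds_nat_ivl[of ?L 0 j "P - j"] P by (simp add: add.commute)
  also have "\<dots> = (\<Sum>i\<in>{0..<P - j}. \<Sum>t<P. G i t)"
    by (simp only: L)
  also have "\<dots> = (\<Sum>(i, t)\<in>{0..<P - j} \<times> {..<P}. G i t)"
    by (rule sum.cartesian_product)
  also have "\<dots> = (\<Sum>(i, t)\<in>{(i, t). i + t < N}. G i t)"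
    using P by (intro sum.mono_neutral_right) (auto dest: G0)
  also have "\<dots> = (\<Sum>k<N. \<Sum>i\<le>k. G i (k - i))"
    by (rule sum.triangle_reindex)
  also have "\<dots> = (\<Sum>k<N. s ((a gchoose j) * (a + b - of_nat j gchoose k)) (g (int k)))"
  proof (rule sum.cong[OF refl])
    fix k
    have "(\<Sum>i\<le>k. G i (k - i))
        = s ((a gchoose j) * (\<Sum>i\<in>{0..k}. (a - of_nat j gchoose i) * (b gchoose (k - i)))) (g (int k))"
      by (simp add: G_def scale_sum_left[symmetric] sum_distrib_left mult.assoc atLeast0AtMost)
    then show "(\<Sum>i\<le>k. G i (k - i)) = s ((a gchoose j) * (a + b - of_nat j gchoose k)) (g (int k))"
      by (simp only: gbinomial_Vandermonde diff_add_eq)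
  qed
  finally show ?thesis .
qed

context weak_dg_module
begin

text \<open>
  \<open>Z a r u w\<close> is the residue of \<open>(1 + x)\<^sup>a x\<^sup>-\<^sup>r Y(u, x) w\<close>.  For \<open>u\<close> of weight \<open>a\<close> the left product is \<open>Z a 1\<close>, the circle
  product \<open>Z a 2\<close>, the right product \<open>Z (a - 1) 1\<close>, and the commutator, their difference, \<open>Z (a - 1) 0\<close>.
\<close>

abbreviation Z where "Z \<equiv> zhu (scl M) (mmode M)"

lemma zhu_finite:
  assumes "w \<in> car M" shows "finite {n. scl M (c n) (mmode M u (int n - r) w) \<noteq> 0}"
  by (rule mode_finite[OF assms, of u "- r"]) simp

lemma zhu_eq_sum:
  assumes "\<And>n. n \<ge> P \<Longrightarrow> mmode M u (int n - r) w = 0"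
  shows "Z a r u w = (\<Sum>n<P. scl M (of_real a gchoose n) (mmode M u (int n - r) w))"
  unfolding zhu_def
  by (rule Sum_any_eq_lessThan) (simp add: assms)

text \<open>
  Truncation gives a bound for each \<open>k\<close> separately, and \<open>v\<^sub>k w\<close> is nonzero for finitely many \<open>k \<ge> k\<^sub>0\<close> only.
\<close>

lemma uniform_truncation:
  assumes w: "w \<in> car M"
  shows "\<exists>N. \<forall>n\<ge>N. \<forall>k\<ge>k0. mmode M u n (mmode M v k w) = 0"
proof -
  obtain K where K: "\<forall>k\<ge>K. mmode M v k w = 0" using truncation[OF w] by blast
  have "\<forall>k. \<exists>N. \<forall>n\<ge>N. mmode M u n (mmode M v k w) = 0"
    using truncation[OF mode_car[OF w]] by blast
  then obtain N where N: "\<forall>k. \<forall>n\<ge>N k. mmode M u n (mmode M v k w) = 0" by metis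
  have "mmode M u n (mmode M v k w) = 0" if n: "n \<ge> Max (insert 0 (N ` {k0..K}))" and k: "k \<ge> k0" for n k
  proof (cases "k \<le> K")
    case True
    then have "N k \<le> Max (insert 0 (N ` {k0..K}))" using k by (intro Max_ge) auto
    then show ?thesis using N order_trans[OF _ n] by blast
  next
    case False
    then show ?thesis using K by simp
  qed
  then show ?thesis by blast
qed

lemma mode_sum_right:
  assumes "finite F" "\<And>i. i \<in> F \<Longrightarrow> x i \<in> car M"
  shows "mmode M u n (\<Sum>i\<in>F. scl M (c i) (x i)) = (\<Sum>i\<in>F. scl M (c i) (mmode M u n (x i)))"
proof -
  have "mmode M u n (\<Sum>i\<in>F. scl M (c i) (x i)) = (\<Sum>i\<in>F. mmode M u n (scl M (c i) (x i)))"
    using assms M.vs.subspace_scale[OF M.car_subspace]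
    by (intro linear_on_sum[OF M.vector_space mode_linear_right M.car_subspace]) auto
  then show ?thesis using assms(2) by (simp add: mode_scale_right)
qed

text \<open>
  With a bound common to both indices a composite of two series is a finite double sum, in which summations may be
  interchanged.
\<close>

lemma zhu_zhu_eq_sum:
  assumes w: "w \<in> car M" and v: "\<And>t. t \<ge> P \<Longrightarrow> mmode M v (int t - r) w = 0"
    and u: "\<And>m t. m \<ge> P \<Longrightarrow> mmode M u (int m - q) (mmode M v (int t - r) w) = 0"
  shows "Z a q u (Z b r v w) = (\<Sum>m<P. \<Sum>t<P. scl M ((of_real a gchoose m) * (of_real b gchoose t))
      (mmode M u (int m - q) (mmode M v (int t - r) w)))"
proof -
  have *: "mmode M u n (Z b r v w) = (\<Sum>t<P. scl M (of_real b gchoose t) (mmode M u n (mmode M v (int t - r) w)))" for n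
    using w by (subst zhu_eq_sum[where P = P]) (simp_all add: v mode_sum_right mode_car)
  then have "Z a q u (Z b r v w) = (\<Sum>m<P. scl M (of_real a gchoose m) (mmode M u (int m - q) (Z b r v w)))"
    by (intro zhu_eq_sum) (simp add: u)
  then show ?thesis by (simp add: * M.vs.scale_sum_right)
qed

text \<open>
  The Jacobi identity weighted by \<open>(1 + x\<^sub>1)\<^sup>a (1 + x\<^sub>2)\<^sup>b x\<^sub>2\<^sup>-\<^sup>r\<close>.  In the expansion around the diagonal
  \<open>x\<^sub>1 = x\<^sub>2 + x\<^sub>0\<close> one has \<open>1 + x\<^sub>1 = (1 + x\<^sub>2) (1 + x\<^sub>0 / (1 + x\<^sub>2))\<close>, which produces the weights
  \<open>a + b - j\<close>; on coefficients this is the Vandermonde convolution.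
\<close>

theorem zhu_jacobi:
  assumes hu: "u \<in> dgr V p" and hv: "v \<in> dgr V q" and w: "w \<in> car M"
  shows "Sum_any (\<lambda>j. scl M (of_real a gchoose j) (Z (a + b - real j) r (vmode V u (l + int j) v) w))
    = Sum_any (\<lambda>i. scl M ((-1) ^ i * (of_int l gchoose i))
        (Z a (int i - l) u (Z b (r - int i) v w)
         - scl M ((-1) powi l * ksign p q) (Z b (r - l + int i) v (Z a (- int i) u w))))"
proof -
  define \<tau> where "\<tau> = (-1) powi l * ksign p q"
  obtain Nv where Nv: "\<forall>n\<ge>Nv. mmode M v n w = 0" using truncation[OF w] by blast
  obtain Nu where Nu: "\<forall>n\<ge>Nu. mmode M u n w = 0" using truncation[OF w] by blast
  obtain Nuv where Nuv: "\<forall>n\<ge>Nuv. vmode V u n v = 0" using V.truncation by blast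
  obtain N1 where N1: "\<forall>n\<ge>N1. \<forall>k\<ge>-r. mmode M u n (mmode M v k w) = 0"
    using uniform_truncation[OF w] by blast
  obtain N2 where N2: "\<forall>n\<ge>N2. \<forall>k\<ge>0. mmode M v n (mmode M u k w) = 0"
    using uniform_truncation[OF w] by blast
  have "\<forall>j. \<exists>K. \<forall>k\<ge>K. mmode M (vmode V u j v) k w = 0"
    using truncation[OF w] by blast
  then obtain K where K: "\<forall>j. \<forall>k\<ge>K j. mmode M (vmode V u j v) k w = 0" by metis
  \<comment> \<open>All inner modes vanish from the index \<open>N\<close> on, the outer ones from \<open>P\<close> on while \<open>i < N\<close>; \<open>2 N \<le> P\<close> lets the triangles
    of the regrouped sum fit into the box.\<close>
  define N where "N = nat (Max ({0, Nv + r, Nu, Nuv - l} \<union> (\<lambda>j. K j + r) ` {l..Nuv}))"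
  define P where "P = nat (Max {2 * int N, N1 + int N - l, N2 + r - l + int N})"
  have N_max: "x \<le> int N" if "x \<in> {0, Nv + r, Nu, Nuv - l} \<union> (\<lambda>j. K j + r) ` {l..Nuv}" for x
  proof -
    have "x \<le> Max ({0, Nv + r, Nu, Nuv - l} \<union> (\<lambda>j. K j + r) ` {l..Nuv})"
      by (rule Max_ge[OF _ that]) simp
    then show ?thesis unfolding N_def by linarith
  qed
  have N_ge: "int N \<ge> Nv + r" "int N \<ge> Nu" "int N \<ge> Nuv - l" "j \<in> {l..Nuv} \<Longrightarrow> int N \<ge> K j + r" for j
    by (rule N_max; blast)+
  have P_ge: "int P \<ge> 2 * int N" "int P \<ge> N1 + int N - l" "int P \<ge> N2 + r - l + int N"
    unfolding P_def by auto
  have v0: "mmode M v (int t - (r - int i)) w = 0" if "t \<ge> N \<or> i \<ge> N" for t i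
    using Nv N_ge(1) that by auto
  have u0: "mmode M u (int m - (- int i)) w = 0" if "m \<ge> N \<or> i \<ge> N" for m i
    using Nu N_ge(2) that by auto
  have uv0: "mmode M u (int m - (int i - l)) (mmode M v (int t - (r - int i)) w) = 0" if "m \<ge> P \<or> i \<ge> N" for m i t
  proof (cases "i < N")
    case True
    then have "int m - (int i - l) \<ge> N1" using that P_ge(2) by auto
    then show ?thesis using N1 by auto
  qed (simp add: v0)
  have vu0: "mmode M v (int t - (r - l + int i)) (mmode M u (int m - (- int i)) w) = 0" if "t \<ge> P \<or> i \<ge> N" for m i t
  proof (cases "i < N")
    case True
    then have "int t - (r - l + int i) \<ge> N2" using that P_ge(3) by auto
    then show ?thesis using N2 by auto
  next
    case False
    then have "mmode M u (int m - (- int i)) w = 0" by (intro u0) simp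
    then show ?thesis by (simp only: mode_zero_right)
  qed
  have PN: "N \<le> P" using P_ge(1) by linarith
  have j0: "vmode V u (l + int j) v = 0" if "j \<ge> N" for j
    using Nuv N_ge(3) that by auto
  have k0: "mmode M (vmode V u (l + int j) v) (int k - r) w = 0" if "k \<ge> N" for j k
  proof (cases "l + int j \<le> Nuv")
    case True
    then have "int k - r \<ge> K (l + int j)" using N_ge(4)[of "l + int j"] that by auto
    then show ?thesis using K by blast
  next
    case False
    then show ?thesis using Nuv w by simp
  qed
  define T where "T i m t = mmode M u (int m - (int i - l)) (mmode M v (int t - (r - int i)) w)
      - scl M \<tau> (mmode M v (int t - (r - l + int i)) (mmode M u (int m - (- int i)) w))" for i m t
  have T0: "T i m t = 0" if "i \<ge> N" for i m t
    unfolding T_def by (simp only: uv0[OF disjI2[OF that]] vu0[OF disjI2[OF that]] M.vs.scale_zero_right diff_zero)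
  have inner: "(\<Sum>i<N. scl M ((-1) ^ i * (of_int l gchoose i)) (T i m t))
      = (\<Sum>j<N. scl M (of_nat m gchoose j) (mmode M (vmode V u (l + int j) v) (int m + (int t - r) - int j) w))" for m t
  proof -
    have "(\<Sum>i<N. scl M ((-1) ^ i * (of_int l gchoose i)) (T i m t))
      = Sum_any (\<lambda>i. scl M ((-1) ^ i * (of_int l gchoose i)) (T i m t))"
      by (rule Sum_any_eq_lessThan[symmetric]) (simp add: T0)
    also have "\<dots> = Sum_any (\<lambda>i. scl M ((-1) ^ i * (of_int l gchoose i))
           (mmode M u (int m + l - int i) (mmode M v (int t - r + int i) w)
            - scl M \<tau> (mmode M v (int t - r + l - int i) (mmode M u (int m + int i) w))))"
      by (simp add: T_def algebra_simps)
    also have "\<dots> = Sum_any (\<lambda>j. scl M (of_int (int m) gchoose j)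
          (mmode M (vmode V u (l + int j) v) (int m + (int t - r) - int j) w))"
      using jacobi[OF hu hv] w unfolding jacobi_identity_def \<tau>_def by blast
    also have "\<dots> = (\<Sum>j<N. scl M (of_int (int m) gchoose j)
          (mmode M (vmode V u (l + int j) v) (int m + (int t - r) - int j) w))"
      by (rule Sum_any_eq_lessThan) (simp add: j0 w)
    finally show ?thesis by simp
  qed
  have "Sum_any (\<lambda>i. scl M ((-1) ^ i * (of_int l gchoose i))
        (Z a (int i - l) u (Z b (r - int i) v w) - scl M \<tau> (Z b (r - l + int i) v (Z a (- int i) u w))))
     = Sum_any (\<lambda>i. scl M ((-1) ^ i * (of_int l gchoose i))
        (\<Sum>m<P. \<Sum>t<P. scl M ((of_real a gchoose m) * (of_real b gchoose t)) (T i m t)))"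
  proof (intro Sum_any.cong arg_cong2[where f = "scl M"] refl)
    fix i
    have "Z b (r - l + int i) v (Z a (- int i) u w) = (\<Sum>t<P. \<Sum>m<P. scl M ((of_real b gchoose t) * (of_real a gchoose m))
      (mmode M v (int t - (r - l + int i)) (mmode M u (int m - (- int i)) w)))"
      using PN by (intro zhu_zhu_eq_sum[OF w] u0 vu0) auto
    also have "\<dots> = (\<Sum>m<P. \<Sum>t<P. scl M ((of_real a gchoose m) * (of_real b gchoose t))
      (mmode M v (int t - (r - l + int i)) (mmode M u (int m - (- int i)) w)))"
      by (subst sum.swap) (simp add: mult.commute)
    finally have 2: "Z b (r - l + int i) v (Z a (- int i) u w) = \<dots>" .
    have 1: "Z a (int i - l) u (Z b (r - int i) v w) = (\<Sum>m<P. \<Sum>t<P. scl M ((of_real a gchoose m) * (of_real b gchoose t))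
      (mmode M u (int m - (int i - l)) (mmode M v (int t - (r - int i)) w)))"
      using PN by (intro zhu_zhu_eq_sum[OF w] v0 uv0) auto
    show "Z a (int i - l) u (Z b (r - int i) v w) - scl M \<tau> (Z b (r - l + int i) v (Z a (- int i) u w))
      = (\<Sum>m<P. \<Sum>t<P. scl M ((of_real a gchoose m) * (of_real b gchoose t)) (T i m t))"
      unfolding 1 2 T_def
      by (simp add: M.vs.scale_sum_right M.vs.scale_right_diff_distrib sum_subtractf mult.commute)
  qed
  also have "\<dots> = (\<Sum>i<N. scl M ((-1) ^ i * (of_int l gchoose i))
        (\<Sum>m<P. \<Sum>t<P. scl M ((of_real a gchoose m) * (of_real b gchoose t)) (T i m t)))"
    by (rule Sum_any_eq_lessThan) (simp add: T0)
  also have "\<dots> = (\<Sum>m<P. \<Sum>t<P. scl M ((of_real a gchoose m) * (of_real b gchoose t))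
        (\<Sum>i<N. scl M ((-1) ^ i * (of_int l gchoose i)) (T i m t)))"
    by (simp only: M.vs.scale_sum_right M.vs.scale_scale mult.commute sum.swap[of _ "{..<N}"])
  also have "\<dots> = (\<Sum>m<P. \<Sum>t<P. scl M ((of_real a gchoose m) * (of_real b gchoose t))
        (\<Sum>j<N. scl M (of_nat m gchoose j) (mmode M (vmode V u (l + int j) v) (int m + (int t - r) - int j) w)))"
    by (simp only: inner)
  also have "\<dots> = (\<Sum>j<N. \<Sum>m<P. \<Sum>t<P. scl M ((of_real a gchoose m) * (of_real b gchoose t) * (of_nat m gchoose j))
        (mmode M (vmode V u (l + int j) v) (int m + int t - int j - r) w))"
    by (simp only: M.vs.scale_sum_right M.vs.scale_scale sum.swap[of _ "{..<N}"]) (simp add: algebra_simps)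
  also have "\<dots> = (\<Sum>j<N. \<Sum>k<N. scl M ((of_real a gchoose j) * (of_real a + of_real b - of_nat j gchoose k))
        (mmode M (vmode V u (l + int j) v) (int k - r) w))"
  proof (rule sum.cong[OF refl])
    fix j assume "j \<in> {..<N}"
    then have "N + j \<le> P" using P_ge(1) by auto
    from vandermonde_regroup[OF M.vector_space _ this, of "\<lambda>k. mmode M (vmode V u (l + int j) v) (k - r) w"]
    show "(\<Sum>m<P. \<Sum>t<P. scl M ((of_real a gchoose m) * (of_real b gchoose t) * (of_nat m gchoose j))
        (mmode M (vmode V u (l + int j) v) (int m + int t - int j - r) w))
      = (\<Sum>k<N. scl M ((of_real a gchoose j) * (of_real a + of_real b - of_nat j gchoose k))
        (mmode M (vmode V u (l + int j) v) (int k - r) w))"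
      using k0 by simp
  qed
  also have "\<dots> = (\<Sum>j<N. scl M (of_real a gchoose j) (Z (a + b - real j) r (vmode V u (l + int j) v) w))"
    by (subst zhu_eq_sum[OF k0]) (auto simp: M.vs.scale_sum_right)
  also have "\<dots> = Sum_any (\<lambda>j. scl M (of_real a gchoose j) (Z (a + b - real j) r (vmode V u (l + int j) v) w))"
    by (rule Sum_any_eq_lessThan[symmetric]) (simp add: j0 w zhu_def)
  finally show ?thesis unfolding \<tau>_def by simp
qed

end

section \<open>The spaces \<open>O(V)\<close> and \<open>O(M)\<close>\<close>

lemma (in vector_space) scale_Sum_any:
  assumes "finite {i. f i \<noteq> 0}" shows "scale c (Sum_any f) = Sum_any (\<lambda>i. scale c (f i))"
proof -
  have "Sum_any (\<lambda>i. scale c (f i)) = (\<Sum>i\<in>{i. f i \<noteq> 0}. scale c (f i))"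
    by (rule Sum_any.expand_superset[OF assms]) auto
  then show ?thesis by (simp add: Sum_any.expand_set scale_sum_right)
qed

lemma linear_on_Sum_any:
  fixes f :: "'a::ab_group_add \<Rightarrow> 'b::ab_group_add"
  assumes vs: "vector_space s" and f: "linear_on s t UNIV f" and fin: "finite {i. x i \<noteq> 0}"
  shows "f (Sum_any x) = Sum_any (\<lambda>i. f (x i))"
proof -
  interpret vector_space s by (rule vs)
  have "Sum_any (\<lambda>i. f (x i)) = (\<Sum>i\<in>{i. x i \<noteq> 0}. f (x i))"
    by (rule Sum_any.expand_superset[OF fin]) (use linear_on_zero[OF f] in auto)
  then show ?thesis by (simp add: Sum_any.expand_set linear_on_sum[OF vs f subspace_UNIV fin])
qed

context weak_dg_module
begin

lemma zhu_linear_left: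
  assumes w: "w \<in> car M" shows "linear_on (scl V) (scl M) UNIV (\<lambda>u. Z a r u w)"
  using w zhu_finite[OF w]
  by (simp add: linear_on_def zhu_def mode_add_left mode_scale_left M.vs.scale_right_distrib Sum_any.distrib
      M.vs.scale_Sum_any mult.commute)

lemma zhu_linear_right: "linear_on (scl M) (scl M) (car M) (Z a r u)"
  using zhu_finite
  by (simp add: linear_on_def zhu_def mode_add_right mode_scale_right M.vs.scale_right_distrib Sum_any.distrib
      M.vs.scale_Sum_any mult.commute)

lemma zhu_car: "w \<in> car M \<Longrightarrow> Z a r u w \<in> car M"
  unfolding zhu_def
  by (intro M.vs.Sum_any_in_subspace M.vs.subspace_scale M.car_subspace mode_car)

lemma mode_truncation:
  assumes w: "w \<in> car M"
  obtains P where "\<And>n r. n \<ge> P \<Longrightarrow> r \<le> r0 \<Longrightarrow> mmode M u (int n - r) w = 0"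
proof -
  obtain K where K: "\<forall>k\<ge>K. mmode M u k w = 0" using truncation[OF w] by blast
  have "mmode M u (int n - r) w = 0" if "n \<ge> nat (K + r0)" "r \<le> r0" for n r
    using K that by simp
  then show thesis by (rule that)
qed

lemma zhu_image:
  assumes t: "vector_space t" and f: "linear_on (scl M) t (car M) f" and w: "w \<in> car M"
  shows "f (Z a r u w) = Sum_any (\<lambda>n. t (of_real a gchoose n) (f (mmode M u (int n - r) w)))"
proof -
  interpret t: vector_space t by (rule t)
  obtain P where P: "\<And>n r'. n \<ge> P \<Longrightarrow> r' \<le> r \<Longrightarrow> mmode M u (int n - r') w = 0"
    using mode_truncation[OF w, of r u] by blast
  have "f 0 = 0" by (rule linear_on_zero[OF f M.vs.subspace_0[OF M.car_subspace]])
  then have "Sum_any (\<lambda>n. t (of_real a gchoose n) (f (mmode M u (int n - r) w)))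
      = (\<Sum>n<P. t (of_real a gchoose n) (f (mmode M u (int n - r) w)))"
    by (intro Sum_any_eq_lessThan) (simp add: P)
  also have "\<dots> = f (\<Sum>n<P. scl M (of_real a gchoose n) (mmode M u (int n - r) w))"
    using mode_car[OF w] M.vs.subspace_scale[OF M.car_subspace]
    by (subst linear_on_sum[OF M.vector_space f M.car_subspace]) (auto simp: linear_on_scale[OF f])
  also have "\<dots> = f (Z a r u w)"
    by (subst zhu_eq_sum[where P = P]) (simp_all add: P)
  finally show ?thesis by simp
qed

lemma zhu_truncation:
  assumes w: "w \<in> car M" shows "\<exists>N. \<forall>n\<ge>N. Z a (r - int n) u w = 0"
proof -
  obtain K where K: "\<forall>k\<ge>K. mmode M u k w = 0" using truncation[OF w] by blast
  have "Z a (r - int n) u w = 0" if "n \<ge> nat (K + r)" for n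
    unfolding zhu_def using K that by simp
  then show ?thesis by blast
qed

lemma zhu_jacobi_finite:
  assumes w: "w \<in> car M"
  shows "finite {i. scl M (c i) (Z a (int i - l) u (Z b (r - int i) v w)
         - scl M d (Z b (r - l + int i) v (Z a (- int i) u w))) \<noteq> 0}" (is "finite {i. ?f i \<noteq> 0}")
proof (rule eventually_zero_finite)
  obtain N1 where N1: "\<forall>n\<ge>N1. Z b (r - int n) v w = 0" using zhu_truncation[OF w] by blast
  obtain N2 where N2: "\<forall>n\<ge>N2. Z a (0 - int n) u w = 0" using zhu_truncation[OF w] by blast
  have z: "Z a' r' u' 0 = 0" for a' r' u' by (simp add: zhu_def)
  have "?f i = 0" if i: "i \<ge> max N1 N2" for i
  proof -
    have 1: "Z b (r - int i) v w = 0" using N1[rule_format, of i] i by simp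
    have 2: "Z a (- int i) u w = 0" using N2[rule_format, of i] i by simp
    show ?thesis unfolding 1 2 z by simp
  qed
  then show "\<exists>N. \<forall>i\<ge>N. ?f i = 0" by (intro exI[of _ "max N1 N2"] allI impI)
qed

text \<open>
  This is \<open>(1 + x)\<^sup>a\<^sup>+\<^sup>1 x\<^sup>-\<^sup>r = (1 + x)\<^sup>a x\<^sup>-\<^sup>r + (1 + x)\<^sup>a x\<^sup>1\<^sup>-\<^sup>r\<close>.
\<close>

lemma zhu_pascal:
  assumes w: "w \<in> car M" shows "Z (a + 1) r u w = Z a r u w + Z a (r - 1) u w"
proof -
  obtain P where P: "\<And>n r'. n \<ge> P \<Longrightarrow> r' \<le> r \<Longrightarrow> mmode M u (int n - r') w = 0"
    using mode_truncation[OF w, of r u] by blast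
  have b: "(complex_of_real (a + 1) gchoose Suc n) = (complex_of_real a gchoose n) + (complex_of_real a gchoose Suc n)" for n
    by (simp add: gbinomial_Suc_Suc)
  have "Z (a + 1) r u w = (\<Sum>n<Suc P. scl M (of_real (a + 1) gchoose n) (mmode M u (int n - r) w))"
    by (rule zhu_eq_sum) (simp add: P)
  also have "\<dots> = (\<Sum>n<Suc P. scl M (of_real a gchoose n) (mmode M u (int n - r) w))
      + (\<Sum>n<P. scl M (of_real a gchoose n) (mmode M u (int n - (r - 1)) w))"
    by (simp only: sum.lessThan_Suc_shift b M.vs.scale_left_distrib sum.distrib) (simp add: algebra_simps)
  also have "(\<Sum>n<Suc P. scl M (of_real a gchoose n) (mmode M u (int n - r) w)) = Z a r u w"
    by (rule zhu_eq_sum[symmetric]) (simp add: P)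
  also have "(\<Sum>n<P. scl M (of_real a gchoose n) (mmode M u (int n - (r - 1)) w)) = Z a (r - 1) u w"
    by (rule zhu_eq_sum[symmetric]) (simp add: P)
  finally show ?thesis .
qed

text \<open>Integration by parts against \<open>(1 + x)\<^sup>a\<^sup>+\<^sup>1 x\<^sup>-\<^sup>r\<close>.\<close>

lemma zhu_translation:
  assumes w: "w \<in> car M"
  shows "Z (a + 1) r (vmode V u (-2) (vac V)) w
    = scl M (of_int r) (Z a (r + 1) u w) + scl M (of_int r - 1 - of_real a) (Z a r u w)"
proof -
  obtain P where P: "\<And>n r'. n \<ge> P \<Longrightarrow> r' \<le> r + 1 \<Longrightarrow> mmode M u (int n - r') w = 0"
    using mode_truncation[OF w, of "r + 1" u] by blast
  let ?\<alpha> = "complex_of_real a"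
  have b: "(complex_of_real (a + 1) gchoose Suc n) * (- of_int (int (Suc n) - r))
      = of_int r * (?\<alpha> gchoose Suc n) + (of_int r - 1 - ?\<alpha>) * (?\<alpha> gchoose n)" for n
  proof -
    have e: "(complex_of_real (a + 1) gchoose Suc n) = (?\<alpha> gchoose n) + (?\<alpha> gchoose Suc n)"
      by (simp add: gbinomial_Suc_Suc)
    show ?thesis unfolding e using gbinomial_mult_1[of ?\<alpha> n] by (simp add: algebra_simps)
  qed
  have "Z (a + 1) r (vmode V u (-2) (vac V)) w
    = (\<Sum>n<Suc P. scl M ((of_real (a + 1) gchoose n) * (- of_int (int n - r))) (mmode M u (int n - (r + 1)) w))"
    by (subst zhu_eq_sum[where P = "Suc P"]) (auto simp: translation_mode[OF w] P diff_diff_eq)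
  also have "\<dots> = (\<Sum>n<Suc P. scl M (of_int r * (?\<alpha> gchoose n)) (mmode M u (int n - (r + 1)) w))
      + (\<Sum>n<P. scl M ((of_int r - 1 - ?\<alpha>) * (?\<alpha> gchoose n)) (mmode M u (int n - r) w))"
    by (simp only: sum.lessThan_Suc_shift b M.vs.scale_left_distrib sum.distrib) (simp add: algebra_simps)
  also have "(\<Sum>n<Suc P. scl M (of_int r * (?\<alpha> gchoose n)) (mmode M u (int n - (r + 1)) w)) = scl M (of_int r) (Z a (r + 1) u w)"
    by (subst zhu_eq_sum[where P = "Suc P"]) (simp_all add: P M.vs.scale_sum_right del: sum.lessThan_Suc)
  also have "(\<Sum>n<P. scl M ((of_int r - 1 - ?\<alpha>) * (?\<alpha> gchoose n)) (mmode M u (int n - r) w)) = scl M (of_int r - 1 - ?\<alpha>) (Z a r u w)"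
    by (subst zhu_eq_sum[where P = P]) (simp_all add: P M.vs.scale_sum_right)
  finally show ?thesis .
qed

end

lemma OM_adjoint [simp]: "OM V (adjoint_module V) = OV V"
  by (simp add: OM_def OV_def)

context dg_vertex_operator_algebra
begin

lemma vac_weight: "vac V \<in> wtspace V 0"
  by (simp add: wtspace_def Lop_def creation)

lemma translation_weight: "u \<in> wtspace V a \<Longrightarrow> vmode V u (-2) (vac V) \<in> wtspace V (a + 1)"
  using wtspace_mode[OF _ vac_weight, of u a "-2"] by (simp add: add.commute)

end

context graded_dg_module
begin

lemma OM_subspace: "M.vs.subspace (OM V M)"
  by (simp add: OM_def)

lemma circ_OM: "u \<in> wtspace V a \<Longrightarrow> x \<in> car M \<Longrightarrow> Z a 2 u x \<in> OM V M"
  unfolding OM_def circ_def by (rule M.vs.span_base) blast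

text \<open>
  Integration by parts with \<open>u\<^bsub>-2\<^esub>\<one>\<close>, of weight \<open>a + 1\<close>, in place of \<open>u\<close> raises the pole order by one.
\<close>

lemma zhu_OM:
  assumes u: "u \<in> wtspace V a" and x: "x \<in> car M" and r: "r \<ge> 2"
  shows "Z a r u x \<in> OM V M"
proof -
  have "Z a (2 + int k) u x \<in> OM V M" for k
    using u
  proof (induction k arbitrary: u a)
    case 0
    then show ?case using circ_OM[OF _ x] by simp
  next
    case (Suc k)
    define c :: complex where "c = of_int (2 + int k)"
    have c: "c \<noteq> 0" unfolding c_def of_int_eq_0_iff by simp
    have "Z (a + 1) (2 + int k) (vmode V u (-2) (vac V)) x
        - scl M (of_int (2 + int k) - 1 - of_real a) (Z a (2 + int k) u x) \<in> OM V M"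
      by (intro M.vs.subspace_diff M.vs.subspace_scale OM_subspace Suc.IH Suc.prems V.translation_weight)
    then have "scl M c (Z a (2 + int (Suc k)) u x) \<in> OM V M"
      unfolding zhu_translation[OF x] c_def by (simp add: add.assoc[symmetric] add.commute)
    then have "scl M (inverse c) (scl M c (Z a (2 + int (Suc k)) u x)) \<in> OM V M"
      by (rule M.vs.subspace_scale[OF OM_subspace])
    then show ?case using c by simp
  qed
  from this[of "nat (r - 2)"] r show ?thesis by simp
qed

lemma zhu_OM_Suc:
  assumes "u \<in> wtspace V a" "x \<in> car M" "r \<ge> 3"
  shows "Z (a + 1) r u x \<in> OM V M"
  unfolding zhu_pascal[OF assms(2)] using assms
  by (intro M.vs.subspace_add OM_subspace zhu_OM) auto

text \<open>
  The target may be another space than \<open>M\<close>, so that this also applies to morphisms of modules.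
\<close>

lemma OM_into:
  assumes f: "linear_on (scl M) t (car M) f" and t: "vector_space t" and T: "module.subspace t T"
    and gen: "\<And>p n u w. u \<in> wtspace V n \<Longrightarrow> u \<in> dgr V p \<Longrightarrow> w \<in> car M \<Longrightarrow> f (Z n 2 u w) \<in> T"
    and x: "x \<in> OM V M"
  shows "f x \<in> T"
proof -
  have "f (Z n 2 u w) \<in> T" if u: "u \<in> wtspace V n" and w: "w \<in> car M" for n u w
  proof (rule linear_on_span_into[where f = "\<lambda>u. f (Z n 2 u w)" and S = "\<Union>p. wtspace V n \<inter> dgr V p",
        OF V.vector_space t _ V.vs.subspace_UNIV subset_UNIV T])
    show "linear_on (scl V) t UNIV (\<lambda>u. f (Z n 2 u w))"
      using linear_on_add[OF zhu_linear_left[OF w]] linear_on_scale[OF zhu_linear_left[OF w]]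
        linear_on_add[OF f] linear_on_scale[OF f] zhu_car[OF w] by (simp add: linear_on_def)
    show "u \<in> V.vs.span (\<Union>p. wtspace V n \<inter> dgr V p)"
      by (rule subsetD[OF equalityD1[OF V.wtspace_graded] u])
  qed (use gen w in blast)
  then show ?thesis
    using x unfolding OM_def circ_def
    by (rule_tac linear_on_span_into[where f = f, OF M.vector_space t f M.car_subspace _ T])
      (auto intro: zhu_car)
qed

end

context graded_dg_module
begin

interpretation adj: graded_dg_module V "adjoint_module V"
  by (rule V.adjoint_graded_dg_module)

lemma OV_into:
  assumes f: "linear_on (scl V) (scl M) UNIV f" and T: "M.vs.subspace T"
    and gen: "\<And>g h u v. u \<in> Vp V g \<Longrightarrow> v \<in> Vp V h \<Longrightarrow> f (zhu (scl V) (vmode V) (snd g) 2 u v) \<in> T"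
    and a: "a \<in> OV V"
  shows "f a \<in> T"
proof (rule adj.OM_into[simplified, OF f M.vector_space T _ a])
  fix p n u w assume u: "u \<in> wtspace V n" "u \<in> dgr V p"
  note lin = adj.zhu_linear_right[simplified, of n 2 u]
  have "w \<in> V.vs.span (\<Union>g. Vp V g)"
    using adj.car_eq_span_Mp by auto
  then show "f (zhu (scl V) (vmode V) n 2 u w) \<in> T"
  proof (rule linear_on_span_into[where f = "\<lambda>w. f (zhu (scl V) (vmode V) n 2 u w)", OF V.vector_space M.vector_space
        _ V.vs.subspace_UNIV subset_UNIV T, rotated 2])
    show "linear_on (scl V) (scl M) UNIV (\<lambda>w. f (zhu (scl V) (vmode V) n 2 u w))"
      using linear_on_add[OF lin] linear_on_scale[OF lin] linear_on_add[OF f] linear_on_scale[OF f]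
      by (simp add: linear_on_def)
    fix v assume "v \<in> (\<Union>g. Vp V g)"
    then show "f (zhu (scl V) (vmode V) n 2 u v) \<in> T"
      using gen[of u "(p, n)"] u by (auto simp: Vp_def)
  qed
qed

text \<open>
  The left product with \<open>u\<close> for \<open>r = 1\<close>, the commutator with \<open>u\<close> for \<open>r = 0\<close>.  The weighted Jacobi identity for \<open>l = - r\<close>
  computes the circle product of \<open>u * v\<close>, or of the commutator of \<open>u\<close> and \<open>v\<close>, with \<open>w\<close>.  Apart from the operator applied to
  \<open>v \<circ> w\<close> all its terms lie in \<open>O(M)\<close>.
\<close>

lemma zhu_preserves_OM:
  assumes r: "r = 0 \<or> r = 1" and u: "u \<in> Vp V g" and x: "x \<in> OM V M"
  shows "Z (snd g + of_int r - 1) r u x \<in> OM V M"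
proof (rule OM_into[OF zhu_linear_right M.vector_space OM_subspace _ x])
  fix q b v w assume v: "v \<in> wtspace V b" "v \<in> dgr V q" and w: "w \<in> car M"
  let ?a = "snd g + of_int r - 1"
  have hu: "u \<in> dgr V (fst g)" "u \<in> wtspace V (snd g)" using u by (auto simp: Vp_def)
  define F where "F i = scl M ((-1) ^ i * (of_int (- r) gchoose i))
        (Z ?a (int i - - r) u (Z b (2 - int i) v w)
         - scl M ((-1) powi (- r) * ksign (fst g) q) (Z b (2 - - r + int i) v (Z ?a (- int i) u w)))" for i
  have O: "Z b (2 - - r + int i) v y \<in> OM V M" if "y \<in> car M" for i y
    using r by (intro zhu_OM v that) auto
  have wt: "vmode V u (- r + int j) v \<in> wtspace V (?a + b - real j)" for j
    using V.wtspace_mode[OF hu(2) v(1), of "- r + int j"] by (simp add: algebra_simps)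
  have "Sum_any F = Sum_any (\<lambda>j. scl M (of_real ?a gchoose j) (Z (?a + b - real j) 2 (vmode V u (- r + int j) v) w))"
    unfolding F_def by (rule zhu_jacobi[OF hu(1) v(2) w, symmetric])
  also have "\<dots> \<in> OM V M"
    by (intro M.vs.Sum_any_in_subspace M.vs.subspace_scale OM_subspace zhu_OM[OF wt w]) simp
  finally have "Sum_any F \<in> OM V M" .
  moreover have "Sum_any F - F 0 \<in> OM V M"
  proof (rule M.vs.Sum_any_head[OF OM_subspace])
    show "finite {i. F i \<noteq> 0}" unfolding F_def by (rule zhu_jacobi_finite[OF w])
    fix i :: nat assume i: "i > 0"
    show "F i \<in> OM V M"
    proof (cases "r = 0")
      case True
      then show ?thesis using i M.vs.subspace_0[OF OM_subspace] by (simp add: F_def gbinomial_0_left)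
    next
      case False
      then have "Z ?a (int i - - r) u (Z b (2 - int i) v w) \<in> OM V M"
        using r i by (intro zhu_OM zhu_car w) (auto simp: hu)
      then show ?thesis
        unfolding F_def by (intro M.vs.subspace_scale M.vs.subspace_diff OM_subspace O zhu_car w)
    qed
  qed
  ultimately have "Sum_any F - (Sum_any F - F 0) \<in> OM V M"
    by (rule M.vs.subspace_diff[OF OM_subspace])
  then have "F 0 \<in> OM V M" by simp
  moreover have "F 0 = Z ?a r u (Z b 2 v w)
      - scl M ((-1) powi (- r) * ksign (fst g) q) (Z b (2 - - r + int 0) v (Z ?a 0 u w))"
    by (simp add: F_def)
  moreover have "scl M ((-1) powi (- r) * ksign (fst g) q) (Z b (2 - - r + int 0) v (Z ?a 0 u w)) \<in> OM V M"
    by (intro M.vs.subspace_scale OM_subspace O zhu_car w)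
  ultimately show "Z ?a r u (Z b 2 v w) \<in> OM V M"
    using M.vs.subspace_add[OF OM_subspace] by fastforce
qed

lemma circ_Sum_any_image:
  assumes E: "linear_on (scl V) (scl M) UNIV E"
  shows "E (zhu (scl V) (vmode V) a 2 u v) = Sum_any (\<lambda>j. scl M (of_real a gchoose j) (E (vmode V u (-2 + int j) v)))"
proof -
  have "E (zhu (scl V) (vmode V) a 2 u v) = Sum_any (\<lambda>j. E (scl V (of_real a gchoose j) (vmode V u (int j - 2) v)))"
    unfolding zhu_def using adj.zhu_finite by (intro linear_on_Sum_any[OF V.vector_space E]) simp
  then show ?thesis by (simp add: linear_on_scale[OF E])
qed

text \<open>
  On \<open>u \<circ> v\<close> the extended operator \<open>E\<close> is the left hand side of the weighted Jacobi identity for \<open>l = -2\<close>, since the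
  exponents there follow the weights of the vectors \<open>u\<^bsub>j - 2\<^esub>v\<close>.  On the right hand side the operator applied last always
  maps into \<open>O(M)\<close>.
\<close>

lemma OV_zhu:
  assumes low: "\<And>b v y i. \<lbrakk>v \<in> wtspace V b; y \<in> car M\<rbrakk> \<Longrightarrow> Z (b + 1 + c) (r + 2 + int i) v y \<in> OM V M"
    and E: "linear_on (scl V) (scl M) UNIV E" "\<And>n v. v \<in> wtspace V n \<Longrightarrow> E v = Z (n + c) r v x"
    and x: "x \<in> car M" and a: "a \<in> OV V"
  shows "E a \<in> OM V M"
proof (rule OV_into[OF E(1) OM_subspace _ a])
  fix g h u v assume uv: "u \<in> Vp V g" "v \<in> Vp V h"
  then have u: "u \<in> dgr V (fst g)" "u \<in> wtspace V (snd g)" and v: "v \<in> dgr V (fst h)" "v \<in> wtspace V (snd h)"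
    by (auto simp: Vp_def)
  have "vmode V u (-2 + int j) v \<in> wtspace V (snd g + snd h - real j + 1)" for j
    using V.wtspace_mode[OF u(2) v(2), of "-2 + int j"] by (simp add: algebra_simps)
  from E(2)[OF this]
  have "E (vmode V u (-2 + int j) v) = Z (snd g + (snd h + 1 + c) - real j) r (vmode V u (-2 + int j) v) x" for j
    by (simp add: algebra_simps)
  then have "E (zhu (scl V) (vmode V) (snd g) 2 u v)
      = Sum_any (\<lambda>j. scl M (of_real (snd g) gchoose j)
          (Z (snd g + (snd h + 1 + c) - real j) r (vmode V u (-2 + int j) v) x))"
    by (simp only: circ_Sum_any_image[OF E(1)])
  also have "\<dots> \<in> OM V M"
  proof -
    have U: "Z (snd g) (int i - - 2) u y \<in> OM V M" if "y \<in> car M" for i y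
      by (rule zhu_OM[OF u(2) that]) simp
    have L: "Z (snd h + 1 + c) (r - - 2 + int i) v y \<in> OM V M" if "y \<in> car M" for i y
      using low[OF v(2) that] by simp
    show ?thesis
      unfolding zhu_jacobi[OF u(1) v(1) x]
      by (intro M.vs.Sum_any_in_subspace M.vs.subspace_scale M.vs.subspace_diff OM_subspace U L zhu_car x)
  qed
  finally show "E (zhu (scl V) (vmode V) (snd g) 2 u v) \<in> OM V M" .
qed

lemma dif_OM: "x \<in> OM V M \<Longrightarrow> dif M x \<in> OM V M"
proof (rule OM_into[OF M.dif_linear M.vector_space OM_subspace])
  fix p n u w assume u: "u \<in> wtspace V n" "u \<in> dgr V p" and w: "w \<in> car M"
  have "dif M (mmode M u k w) = mmode M (dif V u) k w + scl M ((-1) powi p) (mmode M u k (dif M w))" for k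
    using mode_dif[OF u(2) w, of k] by simp
  then have "dif M (Z n 2 u w) = Sum_any (\<lambda>k. scl M (of_real n gchoose k) (mmode M (dif V u) (int k - 2) w)
      + scl M ((-1) powi p) (scl M (of_real n gchoose k) (mmode M u (int k - 2) (dif M w))))"
    by (simp add: zhu_image[OF M.vector_space M.dif_linear w] M.vs.scale_right_distrib mult.commute)
  also have "\<dots> = Z n 2 (dif V u) w + scl M ((-1) powi p) (Z n 2 u (dif M w))"
    using zhu_finite[OF w] zhu_finite[OF M.dif_car[OF w]]
    by (subst Sum_any.distrib) (simp_all add: zhu_def M.vs.scale_Sum_any)
  finally have "dif M (Z n 2 u w) = Z n 2 (dif V u) w + scl M ((-1) powi p) (Z n 2 u (dif M w))" .
  then show "dif M (Z n 2 u w) \<in> OM V M"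
    using u w by (auto intro!: M.vs.subspace_add M.vs.subspace_scale OM_subspace circ_OM V.wtspace_dif M.dif_car)
qed

end

section \<open>Leading terms\<close>

text \<open>
  The bidegrees of the terms that are divided out in \<open>I\<close> and \<open>J\<close> besides \<open>O(V)\<close> and \<open>O(M)\<close>.
\<close>

definition below :: "bideg \<Rightarrow> bideg \<Rightarrow> bool" where
  "below k g \<longleftrightarrow> fst k \<le> fst g \<and> snd k \<le> snd g \<and> k \<noteq> g"

lemma below_simps:
  "below (p, m) (q, n) \<longleftrightarrow> p \<le> q \<and> m \<le> n \<and> (p < q \<or> m < n)"
  by (auto simp: below_def)

context graded_dg_module
begin

definition lower :: "bideg \<Rightarrow> 'm set" where
  "lower g = M.vs.span (\<Union>{Mp M k | k. below k g})"

lemma lower_subspace: "M.vs.subspace (lower g)"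
  by (simp add: lower_def)

lemma Mp_lower: "below k g \<Longrightarrow> x \<in> Mp M k \<Longrightarrow> x \<in> lower g"
  unfolding lower_def by (rule M.vs.span_base) blast

lemma lower_car: "x \<in> lower g \<Longrightarrow> x \<in> car M"
  unfolding lower_def
  by (rule M.vs.span_minimal[OF _ M.car_subspace, THEN subsetD]) (auto dest: Mp_car)

lemma OM_car: "x \<in> OM V M \<Longrightarrow> x \<in> car M"
  unfolding OM_def circ_def
  by (rule M.vs.span_minimal[OF _ M.car_subspace, THEN subsetD]) (auto intro: zhu_car)

lemma lower_into:
  assumes f: "linear_on (scl M) t (car M) f" and t: "vector_space t" and T: "module.subspace t T"
    and gen: "\<And>k y. below k g \<Longrightarrow> y \<in> Mp M k \<Longrightarrow> f y \<in> T" and x: "x \<in> lower g"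
  shows "f x \<in> T"
  using x unfolding lower_def
  by (rule_tac linear_on_span_into[where f = f, OF M.vector_space t f M.car_subspace _ T])
    (auto intro: gen dest: Mp_car)

text \<open>
  The two families of lower components overlap, and together are all components of bidegree below \<open>g\<close>.
\<close>

lemma JM_eq: "JM V M g = OM V M + lower g"
proof -
  let ?A = "\<Union>{Mp M (q, m) | q m. q \<le> fst g \<and> m < snd g}" and ?B = "\<Union>{Mp M (q, m) | q m. q < fst g \<and> m \<le> snd g}"
  have 1: "?A \<subseteq> lower g" "?B \<subseteq> lower g"
    by (auto intro!: Mp_lower[rotated] simp: below_def)
  have "M.vs.span ?A + M.vs.span ?B \<subseteq> lower g"
    using M.vs.span_minimal[OF 1(1) lower_subspace] M.vs.span_minimal[OF 1(2) lower_subspace]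
      M.vs.subspace_add[OF lower_subspace[of g]] by (blast elim!: set_plus_elim)
  moreover have "lower g \<subseteq> M.vs.span ?A + M.vs.span ?B"
    unfolding lower_def
  proof (rule M.vs.span_minimal[OF _ M.vs.subspace_set_plus[OF M.vs.subspace_span M.vs.subspace_span]])
    show "\<Union>{Mp M k | k. below k g} \<subseteq> M.vs.span ?A + M.vs.span ?B"
    proof
      fix x assume "x \<in> \<Union>{Mp M k | k. below k g}"
      then obtain q m where x: "x \<in> Mp M (q, m)" and b: "below (q, m) g" by auto
      from b have "q \<le> fst g \<and> m < snd g \<or> q < fst g \<and> m \<le> snd g"
        by (cases g) (auto simp: below_simps)
      with x have "x \<in> ?A \<or> x \<in> ?B" by blast
      then show "x \<in> M.vs.span ?A + M.vs.span ?B"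
      proof
        assume "x \<in> ?A"
        then have "x + 0 \<in> M.vs.span ?A + M.vs.span ?B"
          by (intro set_plus_intro M.vs.span_base M.vs.span_zero)
        then show ?thesis by simp
      next
        assume "x \<in> ?B"
        then have "0 + x \<in> M.vs.span ?A + M.vs.span ?B"
          by (intro set_plus_intro M.vs.span_base M.vs.span_zero)
        then show ?thesis by simp
      qed
    qed
  qed
  ultimately have "lower g = M.vs.span ?A + M.vs.span ?B" by simp
  then show ?thesis unfolding JM_def by (simp only: add.assoc)
qed

lemma JM_subspace: "M.vs.subspace (JM V M g)"
  unfolding JM_eq by (rule M.vs.subspace_set_plus[OF OM_subspace lower_subspace])

lemma OM_JM: "x \<in> OM V M \<Longrightarrow> x \<in> JM V M g"
  and lower_JM: "x \<in> lower g \<Longrightarrow> x \<in> JM V M g"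
  using set_plus_intro[of x "OM V M" 0 "lower g"] set_plus_intro[of 0 "OM V M" x "lower g"]
    M.vs.subspace_0[OF OM_subspace] M.vs.subspace_0[OF lower_subspace] by (simp_all add: JM_eq)

lemma JM_into:
  assumes f: "linear_on (scl M) t (car M) f" and t: "vector_space t" and T: "module.subspace t T"
    and O: "\<And>y. y \<in> OM V M \<Longrightarrow> f y \<in> T" and L: "\<And>k y. below k g \<Longrightarrow> y \<in> Mp M k \<Longrightarrow> f y \<in> T"
    and x: "x \<in> JM V M g"
  shows "f x \<in> T"
proof -
  interpret t: vector_space t by (rule t)
  obtain y l where x: "x = y + l" "y \<in> OM V M" "l \<in> lower g"
    using x unfolding JM_eq by (rule set_plus_elim)
  have "f l \<in> T" by (rule lower_into[OF f t T L x(3)])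
  then have "f y + f l \<in> T" by (rule t.subspace_add[OF T O[OF x(2)]])
  then show ?thesis
    using linear_on_add[OF f OM_car lower_car] x by simp
qed

lemma zhu_term:
  assumes "u \<in> Vp V g" "x \<in> Mp M h"
  shows "mmode M u (int n - r) x \<in> Mp M (g + h + (2 * r - 2, of_int r - 1) - (2 * int n, real n))"
  by (rule Mp_mode[OF assms]) (simp add: prod_eq_iff)

lemma zhu_lower:
  assumes u: "u \<in> Vp V g" and x: "x \<in> Mp M h" and b: "below (g + h + (2 * r - 2, of_int r - 1)) k"
  shows "Z c r u x \<in> lower k"
proof -
  have "below (g + h + (2 * r - 2, of_int r - 1) - (2 * int n, real n)) k" for n
    using b by (auto simp: below_def prod_eq_iff)
  then show ?thesis
    unfolding zhu_def
    by (intro M.vs.Sum_any_in_subspace M.vs.subspace_scale lower_subspace Mp_lower[OF _ zhu_term[OF u x]])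
qed

text \<open>
  Raising the index of the mode by \<open>n\<close> lowers the bidegree by \<open>(2 n, n)\<close>.
\<close>

lemma zhu_leading_terms:
  assumes u: "u \<in> Vp V g" and x: "x \<in> Mp M h"
    and b: "\<And>n. n \<ge> N \<Longrightarrow> below (g + h + (2 * r - 2, of_int r - 1) - (2 * int n, real n)) k"
  shows "Z c r u x - (\<Sum>n<N. scl M (of_real c gchoose n) (mmode M u (int n - r) x)) \<in> lower k"
  unfolding zhu_def
  using b zhu_finite[OF Mp_car[OF x]]
  by (intro M.vs.Sum_any_initial lower_subspace M.vs.subspace_scale Mp_lower[OF _ zhu_term[OF u x]])

lemma zhu_leading:
  assumes u: "u \<in> Vp V g" and x: "x \<in> Mp M h" and k: "k = g + h + (2 * r - 2, of_int r - 1)"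
  shows "Z c r u x - mmode M u (- r) x \<in> lower k"
proof -
  have "below (g + h + (2 * r - 2, of_int r - 1) - (2 * int n, real n)) k" if "n \<ge> 1" for n
    using that by (auto simp: below_def prod_eq_iff k)
  from zhu_leading_terms[where N = 1, OF u x this] show ?thesis by simp
qed

lemma star_two_terms:
  assumes u: "u \<in> Vp V g" and x: "x \<in> Mp M h"
  shows "Z c 1 u x - (mmode M u (-1) x + scl M (of_real c) (mmode M u 0 x)) \<in> lower (brdeg g h)"
proof -
  have "below (g + h + (2 * 1 - 2, of_int 1 - 1) - (2 * int n, real n)) (brdeg g h)" if "n \<ge> 2" for n
    using that by (auto simp: below_def prod_eq_iff)
  from zhu_leading_terms[where N = 2, OF u x this] show ?thesis
    by (simp add: numeral_2_eq_2)
qed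

lemma Mp_projection:
  assumes "snd g \<in> half_ints"
  obtains \<pi> where "linear_on (scl M) (scl M) (car M) \<pi>" "\<And>x. x \<in> Mp M g \<Longrightarrow> \<pi> x = x"
    "\<And>k x. x \<in> Mp M k \<Longrightarrow> k \<noteq> g \<Longrightarrow> \<pi> x = 0"
proof -
  have lin: "linear_on (scl M) (scl M) X (if b then (\<lambda>x. x) else (\<lambda>x. 0))" for b X
    by (simp add: linear_on_def)
  obtain \<pi>\<^sub>1 where p1: "linear_on (scl M) (scl M) (car M) \<pi>\<^sub>1"
    "\<And>p x. x \<in> dgr M p \<Longrightarrow> \<pi>\<^sub>1 x = (if p = fst g then (\<lambda>x. x) else (\<lambda>x. 0)) x"
    by (rule direct_sum_linear_extension[where \<phi> = "\<lambda>p. if p = fst g then (\<lambda>x. x) else (\<lambda>x. 0)",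
          OF M.vector_space M.vector_space M.degree_decomposition lin]) blast
  obtain \<pi>\<^sub>2 where p2: "linear_on (scl M) (scl M) (car M) \<pi>\<^sub>2"
    "\<And>n x. n \<in> half_ints \<Longrightarrow> x \<in> mwt M n \<Longrightarrow> \<pi>\<^sub>2 x = (if n = snd g then (\<lambda>x. x) else (\<lambda>x. 0)) x"
    by (rule direct_sum_linear_extension[where \<phi> = "\<lambda>n. if n = snd g then (\<lambda>x. x) else (\<lambda>x. 0)",
          OF M.vector_space M.vector_space mwt_decomposition lin]) blast
  have z: "\<pi>\<^sub>1 0 = 0" "\<pi>\<^sub>2 0 = 0"
    using linear_on_zero[OF p1(1)] linear_on_zero[OF p2(1)] M.vs.subspace_0[OF M.car_subspace] by auto
  have p12: "\<pi>\<^sub>2 (\<pi>\<^sub>1 x) = (if k = g then x else 0)" if x: "x \<in> Mp M k" for k x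
  proof (cases "snd k \<in> half_ints")
    case True
    have "\<pi>\<^sub>1 x = (if fst k = fst g then x else 0)" "\<pi>\<^sub>2 x = (if snd k = snd g then x else 0)"
      using x p1(2)[of x "fst k"] p2(2)[OF True, of x] by (auto simp: Mp_def)
    then show ?thesis by (auto simp: z prod_eq_iff)
  next
    case False
    then have "x = 0" using x mwt_off by (auto simp: Mp_def)
    then show ?thesis by (simp add: z)
  qed
  have \<pi>1_car: "\<pi>\<^sub>1 x \<in> car M" if x: "x \<in> car M" for x
  proof (rule linear_on_span_into[where f = \<pi>\<^sub>1 and S = "\<Union>p. dgr M p", OF M.vector_space M.vector_space p1(1)
          M.car_subspace _ M.car_subspace])
    show "x \<in> M.vs.span (\<Union>p. dgr M p)" using x unfolding M.car_eq_span .
    show "\<pi>\<^sub>1 y \<in> car M" if "y \<in> (\<Union>p. dgr M p)" for y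
      using that p1(2) M.dgr_car M.vs.subspace_0[OF M.car_subspace] by fastforce
  qed (use M.dgr_car in blast)
  show ?thesis
  proof
    show "linear_on (scl M) (scl M) (car M) (\<lambda>x. \<pi>\<^sub>2 (\<pi>\<^sub>1 x))"
      using linear_on_add[OF p1(1)] linear_on_scale[OF p1(1)] linear_on_add[OF p2(1)] linear_on_scale[OF p2(1)]
      by (simp add: linear_on_def \<pi>1_car)
  qed (simp_all add: p12)
qed

text \<open>
  A homogeneous element of \<open>C\<^sub>2(M)\<close> is a combination of generators \<open>u\<^bsub>-2\<^esub>w\<close> of various bidegrees.  The projection to its own
  bidegree removes all but those that are leading terms of \<open>u \<circ> w\<close> there.
\<close>

lemma C2M_Mp_JM:
  assumes x: "x \<in> C2M M" "x \<in> Mp M g"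
  shows "x \<in> JM V M g"
proof (cases "snd g \<in> half_ints")
  case True
  then obtain \<pi> where \<pi>: "linear_on (scl M) (scl M) (car M) \<pi>" "\<And>x. x \<in> Mp M g \<Longrightarrow> \<pi> x = x"
    "\<And>k x. x \<in> Mp M k \<Longrightarrow> k \<noteq> g \<Longrightarrow> \<pi> x = 0"
    by (rule Mp_projection) blast
  have hom: "\<pi> (mmode M u (-2) w) \<in> JM V M g" if u: "u \<in> Vp V h" and w: "w \<in> Mp M k" for u w h k
  proof (cases "g = h + k + (2, 1)")
    case True
    have lead: "Z (snd h) 2 u w - mmode M u (-2) w \<in> lower g"
      by (rule zhu_leading[OF u w]) (simp add: True)
    have "Z (snd h) 2 u w - (Z (snd h) 2 u w - mmode M u (-2) w) \<in> JM V M g"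
      using u by (intro M.vs.subspace_diff JM_subspace OM_JM circ_OM Mp_car[OF w] lower_JM lead)
        (simp add: Vp_def)
    moreover have "mmode M u (-2) w \<in> Mp M g"
      by (rule Mp_mode[OF u w]) (simp add: True prod_eq_iff)
    ultimately show ?thesis by (simp add: \<pi>(2))
  next
    case False
    have "mmode M u (-2) w \<in> Mp M (h + k + (2, 1))"
      by (rule Mp_mode[OF u w]) (simp add: prod_eq_iff)
    then show ?thesis using \<pi>(3) False M.vs.subspace_0[OF JM_subspace] by metis
  qed
  have lin: "linear_on (scl M) (scl M) (car M) (\<lambda>w. \<pi> (mmode M u (-2) w))" for u
    using linear_on_add[OF \<pi>(1)] linear_on_scale[OF \<pi>(1)]
    by (simp add: linear_on_def mode_add_right mode_scale_right mode_car)
  have lin': "linear_on (scl V) (scl M) UNIV (\<lambda>u. \<pi> (mmode M u (-2) w))" if "w \<in> car M" for w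
    using linear_on_add[OF \<pi>(1)] linear_on_scale[OF \<pi>(1)] that
    by (simp add: linear_on_def mode_add_left mode_scale_left mode_car)
  have "\<pi> (mmode M u (-2) w) \<in> JM V M g" if u: "u \<in> Vp V h" and w: "w \<in> car M" for u w h
    by (rule linear_on_span_into[where f = "\<lambda>w. \<pi> (mmode M u (-2) w)" and S = "\<Union>k. Mp M k",
          OF M.vector_space M.vector_space lin M.car_subspace _ JM_subspace])
      (use hom[OF u] w car_eq_span_Mp in \<open>auto dest: Mp_car\<close>)
  then have "\<pi> (mmode M u (-2) w) \<in> JM V M g" if w: "w \<in> car M" for u w
    by (rule_tac linear_on_span_into[where f = "\<lambda>u. \<pi> (mmode M u (-2) w)" and S = "\<Union>k. Vp V k",
          OF V.vector_space M.vector_space lin'[OF w] V.vs.subspace_UNIV _ JM_subspace])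
      (use w graded_dg_module.car_eq_span_Mp[OF V.adjoint_graded_dg_module] in auto)
  then have "\<pi> x \<in> JM V M g"
    by (intro C2M_into[OF \<pi>(1) JM_subspace _ x(1)])
  then show ?thesis by (simp add: \<pi>(2)[OF x(2)])
next
  case False
  then have "x = 0" using x(2) mwt_off by (auto simp: Mp_def)
  then show ?thesis using M.vs.subspace_0[OF JM_subspace] by simp
qed

lemma Mp_eq_0: "snd g \<notin> half_ints \<Longrightarrow> Mp M g = {0}"
  using mwt_off[of "snd g"] M.vs.subspace_0[OF Mp_subspace, of g] by (auto simp: Mp_def)

lemma zhu_extension:
  assumes x: "x \<in> car M"
  obtains E where "linear_on (scl V) (scl M) UNIV E" "\<And>n v. v \<in> wtspace V n \<Longrightarrow> E v = Z (n + c) r v x"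
proof -
  have lin: "linear_on (scl V) (scl M) X (\<lambda>v. Z (n + c) r v x)" for n X
    by (rule linear_on_subset[OF zhu_linear_left[OF x]]) simp
  obtain E where E: "linear_on (scl V) (scl M) UNIV E"
    "\<And>n v. n \<in> half_ints \<Longrightarrow> v \<in> wtspace V n \<Longrightarrow> E v = Z (n + c) r v x"
    by (rule direct_sum_linear_extension[where \<phi> = "\<lambda>n v. Z (n + c) r v x",
          OF V.vector_space M.vector_space V.weight_decomposition lin]) blast
  have "E v = Z (n + c) r v x" if v: "v \<in> wtspace V n" for n v
  proof (cases "n \<in> half_ints")
    case False
    then have "v = 0" using v V.wtspace_off by auto
    then show ?thesis using linear_on_zero[OF E(1)] linear_on_zero[OF lin[of UNIV]] by simp
  qed (rule E(2)[OF _ v])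
  with E(1) show thesis by (rule that)
qed

end

section \<open>Operations on the graded space of \<open>A(M)\<close>\<close>

lemma IV_adjoint [simp]: "JM V (adjoint_module V) g = IV V g"
  by (simp add: JM_def IV_def)

context graded_dg_module
begin

interpretation adj: graded_dg_module V "adjoint_module V"
  by (rule V.adjoint_graded_dg_module)

lemma IV_into:
  assumes f: "linear_on (scl V) (scl M) UNIV f" and T: "M.vs.subspace T"
    and O: "\<And>y. y \<in> OV V \<Longrightarrow> f y \<in> T" and L: "\<And>k y. below k g \<Longrightarrow> y \<in> Vp V k \<Longrightarrow> f y \<in> T"
    and x: "x \<in> IV V g"
  shows "f x \<in> T"
  using adj.JM_into[OF _ M.vector_space T, of f g x] assms by simp

text \<open>
  The mode \<open>-r\<close> is the leading term of \<open>Z c r\<close>.  If this operator preserves \<open>O(M)\<close>, it is compatible with \<open>J\<close>, since none of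
  its terms has a higher bidegree than the leading one.
\<close>

lemma mode_JM:
  assumes u: "u \<in> Vp V g" and O: "\<And>y. y \<in> OM V M \<Longrightarrow> Z c r u y \<in> OM V M"
    and x: "x \<in> JM V M h" "x \<in> Mp M h" and k: "k = g + h + (2 * r - 2, of_int r - 1)"
  shows "mmode M u (- r) x \<in> JM V M k"
proof -
  have "Z c r u x \<in> JM V M k"
  proof (rule JM_into[OF zhu_linear_right M.vector_space JM_subspace _ _ x(1)])
    show "Z c r u y \<in> JM V M k" if "y \<in> OM V M" for y
      by (rule OM_JM[OF O[OF that]])
    show "Z c r u y \<in> JM V M k" if "below l h" "y \<in> Mp M l" for l y
      by (rule lower_JM[OF zhu_lower[OF u that(2)]])
        (use that(1) in \<open>cases g; cases h; cases l; simp add: below_simps k\<close>)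
  qed
  from M.vs.subspace_diff[OF JM_subspace this lower_JM[OF zhu_leading[OF u x(2) k, where c = c]]]
  show ?thesis by simp
qed

lemma product_JM:
  "\<lbrakk>u \<in> Vp V g; x \<in> JM V M h; x \<in> Mp M h\<rbrakk> \<Longrightarrow> mmode M u (-1) x \<in> JM V M (g + h)"
  using mode_JM[of u g "snd g" 1] zhu_preserves_OM[of 1 u g] by (simp add: prod_eq_iff)

lemma bracket_JM:
  "\<lbrakk>u \<in> Vp V g; x \<in> JM V M h; x \<in> Mp M h\<rbrakk> \<Longrightarrow> mmode M u 0 x \<in> JM V M (brdeg g h)"
  using mode_JM[of u g "snd g - 1" 0] zhu_preserves_OM[of 0 u g] by (simp add: prod_eq_iff)

text \<open>
  The same in the other argument.  The component in \<open>O(V)\<close> of an element of \<open>I\<close> need not be homogeneous, so the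
  operator, whose exponent depends on the weight, is first extended linearly to \<open>V\<close>.
\<close>

lemma IV_mode:
  assumes O: "\<And>E y. \<lbrakk>linear_on (scl V) (scl M) UNIV E; \<And>n v. v \<in> wtspace V n \<Longrightarrow> E v = Z (n + c) r v x; y \<in> OV V\<rbrakk>
      \<Longrightarrow> E y \<in> OM V M"
    and u: "u \<in> IV V g" "u \<in> Vp V g" and x: "x \<in> Mp M h" and k: "k = g + h + (2 * r - 2, of_int r - 1)"
  shows "mmode M u (- r) x \<in> JM V M k"
proof -
  obtain E where E: "linear_on (scl V) (scl M) UNIV E" "\<And>n v. v \<in> wtspace V n \<Longrightarrow> E v = Z (n + c) r v x"
    using zhu_extension[OF Mp_car[OF x]] by blast
  have E_Vp: "E v = Z (snd l + c) r v x" if "v \<in> Vp V l" for v l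
    using E(2)[of v "snd l"] that by (simp add: Vp_def)
  have "E u \<in> JM V M k"
  proof (rule IV_into[OF E(1) JM_subspace _ _ u(1)])
    show "E y \<in> JM V M k" if "y \<in> OV V" for y
      by (rule OM_JM[OF O[OF E that]])
    show "E y \<in> JM V M k" if "below l g" "y \<in> Vp V l" for l y
      unfolding E_Vp[OF that(2)]
      by (rule lower_JM[OF zhu_lower[OF that(2) x]])
        (use that(1) in \<open>cases g; cases h; cases l; simp add: below_simps k\<close>)
  qed
  then have "Z (snd g + c) r u x \<in> JM V M k" by (simp add: E_Vp[OF u(2)])
  from M.vs.subspace_diff[OF JM_subspace this lower_JM[OF zhu_leading[OF u(2) x k, where c = "snd g + c"]]]
  show ?thesis by simp
qed

lemma IV_product:
  assumes "u \<in> IV V g" "u \<in> Vp V g" "x \<in> Mp M h"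
  shows "mmode M u (-1) x \<in> JM V M (g + h)"
proof (rule IV_mode[where c = 0 and r = 1, OF _ assms])
  fix E y assume E: "linear_on (scl V) (scl M) UNIV E" "\<And>n v. v \<in> wtspace V n \<Longrightarrow> E v = Z (n + 0) 1 v x" "y \<in> OV V"
  show "E y \<in> OM V M"
    by (rule OV_zhu[OF _ E(1,2) Mp_car[OF assms(3)] E(3)]) (simp add: zhu_OM_Suc)
qed (simp add: prod_eq_iff)

lemma IV_bracket:
  assumes "u \<in> IV V g" "u \<in> Vp V g" "x \<in> Mp M h"
  shows "mmode M u 0 x \<in> JM V M (brdeg g h)"
proof (rule IV_mode[where c = "-1" and r = 0, OF _ assms, unfolded minus_zero])
  fix E y assume E: "linear_on (scl V) (scl M) UNIV E" "\<And>n v. v \<in> wtspace V n \<Longrightarrow> E v = Z (n + -1) 0 v x" "y \<in> OV V"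
  show "E y \<in> OM V M"
    by (rule OV_zhu[OF _ E(1,2) Mp_car[OF assms(3)] E(3)]) (simp add: zhu_OM)
qed (simp add: prod_eq_iff)

lemma dif_JM: "x \<in> JM V M g \<Longrightarrow> dif M x \<in> JM V M (up g)"
proof (rule JM_into[OF M.dif_linear M.vector_space JM_subspace])
  show "dif M y \<in> JM V M (up g)" if "y \<in> OM V M" for y
    by (rule OM_JM[OF dif_OM[OF that]])
  show "dif M y \<in> JM V M (up g)" if "below k g" "y \<in> Mp M k" for k y
    by (rule lower_JM[OF Mp_lower[OF _ Mp_dif[OF that(2)]]])
      (use that(1) in \<open>cases g; cases k; auto simp: below_simps\<close>)
qed

text \<open>By Pascal's rule the left product minus the right product is \<open>Z (a - 1) 0\<close> for \<open>u\<close> of weight \<open>a\<close>.\<close>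

lemma star_commutator_JM:
  assumes u: "u \<in> Vp V g" and x: "x \<in> Mp M h"
  shows "star_l (scl M) (mmode M) g u x - scl M (gsign g h) (star_r (scl M) (mmode M) g h x u) - mmode M u 0 x
    \<in> JM V M (brdeg g h)"
proof -
  have "Z (snd g) 1 u x = Z (snd g - 1) 1 u x + Z (snd g - 1) 0 u x"
    using zhu_pascal[OF Mp_car[OF x], of "snd g - 1" 1 u] by simp
  then have "star_l (scl M) (mmode M) g u x - scl M (gsign g h) (star_r (scl M) (mmode M) g h x u) = Z (snd g - 1) 0 u x"
    by (simp add: star_l_def star_r_def)
  then show ?thesis
    using lower_JM[OF zhu_leading[OF u x, of "brdeg g h" 0 "snd g - 1"]] by (simp add: prod_eq_iff)
qed

lemma star_JM:
  assumes u: "u \<in> Vp V g" and x: "x \<in> Mp M h"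
  shows "star_l (scl M) (mmode M) g u x - mmode M u (-1) x \<in> JM V M (g + h)"
  unfolding star_l_def
  using lower_JM[OF zhu_leading[OF u x, of "g + h" 1 "snd g"]] by (simp add: prod_eq_iff)

end

context dg_vertex_operator_algebra
begin

interpretation adj: graded_dg_module V "adjoint_module V"
  by (rule adjoint_graded_dg_module)

lemmas IV_subspace = adj.JM_subspace[simplified]
lemmas OV_IV = adj.OM_JM[simplified]

text \<open>
  The vectors \<open>w\<^bsub>-1 - q\<^esub>\<one>\<close> are the divided powers of the translation operator applied to \<open>w\<close>.  The relations obtained from
  \<open>zhu_OM\<close> for the vacuum express each of them by earlier ones modulo \<open>O(V)\<close>, hence as a multiple of \<open>w\<close>.
\<close>

lemma creation_modes_OV:
  assumes w: "w \<in> wtspace V k" and T: "vs.subspace T" "OV V \<subseteq> T" "w \<in> T"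
  shows "vmode V w (-1 - int q) (vac V) \<in> T"
proof (induction q rule: less_induct)
  case (less q)
  show ?case
  proof (cases "q = 0")
    case True
    then show ?thesis using T(3) by (simp add: creation)
  next
    case False
    define f where "f n = scl V (of_real k gchoose n) (vmode V w (int n - (int q + 1)) (vac V))" for n
    have "Sum_any f \<in> T"
      using adj.zhu_OM[OF w, of "vac V" "int q + 1"] False T(2) by (auto simp: f_def zhu_def)
    moreover have "Sum_any f - f 0 \<in> T"
    proof (rule vs.Sum_any_head[OF T(1)])
      show "finite {n. f n \<noteq> 0}"
        unfolding f_def using adj.zhu_finite[of "vac V"] by simp
      show "f n \<in> T" if "n > 0" for n
      proof (cases "n \<le> q")
        case True
        then have "vmode V w (-1 - int (q - n)) (vac V) \<in> T" using that by (intro less) simp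
        then show ?thesis using True
          by (simp add: f_def vs.subspace_scale[OF T(1)] of_nat_diff algebra_simps)
      next
        case False
        then show ?thesis using vs.subspace_0[OF T(1)] by (simp add: f_def creation)
      qed
    qed
    ultimately have "Sum_any f - (Sum_any f - f 0) \<in> T" by (rule vs.subspace_diff[OF T(1)])
    then show ?thesis by (simp add: f_def algebra_simps)
  qed
qed

lemma translation_OV:
  assumes w: "w \<in> wtspace V k"
  shows "vmode V w (-2) (vac V) + scl V (of_real k) w \<in> OV V"
proof -
  have "zhu (scl V) (vmode V) k 2 w (vac V) = (\<Sum>n<2. scl V (of_real k gchoose n) (vmode V w (int n - 2) (vac V)))"
    by (rule adj.zhu_eq_sum[simplified]) (simp add: creation)
  then show ?thesis
    using adj.zhu_OM[OF w, of "vac V" 2] by (simp add: numeral_2_eq_2 creation)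
qed

text \<open>
  In the algebra the bracket is a commutator of left products, without reference to the right product.
  The terms \<open>v\<^bsub>-1\<^esub>u\<close> and \<open>v\<^sub>0u\<close> of \<open>v * u\<close> are rewritten by skew symmetry.  To this order
  \<open>v\<^bsub>-1\<^esub>u\<close> contributes the derivative of \<open>u\<^sub>0v\<close>, which \<open>O(V)\<close> replaces by a multiple of \<open>u\<^sub>0v\<close> depending on its weight;
  the coefficients of \<open>u\<^sub>0v\<close> then add up to one.
\<close>

lemma star_commutator_IV:
  assumes u: "u \<in> Vp V g" and v: "v \<in> Vp V h"
  shows "star_l (scl V) (vmode V) g u v - scl V (gsign g h) (star_l (scl V) (vmode V) h v u) - vmode V u 0 v
    \<in> IV V (brdeg g h)" (is "_ \<in> ?I")
proof -
  let ?\<sigma> = "gsign g h" and ?a = "complex_of_real (snd g)" and ?b = "complex_of_real (snd h)"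
  have I: "vs.subspace ?I" by (rule IV_subspace)
  have d: "u \<in> dgr V (fst g)" "v \<in> dgr V (fst h)" using u v by (auto simp: Vp_def)
  have u0v: "vmode V u 0 v \<in> Vp V (brdeg g h)"
    using adj.Mp_mode[of u g v h "brdeg g h" 0] u v by simp
  have v0u: "vmode V v 0 u \<in> Vp V (brdeg g h)"
    using adj.Mp_mode[of v h u g "brdeg g h" 0] u v by (simp add: add.commute)
  \<comment> \<open>Both star products are expanded to second order.\<close>
  have 1: "star_l (scl V) (vmode V) g u v - (vmode V u (-1) v + scl V ?a (vmode V u 0 v)) \<in> ?I"
    using adj.lower_JM[OF adj.star_two_terms[of u g v h "snd g"]] u v by (simp add: star_l_def)
  have 2: "star_l (scl V) (vmode V) h v u - (vmode V v (-1) u + scl V ?b (vmode V v 0 u)) \<in> ?I"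
    using adj.lower_JM[OF adj.star_two_terms[of v h u g "snd h"]] u v by (simp add: star_l_def add.commute)
  have 3: "vmode V u 0 v + scl V ?\<sigma> (vmode V v 0 u) \<in> ?I"
    using adj.C2M_Mp_JM[of "vmode V u 0 v + scl V ?\<sigma> (vmode V v 0 u)" "brdeg g h"] bracket_skew_C2V[OF d] u0v v0u
      vs.subspace_add[OF adj.Vp_subspace] vs.subspace_scale[OF adj.Vp_subspace] by simp
  have 4: "vmode V u (-1) v - scl V ?\<sigma> (vmode V v (-1) u) + scl V (?a + ?b - 1) (vmode V u 0 v) \<in> ?I"
  proof -
    define f where "f i = scl V (of_int (-1) gchoose i) (vmode V (vmode V u (int i) v) (-1 + -1 - int i) (vac V))" for i :: nat
    have "Sum_any f = vmode V u (-1) v - scl V ?\<sigma> (vmode V v (-1) u)"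
      using adj.commutator[OF d, of "vac V" "-1" "-1"] by (simp add: creation f_def)
    moreover have "Sum_any f - f 0 \<in> ?I"
    proof (rule vs.Sum_any_head[OF I])
      show "finite {i. f i \<noteq> 0}"
        unfolding f_def using adj.commutator_finite[of "vac V" "-1" u 0 v "-1 + -1"] by simp
      \<comment> \<open>The vector \<open>u\<^sub>iv\<close> is of lower bidegree, and translating it does not lead out of the span of it and \<open>O(V)\<close>.\<close>
      show "f i \<in> ?I" if "i > 0" for i
      proof -
        let ?k = "g + h - (2 * int i + 2, real i + 1)"
        have w: "vmode V u (int i) v \<in> Vp V ?k"
          using adj.Mp_mode[of u g v h ?k "int i"] u v by simp
        have "below ?k (brdeg g h)" using that by (cases g; cases h) (simp add: below_simps)
        then have "vmode V u (int i) v \<in> ?I"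
          using adj.lower_JM[OF adj.Mp_lower] w by simp
        then have "vmode V (vmode V u (int i) v) (-1 - int (Suc i)) (vac V) \<in> ?I"
          using w by (intro creation_modes_OV[OF _ I subsetI[OF OV_IV]]) (auto simp: Vp_def)
        then show ?thesis by (simp add: f_def vs.subspace_scale[OF I])
      qed
    qed
    moreover have "f 0 + scl V (?a + ?b - 1) (vmode V u 0 v) \<in> ?I"
      using OV_IV[OF translation_OV[of "vmode V u 0 v" "snd (brdeg g h)"]] u0v by (simp add: f_def Vp_def)
    ultimately show ?thesis
      using vs.subspace_add[OF I, of "Sum_any f - f 0" "f 0 + scl V (?a + ?b - 1) (vmode V u 0 v)"] by simp
  qed
  have "(star_l (scl V) (vmode V) g u v - (vmode V u (-1) v + scl V ?a (vmode V u 0 v)))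
      - scl V ?\<sigma> (star_l (scl V) (vmode V) h v u - (vmode V v (-1) u + scl V ?b (vmode V v 0 u)))
      + (vmode V u (-1) v - scl V ?\<sigma> (vmode V v (-1) u) + scl V (?a + ?b - 1) (vmode V u 0 v))
      - scl V ?b (vmode V u 0 v + scl V ?\<sigma> (vmode V v 0 u)) \<in> ?I"
    by (intro vs.subspace_diff vs.subspace_add vs.subspace_scale I 1 2 3 4)
  then show ?thesis
    by (simp add: vs.scale_left_distrib vs.scale_left_diff_distrib vs.scale_right_distrib
        vs.scale_right_diff_distrib mult.commute algebra_simps)
qed

end

section \<open>Presentations of dg Poisson modules\<close>

text \<open>
  Every bigraded object in question is a quotient of \<open>V\<close> or \<open>M\<close> in each bidegree, with operations
  induced by the differential and by the modes \<open>-1\<close> and \<open>0\<close>.  \<open>\<pi> g x\<close> is the class of \<open>x\<close>.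
\<close>

locale presented_complex =
  fixes s :: "complex \<Rightarrow> 'x::ab_group_add \<Rightarrow> 'x" and X :: "bideg \<Rightarrow> 'x set" and d :: "'x \<Rightarrow> 'x"
    and W :: "('w, 'z) bigraded_scheme" and \<pi> :: "bideg \<Rightarrow> 'x \<Rightarrow> 'w"
  assumes vs: "vector_space s"
    and subspace: "module.subspace s (X g)"
    and module: "module C_ring (piece W g)"
    and elts: "elts W g = \<pi> g ` X g"
    and class_add: "\<lbrakk>x \<in> X g; y \<in> X g\<rbrakk> \<Longrightarrow> \<pi> g (x + y) = \<pi> g x \<oplus>\<^bsub>piece W g\<^esub> \<pi> g y"
    and class_scale: "x \<in> X g \<Longrightarrow> \<pi> g (s c x) = c \<odot>\<^bsub>piece W g\<^esub> \<pi> g x"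
    and class_dif: "x \<in> X g \<Longrightarrow> dmap W g (\<pi> g x) = \<pi> (up g) (d x)"
begin

lemma X_closed:
  "0 \<in> X g" "\<lbrakk>x \<in> X g; y \<in> X g\<rbrakk> \<Longrightarrow> x + y \<in> X g" "\<lbrakk>x \<in> X g; y \<in> X g\<rbrakk> \<Longrightarrow> x - y \<in> X g"
  "x \<in> X g \<Longrightarrow> s c x \<in> X g"
proof -
  interpret vs: vector_space s by (rule vs)
  note X = subspace[of g]
  show "0 \<in> X g" by (rule vs.subspace_0[OF X])
  show "\<lbrakk>x \<in> X g; y \<in> X g\<rbrakk> \<Longrightarrow> x + y \<in> X g" by (rule vs.subspace_add[OF X])
  show "\<lbrakk>x \<in> X g; y \<in> X g\<rbrakk> \<Longrightarrow> x - y \<in> X g" by (rule vs.subspace_diff[OF X])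
  show "x \<in> X g \<Longrightarrow> s c x \<in> X g" by (rule vs.subspace_scale[OF X])
qed

lemma class_zero: "\<pi> g 0 = \<zero>\<^bsub>piece W g\<^esub>"
proof -
  interpret vs: vector_space s by (rule vs)
  interpret P: Module.module C_ring "piece W g" by (rule module)
  have "\<pi> g 0 = \<zero>\<^bsub>C_ring\<^esub> \<odot>\<^bsub>piece W g\<^esub> \<pi> g 0"
    using class_scale[OF X_closed(1), of g 0] by (simp add: C_ring_def)
  also have "\<dots> = \<zero>\<^bsub>piece W g\<^esub>"
    using X_closed(1) by (intro P.smult_l_null) (auto simp: elts)
  finally show ?thesis .
qed

lemma class_cong:
  assumes "x \<in> X g" "y \<in> X g" "\<pi> g (x - y) = \<pi> g 0"
  shows "\<pi> g x = \<pi> g y"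
  using class_add[OF assms(2) X_closed(3)[OF assms(1,2)]] class_add[OF assms(2) X_closed(1)] assms(3)
  by simp

lemma bigraded_complexI:
  assumes off: "\<And>g. snd g \<notin> half_ints \<Longrightarrow> X g = {0}"
    and d_closed: "\<And>g x. x \<in> X g \<Longrightarrow> d x \<in> X (up g)"
    and d_linear: "\<And>g x y. \<lbrakk>x \<in> X g; y \<in> X g\<rbrakk> \<Longrightarrow> d (x + y) = d x + d y" "\<And>g c x. x \<in> X g \<Longrightarrow> d (s c x) = s c (d x)"
    and d_d: "\<And>g x. x \<in> X g \<Longrightarrow> d (d x) = 0"
  shows "bigraded_complex W"
proof (rule bigraded_complex.intro)
  fix g
  show "module C_ring (piece W g)" by (rule module)
  show "elts W g = {\<zero>\<^bsub>piece W g\<^esub>}" if "snd g \<notin> half_ints"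
    using off[OF that] by (simp add: elts class_zero)
  show "linear_map (piece W g) (piece W (up g)) (dmap W g)"
    unfolding linear_map_def elts
    by (auto simp: class_dif class_add[symmetric] class_scale[symmetric] X_closed d_closed d_linear[of _ g])
  show "dmap W (up g) (dmap W g x) = \<zero>\<^bsub>piece W (up (up g))\<^esub>" if "x \<in> elts W g" for x
    using that by (auto simp: elts class_dif d_closed d_d class_zero)
qed

end

text \<open>
  Linearity of an operation on classes, read off from representatives.
\<close>

lemma induced_linear_map:
  assumes W: "presented_complex s X d W \<pi>" and U: "presented_complex t Y e U \<rho>"
    and f: "\<And>x. x \<in> X g \<Longrightarrow> f x \<in> Y h"
      "\<And>x y. \<lbrakk>x \<in> X g; y \<in> X g\<rbrakk> \<Longrightarrow> f (x + y) = f x + f y" "\<And>c x. x \<in> X g \<Longrightarrow> f (s c x) = t c (f x)"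
    and F: "\<And>x. x \<in> X g \<Longrightarrow> F (\<pi> g x) = \<rho> h (f x)"
  shows "linear_map (piece W g) (piece U h) F"
proof -
  interpret W: presented_complex s X d W \<pi> by (rule W)
  interpret U: presented_complex t Y e U \<rho> by (rule U)
  show ?thesis
    unfolding linear_map_def W.elts U.elts
    by (auto simp: F f W.class_add[symmetric] W.class_scale[symmetric] U.class_add[symmetric]
        U.class_scale[symmetric] W.X_closed)
qed

locale presented_algebra =
  V: dg_vertex_operator_algebra V + alg: presented_complex "scl V" "Vp V" "dif V" A \<alpha>
  for V :: "'v::ab_group_add dgvoa" and A :: "('a, 'y) pois_alg_scheme" and \<alpha> :: "bideg \<Rightarrow> 'v \<Rightarrow> 'a" +
  assumes class_unit: "punit A = \<alpha> 0 (vac V)"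
    and class_mult: "\<lbrakk>u \<in> Vp V g; v \<in> Vp V h\<rbrakk> \<Longrightarrow> pmult A g h (\<alpha> g u) (\<alpha> h v) = \<alpha> (g + h) (vmode V u (-1) v)"
    and class_brk: "\<lbrakk>u \<in> Vp V g; v \<in> Vp V h\<rbrakk> \<Longrightarrow> pbrk A g h (\<alpha> g u) (\<alpha> h v) = \<alpha> (brdeg g h) (vmode V u 0 v)"
    and class_C2V: "\<lbrakk>u \<in> Vp V g; u \<in> C2V V\<rbrakk> \<Longrightarrow> \<alpha> g u = \<alpha> g 0"

text \<open>
  The operations are parameters rather than fields of a record, so that the algebra itself, with its own product and
  bracket, is an instance for the adjoint module.
\<close>

locale presented_action =
  graded_dg_module V M + alg: presented_algebra V A \<alpha> + mod: presented_complex "scl M" "Mp M" "dif M" W \<pi>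
  for V :: "'v::ab_group_add dgvoa" and M :: "('v, 'm::ab_group_add) graded_mod"
    and A :: "('a, 'y) pois_alg_scheme" and \<alpha> :: "bideg \<Rightarrow> 'v \<Rightarrow> 'a"
    and W :: "('w, 'z) bigraded_scheme" and \<pi> :: "bideg \<Rightarrow> 'm \<Rightarrow> 'w" +
  fixes ac :: "bideg \<Rightarrow> bideg \<Rightarrow> 'a \<Rightarrow> 'w \<Rightarrow> 'w"
  assumes class_act: "\<lbrakk>u \<in> Vp V g; x \<in> Mp M h\<rbrakk> \<Longrightarrow> ac g h (\<alpha> g u) (\<pi> h x) = \<pi> (g + h) (mmode M u (-1) x)"
    and class_C2M: "\<lbrakk>x \<in> Mp M g; x \<in> C2M M\<rbrakk> \<Longrightarrow> \<pi> g x = \<pi> g 0"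
begin

lemma Vp_dgr: "u \<in> Vp V g \<Longrightarrow> u \<in> dgr V (fst g)"
  by (simp add: Vp_def)

lemma Mp_product: "\<lbrakk>u \<in> Vp V g; x \<in> Mp M h\<rbrakk> \<Longrightarrow> mmode M u (-1) x \<in> Mp M (g + h)"
  by (rule Mp_mode) (simp_all add: prod_eq_iff)

lemma Mp_bracket: "\<lbrakk>u \<in> Vp V g; x \<in> Mp M h\<rbrakk> \<Longrightarrow> mmode M u 0 x \<in> Mp M (brdeg g h)"
  by (rule Mp_mode) (simp_all add: prod_eq_iff)

lemma Vp_product: "\<lbrakk>u \<in> Vp V g; v \<in> Vp V h\<rbrakk> \<Longrightarrow> vmode V u (-1) v \<in> Vp V (g + h)"
  using graded_dg_module.Mp_mode[OF V.adjoint_graded_dg_module, of u g v h "g + h" "-1"]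
  by (simp add: prod_eq_iff)

lemma Vp_bracket: "\<lbrakk>u \<in> Vp V g; v \<in> Vp V h\<rbrakk> \<Longrightarrow> vmode V u 0 v \<in> Vp V (brdeg g h)"
  using graded_dg_module.Mp_mode[OF V.adjoint_graded_dg_module, of u g v h "brdeg g h" 0]
  by simp

lemma Vp_dif: "u \<in> Vp V g \<Longrightarrow> dif V u \<in> Vp V (up g)"
  using graded_dg_module.Mp_dif[OF V.adjoint_graded_dg_module, of u g] by simp

lemma class_cong_C2M:
  assumes "x \<in> Mp M g" "y \<in> Mp M g" "x - y \<in> C2M M"
  shows "\<pi> g x = \<pi> g y"
  by (rule mod.class_cong[OF assms(1,2) class_C2M[OF mod.X_closed(3)[OF assms(1,2)] assms(3)]])

lemma mode_bilinear:
  assumes closed: "\<And>u x. \<lbrakk>u \<in> Vp V g; x \<in> Mp M h\<rbrakk> \<Longrightarrow> mmode M u n x \<in> Mp M k"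
    and F: "\<And>u x. \<lbrakk>u \<in> Vp V g; x \<in> Mp M h\<rbrakk> \<Longrightarrow> F (\<alpha> g u) (\<pi> h x) = \<pi> k (mmode M u n x)"
  shows "bilinear_map (piece A g) (piece W h) (piece W k) F"
  unfolding bilinear_map_def alg.alg.elts mod.elts
proof (intro conjI ballI; elim imageE; hypsubst)
  show "linear_map (piece W h) (piece W k) (F (\<alpha> g u))" if u: "u \<in> Vp V g" for u
    by (rule induced_linear_map[OF mod.presented_complex_axioms mod.presented_complex_axioms,
          where f = "mmode M u n"])
      (use u in \<open>auto simp: closed F mode_add_right mode_scale_right Mp_car\<close>)
  show "linear_map (piece A g) (piece W k) (\<lambda>a. F a (\<pi> h x))" if x: "x \<in> Mp M h" for x
    by (rule induced_linear_map[OF alg.alg.presented_complex_axioms mod.presented_complex_axioms,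
          where f = "\<lambda>u. mmode M u n x"])
      (use x in \<open>auto simp: closed F mode_add_left mode_scale_left Mp_car\<close>)
qed

lemma ac_bilinear: "bilinear_map (piece A g) (piece W h) (piece W (g + h)) (ac g h)"
  by (rule mode_bilinear[where n = "-1"]) (simp_all add: Mp_product class_act)

lemma ac_unit: "x \<in> elts W g \<Longrightarrow> ac 0 g (punit A) x = x"
proof (unfold mod.elts, elim imageE, hypsubst)
  fix y assume y: "y \<in> Mp M g"
  have "vac V \<in> Vp V 0" using V.vac_degree V.vac_weight by (simp add: Vp_def)
  then show "ac 0 g (punit A) (\<pi> g y) = \<pi> g y"
    using y by (simp add: alg.class_unit class_act vacuum[OF Mp_car])
qed

lemma ac_assoc:
  assumes "a \<in> elts A g" "b \<in> elts A h" "x \<in> elts W k"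
  shows "ac (g + h) k (pmult A g h a b) x = ac g (h + k) a (ac h k b x)"
proof -
  obtain u v y where e: "a = \<alpha> g u" "b = \<alpha> h v" "x = \<pi> k y"
    and u: "u \<in> Vp V g" and v: "v \<in> Vp V h" and y: "y \<in> Mp M k"
    using assms unfolding alg.alg.elts mod.elts by blast
  have "\<pi> (g + (h + k)) (mmode M (vmode V u (-1) v) (-1) y) = \<pi> (g + (h + k)) (mmode M u (-1) (mmode M v (-1) y))"
    using Mp_product[OF Vp_product[OF u v] y] Mp_product[OF u Mp_product[OF v y]]
    by (intro class_cong_C2M product_assoc_C2M[OF Vp_dgr[OF u] Vp_dgr[OF v] Mp_car[OF y]]) (simp_all only: add.assoc)
  then show ?thesis
    by (simp only: e alg.class_mult[OF u v] class_act[OF v y] class_act[OF Vp_product[OF u v] y]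
        class_act[OF u Mp_product[OF v y]] add.assoc)
qed

lemma dif_ac:
  assumes "a \<in> elts A g" "x \<in> elts W h"
  shows "dmap W (g + h) (ac g h a x) = ac (up g) h (dmap A g a) x \<oplus>\<^bsub>piece W (up (g + h))\<^esub>
    (-1) powi fst g \<odot>\<^bsub>piece W (up (g + h))\<^esub> ac g (up h) a (dmap W h x)"
proof -
  obtain u y where ay: "a = \<alpha> g u" "x = \<pi> h y" and u: "u \<in> Vp V g" and y: "y \<in> Mp M h"
    using assms unfolding alg.alg.elts mod.elts by blast
  have k: "up g + h = up (g + h)" "g + up h = up (g + h)" by (simp_all add: ac_simps)
  have p: "mmode M (dif V u) (-1) y \<in> Mp M (up (g + h))" "mmode M u (-1) (dif M y) \<in> Mp M (up (g + h))"
    using Mp_product[OF Vp_dif[OF u] y] Mp_product[OF u Mp_dif[OF y]] by (simp_all only: k)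
  have "dif M (mmode M u (-1) y) = mmode M (dif V u) (-1) y + scl M ((-1) powi fst g) (mmode M u (-1) (dif M y))"
    using mode_dif[OF Vp_dgr[OF u] Mp_car[OF y], of "-1"] by simp
  then show ?thesis
    using p by (simp only: ay class_act[OF u y] class_act[OF Vp_dif[OF u] y] class_act[OF u Mp_dif[OF y]]
        alg.alg.class_dif[OF u] mod.class_dif[OF y] mod.class_dif[OF Mp_product[OF u y]] k
        mod.class_add mod.class_scale mod.X_closed)
qed

lemma W_complex: "bigraded_complex W"
proof (rule mod.bigraded_complexI)
  show "Mp M g = {0}" if "snd g \<notin> half_ints" for g by (rule Mp_eq_0[OF that])
qed (auto simp: Mp_dif Mp_car linear_on_add[OF M.dif_linear] linear_on_scale[OF M.dif_linear] M.dif_dif)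

end

locale presented_poisson_action = presented_action +
  fixes br :: "bideg \<Rightarrow> bideg \<Rightarrow> 'c \<Rightarrow> 'd \<Rightarrow> 'd"
  assumes class_br: "\<lbrakk>u \<in> Vp V g; x \<in> Mp M h\<rbrakk> \<Longrightarrow> br g h (\<alpha> g u) (\<pi> h x) = \<pi> (brdeg g h) (mmode M u 0 x)"
begin

lemma br_bilinear: "bilinear_map (piece A g) (piece W h) (piece W (brdeg g h)) (br g h)"
  by (rule mode_bilinear[where n = 0]) (simp_all add: Mp_bracket class_br)

lemma br_jacobi:
  assumes "a \<in> elts A g" "b \<in> elts A h" "x \<in> elts W k"
  shows "br (brdeg g h) k (pbrk A g h a b) x = br g (brdeg h k) a (br h k b x)
    \<oplus>\<^bsub>piece W (brdeg g (brdeg h k))\<^esub> (- gsign g h) \<odot>\<^bsub>piece W (brdeg g (brdeg h k))\<^esub> br h (brdeg g k) b (br g k a x)"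
proof -
  obtain u v y where e: "a = \<alpha> g u" "b = \<alpha> h v" "x = \<pi> k y"
    and u: "u \<in> Vp V g" and v: "v \<in> Vp V h" and y: "y \<in> Mp M k"
    using assms unfolding alg.alg.elts mod.elts by blast
  have k: "brdeg (brdeg g h) k = brdeg g (brdeg h k)" "brdeg h (brdeg g k) = brdeg g (brdeg h k)"
    by (simp_all add: algebra_simps)
  note p = Mp_bracket[OF u Mp_bracket[OF v y]] Mp_bracket[OF v Mp_bracket[OF u y], unfolded k]
  have "mmode M (vmode V u 0 v) 0 y = mmode M u 0 (mmode M v 0 y) + scl M (- gsign g h) (mmode M v 0 (mmode M u 0 y))"
    using mode_0_commutator[OF Vp_dgr[OF u] Vp_dgr[OF v] Mp_car[OF y], of 0] by simp
  then show ?thesis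
    using p by (simp only: e alg.class_brk[OF u v] class_br[OF Vp_bracket[OF u v] y] class_br[OF v y] class_br[OF u y]
        class_br[OF u Mp_bracket[OF v y]] class_br[OF v Mp_bracket[OF u y]] k mod.class_add mod.class_scale mod.X_closed)
qed

lemma dif_br:
  assumes "a \<in> elts A g" "x \<in> elts W h"
  shows "dmap W (brdeg g h) (br g h a x) = br (up g) h (dmap A g a) x \<oplus>\<^bsub>piece W (up (brdeg g h))\<^esub>
    (-1) powi fst g \<odot>\<^bsub>piece W (up (brdeg g h))\<^esub> br g (up h) a (dmap W h x)"
proof -
  obtain u y where ay: "a = \<alpha> g u" "x = \<pi> h y" and u: "u \<in> Vp V g" and y: "y \<in> Mp M h"
    using assms unfolding alg.alg.elts mod.elts by blast
  have k: "brdeg (up g) h = up (brdeg g h)" "brdeg g (up h) = up (brdeg g h)" by (simp_all add: algebra_simps)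
  have p: "mmode M (dif V u) 0 y \<in> Mp M (up (brdeg g h))" "mmode M u 0 (dif M y) \<in> Mp M (up (brdeg g h))"
    using Mp_bracket[OF Vp_dif[OF u] y] Mp_bracket[OF u Mp_dif[OF y]] by (simp_all only: k)
  have "dif M (mmode M u 0 y) = mmode M (dif V u) 0 y + scl M ((-1) powi fst g) (mmode M u 0 (dif M y))"
    using mode_dif[OF Vp_dgr[OF u] Mp_car[OF y], of 0] by simp
  then show ?thesis
    using p by (simp only: ay class_br[OF u y] class_br[OF Vp_dif[OF u] y] class_br[OF u Mp_dif[OF y]]
        alg.alg.class_dif[OF u] mod.class_dif[OF y] mod.class_dif[OF Mp_bracket[OF u y]] k
        mod.class_add mod.class_scale mod.X_closed)
qed

lemma br_ac:
  assumes "a \<in> elts A g" "b \<in> elts A h" "x \<in> elts W k"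
  shows "br g (h + k) a (ac h k b x) = ac (brdeg g h) k (pbrk A g h a b) x
    \<oplus>\<^bsub>piece W (brdeg g (h + k))\<^esub> gsign g h \<odot>\<^bsub>piece W (brdeg g (h + k))\<^esub> ac h (brdeg g k) b (br g k a x)"
proof -
  obtain u v y where e: "a = \<alpha> g u" "b = \<alpha> h v" "x = \<pi> k y"
    and u: "u \<in> Vp V g" and v: "v \<in> Vp V h" and y: "y \<in> Mp M k"
    using assms unfolding alg.alg.elts mod.elts by blast
  have k: "brdeg g h + k = brdeg g (h + k)" "h + brdeg g k = brdeg g (h + k)"
    by (simp_all add: algebra_simps)
  note p = Mp_product[OF Vp_bracket[OF u v] y, unfolded k] Mp_product[OF v Mp_bracket[OF u y], unfolded k]
  have "mmode M u 0 (mmode M v (-1) y)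
      = mmode M (vmode V u 0 v) (-1) y + scl M (gsign g h) (mmode M v (-1) (mmode M u 0 y))"
    by (rule mode_0_commutator[OF Vp_dgr[OF u] Vp_dgr[OF v] Mp_car[OF y]])
  then show ?thesis
    using p by (simp only: e alg.class_brk[OF u v] class_act[OF v y] class_act[OF Vp_bracket[OF u v] y] class_br[OF u y]
        class_br[OF u Mp_product[OF v y]] class_act[OF v Mp_bracket[OF u y]] k mod.class_add mod.class_scale mod.X_closed)
qed

lemma mult_br:
  assumes "a \<in> elts A g" "b \<in> elts A h" "x \<in> elts W k"
  shows "br (g + h) k (pmult A g h a b) x = ac g (brdeg h k) a (br h k b x)
    \<oplus>\<^bsub>piece W (brdeg g (h + k))\<^esub> gsign g h \<odot>\<^bsub>piece W (brdeg g (h + k))\<^esub> ac h (brdeg g k) b (br g k a x)"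
proof -
  obtain u v y where e: "a = \<alpha> g u" "b = \<alpha> h v" "x = \<pi> k y"
    and u: "u \<in> Vp V g" and v: "v \<in> Vp V h" and y: "y \<in> Mp M k"
    using assms unfolding alg.alg.elts mod.elts by blast
  have k: "brdeg (g + h) k = brdeg g (h + k)" "g + brdeg h k = brdeg g (h + k)" "h + brdeg g k = brdeg g (h + k)"
    by (simp_all add: algebra_simps)
  note p = Mp_product[OF u Mp_bracket[OF v y], unfolded k] Mp_product[OF v Mp_bracket[OF u y], unfolded k]
  have "\<pi> (brdeg g (h + k)) (mmode M (vmode V u (-1) v) 0 y)
      = \<pi> (brdeg g (h + k)) (mmode M u (-1) (mmode M v 0 y) + scl M (gsign g h) (mmode M v (-1) (mmode M u 0 y)))"
    using p Mp_bracket[OF Vp_product[OF u v] y, unfolded k]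
    by (intro class_cong_C2M product_bracket_C2M Vp_dgr u v Mp_car[OF y] mod.X_closed)
  then show ?thesis
    using p by (simp only: e alg.class_mult[OF u v] class_br[OF Vp_product[OF u v] y] class_br[OF v y] class_br[OF u y]
        class_act[OF u Mp_bracket[OF v y]] class_act[OF v Mp_bracket[OF u y]] k mod.class_add mod.class_scale mod.X_closed)
qed

end

text \<open>
  The adjoint module gives all axioms except commutativity, skew symmetry and the unit.
\<close>

theorem (in presented_algebra) poisson_algebra: "wg_dg_poisson_algebra A"
proof -
  have "presented_poisson_action V (adjoint_module V) A \<alpha> A \<alpha> (pmult A) (pbrk A)"
    by (intro presented_poisson_action.intro presented_action.intro V.adjoint_graded_dg_module
        presented_algebra_axioms presented_action_axioms.intro presented_poisson_action_axioms.intro)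
      (simp_all add: alg.presented_complex_axioms class_mult class_brk class_C2V)
  then interpret adj: presented_poisson_action V "adjoint_module V" A \<alpha> A \<alpha> "pmult A" "pbrk A" .
  interpret bigraded_complex A by (rule adj.W_complex)
  have u: "vac V \<in> Vp V 0" using V.vac_degree V.vac_weight by (simp add: Vp_def)
  show ?thesis
  proof
    show "punit A \<in> elts A 0" using u by (simp add: class_unit alg.elts)
  next
    fix g h a b assume "a \<in> elts A g" "b \<in> elts A h"
    then obtain u v where e: "a = \<alpha> g u" "b = \<alpha> h v" and u: "u \<in> Vp V g" and v: "v \<in> Vp V h"
      unfolding alg.elts by blast
    note d = adj.Vp_dgr[OF u] adj.Vp_dgr[OF v]
    note k = add.commute[of h g]
    note p = adj.Vp_product[OF u v] adj.Vp_product[OF v u, unfolded k] adj.Vp_bracket[OF u v]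
      adj.Vp_bracket[OF v u, unfolded k]
    have "\<alpha> (g + h) (vmode V u (-1) v) = \<alpha> (g + h) (scl V (gsign g h) (vmode V v (-1) u))"
      using p by (intro adj.class_cong_C2M) (simp_all add: alg.X_closed V.product_commutes_C2V[OF d])
    then show "pmult A g h a b = gsign g h \<odot>\<^bsub>piece A (g + h)\<^esub> pmult A h g b a"
      using p by (simp only: e class_mult[OF u v] class_mult[OF v u] k alg.class_scale)
    have "\<alpha> (brdeg g h) (vmode V u 0 v) = \<alpha> (brdeg g h) (scl V (- gsign g h) (vmode V v 0 u))"
      using p V.bracket_skew_C2V[OF d] alg.X_closed(4)[OF p(4), of "- gsign g h"]
      by (intro adj.class_cong_C2M) simp_all
    then show "pbrk A g h a b = (- gsign g h) \<odot>\<^bsub>piece A (brdeg g h)\<^esub> pbrk A h g b a"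
      using p by (simp only: e class_brk[OF u v] class_brk[OF v u] k alg.class_scale)
  qed (fact adj.ac_bilinear adj.br_bilinear adj.ac_unit adj.ac_assoc adj.dif_ac adj.br_jacobi adj.dif_br adj.br_ac)+
qed

locale presented_module =
  presented_action V M A \<alpha> W \<pi> "act W"
  for V :: "'v::ab_group_add dgvoa" and M :: "('v, 'm::ab_group_add) graded_mod"
    and A :: "('a, 'y) pois_alg_scheme" and \<alpha> :: "bideg \<Rightarrow> 'v \<Rightarrow> 'a"
    and W :: "('a, 'w, 'z) bg_mod_scheme" and \<pi> :: "bideg \<Rightarrow> 'm \<Rightarrow> 'w"

theorem (in presented_module) dg_module: "wg_dg_module A W"
proof -
  interpret A: wg_dg_poisson_algebra A by (rule alg.poisson_algebra)
  interpret W: bigraded_complex W by (rule W_complex)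
  show ?thesis
    by unfold_locales (fact ac_bilinear ac_unit ac_assoc dif_ac)+
qed

locale presented_poisson_module =
  presented_poisson_action V M A \<alpha> W \<pi> "act W" "mbrk W"
  for V :: "'v::ab_group_add dgvoa" and M :: "('v, 'm::ab_group_add) graded_mod"
    and A :: "('a, 'y) pois_alg_scheme" and \<alpha> :: "bideg \<Rightarrow> 'v \<Rightarrow> 'a"
    and W :: "('a, 'w, 'z) pois_mod_scheme" and \<pi> :: "bideg \<Rightarrow> 'm \<Rightarrow> 'w"

sublocale presented_poisson_module \<subseteq> presented_module
  by unfold_locales

theorem (in presented_poisson_module) poisson_module: "wg_dg_poisson_module A W"
proof -
  interpret W: wg_dg_module A W by (rule dg_module)
  show ?thesis
    by unfold_locales (fact br_bilinear br_jacobi dif_br br_ac mult_br)+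
qed

lemma presented_module_hom:
  assumes M: "presented_module V M A \<alpha> W \<pi>" and N: "presented_module V N A \<alpha> U \<rho>"
    and f: "graded_dg_module_hom V M N f"
    and F: "\<And>g x. x \<in> Mp M g \<Longrightarrow> F g (\<pi> g x) = \<rho> g (f x)"
  shows "wg_dg_module_hom A W U F"
proof -
  interpret M: presented_module V M A \<alpha> W \<pi> by (rule M)
  interpret N: presented_module V N A \<alpha> U \<rho> by (rule N)
  have Mp: "f x \<in> Mp N g" if "x \<in> Mp M g" for g x
    using f that by (auto simp: graded_dg_module_hom_def Mp_def image_subset_iff)
  have lin: "linear_on (scl M) (scl N) (car M) f" using f by (simp add: graded_dg_module_hom_def)
  have "linear_map (piece W g) (piece U g) (F g)" for g
    by (rule induced_linear_map[OF M.mod.presented_complex_axioms N.mod.presented_complex_axioms, where f = f])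
      (auto simp: Mp F M.Mp_car linear_on_add[OF lin] linear_on_scale[OF lin])
  moreover have "F (up g) (dmap W g x) = dmap U g (F g x)" if "x \<in> elts W g" for g x
    using that f unfolding M.mod.elts
    by (auto simp: M.mod.class_dif N.mod.class_dif F Mp M.Mp_dif graded_dg_module_hom_def M.Mp_car)
  moreover have "F (g + h) (act W g h a x) = act U g h a (F h x)" if "a \<in> elts A g" "x \<in> elts W h" for g h a x
    using that f unfolding M.mod.elts M.alg.alg.elts
    by (auto simp: M.class_act N.class_act F Mp M.Mp_product graded_dg_module_hom_def M.Mp_car)
  ultimately show ?thesis
    using M.dg_module N.dg_module by (simp add: wg_dg_module_hom_def)
qed

lemma graded_dg_module_hom_id: "graded_dg_module V M \<Longrightarrow> graded_dg_module_hom V M M id"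
  by (simp add: graded_dg_module_hom_def linear_on_def)

lemma presented_poisson_module_hom:
  assumes W: "presented_poisson_module V M A \<alpha> W \<pi>" and U: "presented_poisson_module V M A \<alpha> U \<rho>"
    and F: "\<And>g x. x \<in> Mp M g \<Longrightarrow> F g (\<pi> g x) = \<rho> g x"
  shows "wg_dg_poisson_module_hom A W U F"
proof -
  interpret W: presented_poisson_module V M A \<alpha> W \<pi> by (rule W)
  interpret U: presented_poisson_module V M A \<alpha> U \<rho> by (rule U)
  have "wg_dg_module_hom A W U F"
    by (rule presented_module_hom[OF W.presented_module_axioms U.presented_module_axioms
          graded_dg_module_hom_id[OF W.graded_dg_module_axioms]]) (simp add: F)
  moreover have "F (brdeg g h) (mbrk W g h a x) = mbrk U g h a (F h x)" if "a \<in> elts A g" "x \<in> elts W h" for g h a x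
    using that unfolding W.mod.elts W.alg.alg.elts
    by (auto simp: W.class_br U.class_br F W.Mp_bracket)
  ultimately show ?thesis
    using W.poisson_module U.poisson_module by (simp add: wg_dg_poisson_module_hom_def)
qed

section \<open>Quotients and induced operations\<close>

lemma induced_eq:
  assumes "x \<in> X" "\<And>y. y \<in> X \<Longrightarrow> cl y = cl x \<Longrightarrow> F y = F x"
  shows "induced X cl F (cl x) = F x"
  unfolding induced_def
proof (rule the_equality)
  show "\<forall>y\<in>X. cl y = cl x \<longrightarrow> F x = F y" using assms(2)[symmetric] by simp
  show "c = F x" if "\<forall>y\<in>X. cl y = cl x \<longrightarrow> c = F y" for c using that assms(1) by simp
qed

lemma induced2_eq:
  assumes "x \<in> X" "y \<in> Y"
    "\<And>x' y'. \<lbrakk>x' \<in> X; y' \<in> Y; cl x' = cl x; cl' y' = cl' y\<rbrakk> \<Longrightarrow> F x' y' = F x y"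
  shows "induced2 X cl Y cl' F (cl x) (cl' y) = F x y"
  unfolding induced2_def
proof (rule the_equality)
  show "\<forall>x'\<in>X. \<forall>y'\<in>Y. cl x' = cl x \<and> cl' y' = cl' y \<longrightarrow> F x y = F x' y'"
    using assms(3)[symmetric] by simp
  show "c = F x y" if "\<forall>x'\<in>X. \<forall>y'\<in>Y. cl x' = cl x \<and> cl' y' = cl' y \<longrightarrow> c = F x' y'" for c
    using that assms(1,2) by simp
qed

lemma (in vector_space) coset_eq_iff:
  assumes "subspace K" shows "a +o K = b +o K \<longleftrightarrow> a - b \<in> K"
proof
  assume "a +o K = b +o K"
  then have "a + 0 \<in> b +o K" using subspace_0[OF assms] by (metis set_plus_intro2)
  then show "a - b \<in> K" using set_plus_imp_minus by fastforce
next
  assume ab: "a - b \<in> K"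
  have "c \<in> a +o K \<longleftrightarrow> c \<in> b +o K" for c
    using subspace_add[OF assms ab, of "c - a"] subspace_diff[OF assms _ ab, of "c - b"]
    by (auto simp: set_minus_plus[symmetric])
  then show "a +o K = b +o K" by blast
qed

text \<open>
  The quotient \<open>quot t (\<rho> ` X) (\<rho> ` L)\<close>, presented by \<open>X\<close>.  For \<open>\<rho>\<close> the identity it is the image of \<open>X\<close> modulo \<open>L\<close>.  For \<open>\<rho>\<close> a map to cosets
  it is a quotient of a quotient; cosets form a monoid but not a group under addition of sets, so all computations
  take place among representatives.
\<close>

locale quotient_map = vector_space s
  for s :: "complex \<Rightarrow> 'x::ab_group_add \<Rightarrow> 'x" +
  fixes t :: "complex \<Rightarrow> 'b::comm_monoid_add \<Rightarrow> 'b" and \<rho> :: "'x \<Rightarrow> 'b" and X L :: "'x set"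
  assumes X: "subspace X" and L: "subspace L"
    and \<rho>_add: "\<rho> (x + y) = \<rho> x + \<rho> y" and \<rho>_scale: "t c (\<rho> x) = \<rho> (s c x)"
begin

definition cl where "cl x = \<rho> x +o \<rho> ` L"

lemma cl_eq_image: "cl x = (\<lambda>l. \<rho> (x + l)) ` L"
  by (auto simp: cl_def elt_set_plus_def \<rho>_add)

lemma cl_0: "cl 0 = \<rho> ` L"
  by (simp add: cl_eq_image)

lemma cl_L: "l \<in> L \<Longrightarrow> cl l = \<rho> ` L"
proof
  assume l: "l \<in> L"
  show "cl l \<subseteq> \<rho> ` L" using subspace_add[OF L l] by (auto simp: cl_eq_image)
  show "\<rho> ` L \<subseteq> cl l"
  proof
    fix b assume "b \<in> \<rho> ` L"
    then obtain k where k: "k \<in> L" "b = \<rho> k" by auto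
    then show "b \<in> cl l"
      using subspace_diff[OF L k(1) l] unfolding cl_eq_image by (intro image_eqI[of _ _ "k - l"]) simp_all
  qed
qed

lemma image_L_add: "\<rho> ` L + \<rho> ` L = \<rho> ` L"
proof
  show "\<rho> ` L + \<rho> ` L \<subseteq> \<rho> ` L"
    using subspace_add[OF L] by (auto elim!: set_plus_elim simp: \<rho>_add[symmetric])
  show "\<rho> ` L \<subseteq> \<rho> ` L + \<rho> ` L"
  proof
    fix b assume "b \<in> \<rho> ` L"
    then obtain l where "l \<in> L" "b = \<rho> l + \<rho> 0" by (auto simp: \<rho>_add[symmetric])
    then show "b \<in> \<rho> ` L + \<rho> ` L" using subspace_0[OF L] by auto
  qed
qed

lemma cl_add: "cl (x + y) = cl x + cl y"
  by (simp add: cl_def \<rho>_add set_plus_rearrange image_L_add)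

lemma cl_scale: "cl (s c x) = t c ` cl x + \<rho> ` L"
proof -
  have "t c ` cl x = (\<lambda>l. \<rho> (s c x) + \<rho> (s c l)) ` L"
    by (simp add: cl_eq_image image_image \<rho>_scale scale_right_distrib \<rho>_add[symmetric])
  also have "\<dots> = \<rho> (s c x) +o (\<lambda>l. \<rho> (s c l)) ` L"
    by (auto simp: elt_set_plus_def)
  finally have "t c ` cl x = \<rho> (s c x) +o (\<lambda>l. \<rho> (s c l)) ` L" .
  then have "t c ` cl x + \<rho> ` L = \<rho> (s c x) +o ((\<lambda>l. \<rho> (s c l)) ` L + \<rho> ` L)"
    by (simp add: set_plus_rearrange3)
  also have "(\<lambda>l. \<rho> (s c l)) ` L + \<rho> ` L = \<rho> ` L"
  proof
    show "(\<lambda>l. \<rho> (s c l)) ` L + \<rho> ` L \<subseteq> \<rho> ` L"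
      using subspace_add[OF L subspace_scale[OF L]] by (auto elim!: set_plus_elim simp: \<rho>_add[symmetric])
    show "\<rho> ` L \<subseteq> (\<lambda>l. \<rho> (s c l)) ` L + \<rho> ` L"
    proof
      fix b assume "b \<in> \<rho> ` L"
      then obtain l where "l \<in> L" "b = \<rho> (s c 0) + \<rho> l" by (auto simp: \<rho>_add[symmetric])
      then show "b \<in> (\<lambda>l. \<rho> (s c l)) ` L + \<rho> ` L" using subspace_0[OF L] by blast
    qed
  qed
  finally show ?thesis by (simp add: cl_def)
qed

lemma cl_cong: "x - y \<in> L \<Longrightarrow> cl x = cl y"
  using cl_add[of y "x - y"] cl_add[of y 0] by (simp add: cl_L cl_0)

lemma cl_eqD: "cl x = cl y \<Longrightarrow> \<exists>l\<in>L. \<rho> x = \<rho> (y + l)"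
proof -
  assume e: "cl x = cl y"
  have "\<rho> (x + 0) \<in> cl x" unfolding cl_eq_image using subspace_0[OF L] by blast
  then show ?thesis unfolding e by (auto simp: cl_eq_image)
qed

abbreviation P where "P \<equiv> quot t (\<rho> ` X) (\<rho> ` L)"

lemma P_simps: "carrier P = cl ` X" "zero P = cl 0" "add P = (+)" "smult P c A = t c ` A + \<rho> ` L"
  by (simp_all add: quot_def cl_def[abs_def] image_image cl_0[unfolded cl_def])

lemma quot_module: "module C_ring P"
proof (rule moduleI)
  show "cring C_ring"
  proof (rule cringI)
    show "abelian_group C_ring"
    proof (rule abelian_groupI)
      show "\<exists>y\<in>carrier C_ring. y \<oplus>\<^bsub>C_ring\<^esub> x = \<zero>\<^bsub>C_ring\<^esub>" for x
        by (intro bexI[of _ "- x"]) (simp_all add: C_ring_def)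
    qed (simp_all add: C_ring_def)
    show "comm_monoid C_ring" by (rule comm_monoidI) (simp_all add: C_ring_def)
  qed (simp add: C_ring_def distrib_right)
  show "abelian_group P"
  proof (rule abelian_groupI; unfold P_simps)
    fix A assume "A \<in> cl ` X"
    then obtain x where "x \<in> X" "A = cl x" by blast
    then show "\<exists>B\<in>cl ` X. B + A = cl 0"
      using subspace_neg[OF X] by (intro bexI[of _ "cl (- x)"]) (auto simp: cl_add[symmetric])
    show "cl 0 + A = A" using \<open>A = cl x\<close> by (simp add: cl_add[symmetric])
  qed (use subspace_0[OF X] subspace_add[OF X] in \<open>auto simp: cl_add[symmetric] ac_simps\<close>)
qed (use subspace_scale[OF X] in \<open>auto simp: P_simps C_ring_def cl_add[symmetric] cl_scale[symmetric]
      scale_left_distrib scale_right_distrib\<close>)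

end


lemma quotient_map_coset:
  assumes "vector_space s" "module.subspace s X" "module.subspace s J"
  shows "quotient_map s s (\<lambda>x. x) X J"
  using assms by (simp add: quotient_map_def quotient_map_axioms_def)

context graded_dg_module
begin

interpretation adj: graded_dg_module V "adjoint_module V"
  by (rule V.adjoint_graded_dg_module)

text \<open>
  \<open>W\<close> is a variable with the two fields given by equations because the fields beyond these differ between the
  algebras and the modules.
\<close>

lemma presented_complex_coset:
  fixes W :: "('m set, 'z) bigraded_scheme"
  assumes J: "\<And>g. M.vs.subspace (J g)" and dJ: "\<And>g x. x \<in> J g \<Longrightarrow> dif M x \<in> J (up g)"
    and W: "\<And>g. piece W g = quot (scl M) (Mp M g) (J g)"
      "\<And>g. dmap W g = induced (Mp M g) (\<lambda>x. x +o J g) (\<lambda>x. dif M x +o J (up g))"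
  shows "presented_complex (scl M) (Mp M) (dif M) W (\<lambda>g x. x +o J g)"
proof (rule presented_complex.intro)
  fix g
  interpret Q: quotient_map "scl M" "scl M" "\<lambda>x. x" "Mp M g" "J g"
    by (rule quotient_map_coset[OF M.vector_space Mp_subspace J])
  have cl: "Q.cl = (\<lambda>x. x +o J g)" by (simp add: Q.cl_def[abs_def])
  show "vector_space (scl M)" by (rule M.vector_space)
  show "M.vs.subspace (Mp M g)" by (rule Mp_subspace)
  show "module C_ring (piece W g)" using Q.quot_module by (simp add: W)
  show "elts W g = (\<lambda>x. x +o J g) ` Mp M g" using Q.P_simps(1) by (simp add: W cl)
  show "(x + y) +o J g = (x +o J g) \<oplus>\<^bsub>piece W g\<^esub> (y +o J g)" for x y
    using Q.P_simps(3) Q.cl_add by (simp add: W cl)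
  show "scl M c x +o J g = c \<odot>\<^bsub>piece W g\<^esub> (x +o J g)" for c x
    using Q.P_simps(4) Q.cl_scale by (simp add: W cl)
  show "dmap W g (x +o J g) = dif M x +o J (up g)" if x: "x \<in> Mp M g" for x
    unfolding W
  proof (rule induced_eq[OF x])
    fix y assume y: "y \<in> Mp M g" "y +o J g = x +o J g"
    then have "dif M (y - x) \<in> J (up g)" by (intro dJ) (simp add: M.vs.coset_eq_iff[OF J])
    then show "dif M y +o J (up g) = dif M x +o J (up g)"
      using y(1) x by (simp add: M.vs.coset_eq_iff[OF J] Mp_car
          linear_on_diff[OF M.vector_space M.dif_linear M.car_subspace])
  qed
qed

lemma mode_diff:
  assumes "x \<in> car M" "x' \<in> car M"
  shows "mmode M u' n x' - mmode M u n x = mmode M (u' - u) n x' + mmode M u n (x' - x)"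
  using assms by (simp add: mode_diff_left mode_diff_right)

text \<open>
  A mode descends to cosets if, in each of its two arguments, it maps homogeneous elements of the subspace divided out
  into \<open>K\<close>.  The operation on representatives may deviate from the mode by elements of \<open>K\<close>, as Zhu's operations do.
\<close>

lemma induced2_mode:
  assumes I: "V.vs.subspace I" and J: "M.vs.subspace J" and K: "M.vs.subspace K"
    and F: "\<And>u x. \<lbrakk>u \<in> Vp V g; x \<in> Mp M h\<rbrakk> \<Longrightarrow> F u x - mmode M u n x \<in> K"
    and IK: "\<And>u x. \<lbrakk>u \<in> I; u \<in> Vp V g; x \<in> Mp M h\<rbrakk> \<Longrightarrow> mmode M u n x \<in> K"
    and JK: "\<And>u x. \<lbrakk>u \<in> Vp V g; x \<in> J; x \<in> Mp M h\<rbrakk> \<Longrightarrow> mmode M u n x \<in> K"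
    and u: "u \<in> Vp V g" and x: "x \<in> Mp M h"
  shows "induced2 (Vp V g) (\<lambda>u. u +o I) (Mp M h) (\<lambda>x. x +o J) (\<lambda>u x. F u x +o K) (u +o I) (x +o J)
    = mmode M u n x +o K"
proof -
  have F_eq: "F u x +o K = mmode M u n x +o K" if "u \<in> Vp V g" "x \<in> Mp M h" for u x
    using F[OF that] by (simp add: M.vs.coset_eq_iff[OF K])
  have "induced2 (Vp V g) (\<lambda>u. u +o I) (Mp M h) (\<lambda>x. x +o J) (\<lambda>u x. F u x +o K) (u +o I) (x +o J) = F u x +o K"
  proof (rule induced2_eq[OF u x])
    fix u' x' assume u': "u' \<in> Vp V g" "u' +o I = u +o I" and x': "x' \<in> Mp M h" "x' +o J = x +o J"
    have "mmode M (u' - u) n x' + mmode M u n (x' - x) \<in> K"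
      using u' x' u x by (intro M.vs.subspace_add[OF K] IK JK V.vs.subspace_diff[OF Vp_subspace]
          M.vs.subspace_diff[OF Mp_subspace]) (simp_all add: V.vs.coset_eq_iff[OF I] M.vs.coset_eq_iff[OF J])
    then show "F u' x' +o K = F u x +o K"
      using u' x' u x by (simp add: F_eq M.vs.coset_eq_iff[OF K] mode_diff Mp_car)
  qed
  then show ?thesis by (simp add: F_eq u x)
qed

lemma coset_zero: "M.vs.subspace J \<Longrightarrow> x \<in> J \<Longrightarrow> x +o J = 0 +o J"
  by (simp only: M.vs.coset_eq_iff diff_zero)

end

section \<open>The algebras \<open>R(V)\<close> and \<open>gr A(V)\<close> and their modules\<close>

context dg_vertex_operator_algebra
begin

interpretation adj: graded_dg_module V "adjoint_module V"
  by (rule adjoint_graded_dg_module)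

theorem R_alg_presented: "presented_algebra V (R_alg V) (\<lambda>g u. u +o C2V V)"
proof (intro presented_algebra.intro presented_algebra_axioms.intro dg_vertex_operator_algebra_axioms)
  show "presented_complex (scl V) (Vp V) (dif V) (R_alg V) (\<lambda>g u. u +o C2V V)"
    using adj.presented_complex_coset[where J = "\<lambda>g. C2V V" and W = "R_alg V"] adj.dif_C2M
    by (simp add: R_alg_def C2V_subspace)
  show "punit (R_alg V) = vac V +o C2V V" by (simp add: R_alg_def)
  fix g h u v assume uv: "u \<in> Vp V g" "v \<in> Vp V h"
  note * = adj.induced2_mode[of "C2V V" "C2V V" "C2V V" g h _ _ u v]
  show "pmult (R_alg V) g h (u +o C2V V) (v +o C2V V) = vmode V u (-1) v +o C2V V"
    using *[of "\<lambda>u v. vmode V u (-1) v" "-1"] uv adj.C2V_mode[of "-1"] adj.mode_C2M[of "-1"]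
    by (simp add: R_alg_def C2V_subspace vs.subspace_0[OF C2V_subspace])
  show "pbrk (R_alg V) g h (u +o C2V V) (v +o C2V V) = vmode V u 0 v +o C2V V"
    using *[of "\<lambda>u v. vmode V u 0 v" 0] uv adj.C2V_mode[of 0] adj.mode_C2M[of 0]
    by (simp add: R_alg_def C2V_subspace vs.subspace_0[OF C2V_subspace])
next
  show "u +o C2V V = 0 +o C2V V" if "u \<in> C2V V" for u
    using adj.coset_zero[OF _ that] by (simp add: C2V_subspace)
qed

theorem grA_alg_presented: "presented_algebra V (grA_alg V) (\<lambda>g u. u +o IV V g)"
proof (intro presented_algebra.intro presented_algebra_axioms.intro dg_vertex_operator_algebra_axioms)
  show "presented_complex (scl V) (Vp V) (dif V) (grA_alg V) (\<lambda>g u. u +o IV V g)"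
    using adj.presented_complex_coset[where J = "IV V" and W = "grA_alg V"] adj.dif_JM
    by (simp add: grA_alg_def IV_subspace)
  show "punit (grA_alg V) = vac V +o IV V 0" by (simp add: grA_alg_def)
  fix g h u v assume uv: "u \<in> Vp V g" "v \<in> Vp V h"
  show "pmult (grA_alg V) g h (u +o IV V g) (v +o IV V h) = vmode V u (-1) v +o IV V (g + h)"
    using adj.induced2_mode[of "IV V g" "IV V h" "IV V (g + h)" g h "star_l (scl V) (vmode V) g" "-1" u v]
      uv adj.star_JM adj.IV_product adj.product_JM
    by (simp add: grA_alg_def IV_subspace)
  show "pbrk (grA_alg V) g h (u +o IV V g) (v +o IV V h) = vmode V u 0 v +o IV V (brdeg g h)"
    using adj.induced2_mode[of "IV V g" "IV V h" "IV V (brdeg g h)" g h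
        "\<lambda>u v. star_l (scl V) (vmode V) g u v - scl V (gsign g h) (star_l (scl V) (vmode V) h v u)" 0 u v]
      uv star_commutator_IV adj.IV_bracket adj.bracket_JM
    by (simp add: grA_alg_def IV_subspace)
next
  show "u +o IV V g = 0 +o IV V g" if "u \<in> Vp V g" "u \<in> C2V V" for u g
    using adj.coset_zero[of "IV V g" u] adj.C2M_Mp_JM[of u g] that by (simp add: IV_subspace)
qed

lemma eta_coset:
  assumes u: "u \<in> Vp V g" shows "eta V g (u +o C2V V) = u +o IV V g"
  unfolding eta_def
proof (rule induced_eq[OF u])
  fix v assume v: "v \<in> Vp V g" "v +o C2V V = u +o C2V V"
  then have "v - u \<in> IV V g"
    using adj.C2M_Mp_JM[of "v - u" g] vs.subspace_diff[OF adj.Vp_subspace v(1) u]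
    by (simp add: vs.coset_eq_iff[OF C2V_subspace])
  then show "v +o IV V g = u +o IV V g" by (simp add: vs.coset_eq_iff[OF IV_subspace])
qed

lemma elts_R_alg: "elts (R_alg V) g = (\<lambda>u. u +o C2V V) ` Vp V g"
  by (simp add: R_alg_def quot_def)

lemma ker_eta_eq: "ker_eta V g = (\<lambda>u. u +o C2V V) ` (Vp V g \<inter> IV V g)"
proof -
  have *: "u +o IV V g = IV V g \<longleftrightarrow> u \<in> IV V g" for u
    using vs.coset_eq_iff[OF IV_subspace, of u g 0] by simp
  have "a \<in> ker_eta V g \<longleftrightarrow> a \<in> (\<lambda>u. u +o C2V V) ` Vp V g \<and> eta V g a = IV V g" for a
    by (simp add: ker_eta_def elts_R_alg grA_alg_def quot_def)
  then have "a \<in> ker_eta V g \<longleftrightarrow> (\<exists>u\<in>Vp V g. a = u +o C2V V \<and> u +o IV V g = IV V g)" for a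
    unfolding image_iff by (metis eta_coset)
  then show ?thesis unfolding * by blast
qed

end

context graded_dg_module
begin

theorem R_mod_presented: "presented_poisson_module V M (R_alg V) (\<lambda>g u. u +o C2V V) (R_mod V M) (\<lambda>g x. x +o C2M M)"
proof (intro presented_poisson_module.intro presented_poisson_action.intro presented_action.intro
    presented_action_axioms.intro presented_poisson_action_axioms.intro
    graded_dg_module_axioms V.R_alg_presented)
  show "presented_complex (scl M) (Mp M) (dif M) (R_mod V M) (\<lambda>g x. x +o C2M M)"
    using presented_complex_coset[where J = "\<lambda>g. C2M M" and W = "R_mod V M"] dif_C2M
    by (simp add: R_mod_def C2M_subspace)
  fix g h u x assume ux: "u \<in> Vp V g" "x \<in> Mp M h"
  show "act (R_mod V M) g h (u +o C2V V) (x +o C2M M) = mmode M u (-1) x +o C2M M"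
    unfolding R_mod_def bg_mod.simps pois_mod.simps bigraded.simps
    by (rule induced2_mode[OF V.C2V_subspace C2M_subspace C2M_subspace _ _ _ ux])
      (simp_all add: C2V_mode mode_C2M Mp_car M.vs.subspace_0[OF C2M_subspace])
  show "mbrk (R_mod V M) g h (u +o C2V V) (x +o C2M M) = mmode M u 0 x +o C2M M"
    unfolding R_mod_def bg_mod.simps pois_mod.simps bigraded.simps
    by (rule induced2_mode[OF V.C2V_subspace C2M_subspace C2M_subspace _ _ _ ux])
      (simp_all add: C2V_mode mode_C2M Mp_car M.vs.subspace_0[OF C2M_subspace])
next
  show "x +o C2M M = 0 +o C2M M" if "x \<in> C2M M" for x
    by (rule coset_zero[OF C2M_subspace that])
qed

theorem grA_mod_presented:
  "presented_poisson_module V M (grA_alg V) (\<lambda>g u. u +o IV V g) (grA_mod V M) (\<lambda>g x. x +o JM V M g)"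
proof (intro presented_poisson_module.intro presented_poisson_action.intro presented_action.intro
    presented_action_axioms.intro presented_poisson_action_axioms.intro
    graded_dg_module_axioms V.grA_alg_presented)
  show "presented_complex (scl M) (Mp M) (dif M) (grA_mod V M) (\<lambda>g x. x +o JM V M g)"
    using presented_complex_coset[where J = "JM V M" and W = "grA_mod V M"] dif_JM
    by (simp add: grA_mod_def JM_subspace)
  fix g h u x assume ux: "u \<in> Vp V g" "x \<in> Mp M h"
  show "act (grA_mod V M) g h (u +o IV V g) (x +o JM V M h) = mmode M u (-1) x +o JM V M (g + h)"
    unfolding grA_mod_def bg_mod.simps pois_mod.simps bigraded.simps
    by (rule induced2_mode[OF V.IV_subspace JM_subspace JM_subspace _ _ _ ux])
      (simp_all add: star_JM IV_product product_JM)
  show "mbrk (grA_mod V M) g h (u +o IV V g) (x +o JM V M h) = mmode M u 0 x +o JM V M (brdeg g h)"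
    unfolding grA_mod_def bg_mod.simps pois_mod.simps bigraded.simps
    by (rule induced2_mode[OF V.IV_subspace JM_subspace JM_subspace _ _ _ ux])
      (simp_all add: star_commutator_JM IV_bracket bracket_JM)
next
  show "x +o JM V M g = 0 +o JM V M g" if "x \<in> Mp M g" "x \<in> C2M M" for g x
    by (rule coset_zero[OF JM_subspace C2M_Mp_JM[OF that(2,1)]])
qed

text \<open>Restriction along \<open>\<eta>\<close> does not change representatives, since \<open>\<eta>\<close> does not.\<close>

theorem grA_mod_restricted_presented:
  "presented_poisson_module V M (R_alg V) (\<lambda>g u. u +o C2V V) (restrict_scalars (eta V) (grA_mod V M))
    (\<lambda>g x. x +o JM V M g)"
proof -
  interpret gr: presented_poisson_module V M "grA_alg V" "\<lambda>g u. u +o IV V g" "grA_mod V M" "\<lambda>g x. x +o JM V M g"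
    by (rule grA_mod_presented)
  have "presented_complex (scl M) (Mp M) (dif M) (restrict_scalars (eta V) (grA_mod V M)) (\<lambda>g x. x +o JM V M g)"
    using gr.mod.presented_complex_axioms by (simp add: presented_complex_def restrict_scalars_def)
  then show ?thesis
    by (intro presented_poisson_module.intro presented_poisson_action.intro presented_action.intro
        presented_action_axioms.intro presented_poisson_action_axioms.intro
        graded_dg_module_axioms V.R_alg_presented gr.class_C2M)
      (simp_all add: restrict_scalars_def V.eta_coset gr.class_act gr.class_br)
qed

end

section \<open>The quotient of \<open>R(M)\<close> by the kernel of \<open>\<eta>\<close>\<close>

context graded_dg_module
begin

interpretation adj: graded_dg_module V "adjoint_module V"
  by (rule V.adjoint_graded_dg_module)

interpretation R: presented_poisson_module V M "R_alg V" "\<lambda>g u. u +o C2V V" "R_mod V M" "\<lambda>g x. x +o C2M M"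
  by (rule R_mod_presented)

text \<open>
  The preimage of \<open>(Ker \<eta>) R(M)\<close> in the component of \<open>M\<close> of bidegree \<open>g\<close>, as \<open>KR_eq\<close> shows.
\<close>

definition ker_rep :: "bideg \<Rightarrow> 'm set" where
  "ker_rep g = M.vs.span ({mmode M u (-1) x | u x h k. h + k = g \<and> u \<in> Vp V h \<and> u \<in> IV V h \<and> x \<in> Mp M k}
    \<union> (C2M M \<inter> Mp M g))"

lemma ker_rep_subspace: "M.vs.subspace (ker_rep g)"
  by (simp add: ker_rep_def)

lemma ker_rep_product: "\<lbrakk>u \<in> Vp V h; u \<in> IV V h; x \<in> Mp M k\<rbrakk> \<Longrightarrow> mmode M u (-1) x \<in> ker_rep (h + k)"
  unfolding ker_rep_def by (rule M.vs.span_base) blast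

lemma C2M_ker_rep: "\<lbrakk>x \<in> C2M M; x \<in> Mp M g\<rbrakk> \<Longrightarrow> x \<in> ker_rep g"
  unfolding ker_rep_def by (rule M.vs.span_base) blast

lemma ker_rep_into:
  assumes f: "linear_on (scl M) t (car M) f" and t: "vector_space t" and T: "module.subspace t T"
    and gen: "\<And>u x h k. \<lbrakk>h + k = g; u \<in> Vp V h; u \<in> IV V h; x \<in> Mp M k\<rbrakk> \<Longrightarrow> f (mmode M u (-1) x) \<in> T"
    and C2: "\<And>x. \<lbrakk>x \<in> C2M M; x \<in> Mp M g\<rbrakk> \<Longrightarrow> f x \<in> T" and x: "x \<in> ker_rep g"
  shows "f x \<in> T"
  using x unfolding ker_rep_def
proof (rule linear_on_span_into[where f = f, OF M.vector_space t f M.car_subspace _ T, rotated 2])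
  show "{mmode M u (-1) x | u x h k. h + k = g \<and> u \<in> Vp V h \<and> u \<in> IV V h \<and> x \<in> Mp M k} \<union> C2M M \<inter> Mp M g \<subseteq> car M"
    by (auto intro: mode_car Mp_car)
qed (use gen C2 in auto)

lemma id_linear: "linear_on (scl M) (scl M) (car M) (\<lambda>x. x)"
  by (simp add: linear_on_def)

lemma ker_rep_Mp: "ker_rep g \<subseteq> Mp M g"
  by (rule subsetI, rule ker_rep_into[OF id_linear M.vector_space Mp_subspace]) (auto intro: R.Mp_product)

lemma ker_rep_JM: "x \<in> ker_rep g \<Longrightarrow> x \<in> JM V M g"
  by (rule ker_rep_into[OF id_linear M.vector_space JM_subspace]) (auto intro: IV_product C2M_Mp_JM)

lemma ker_rep_dif: "x \<in> ker_rep g \<Longrightarrow> dif M x \<in> ker_rep (up g)"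
proof (rule ker_rep_into[OF M.dif_linear M.vector_space ker_rep_subspace])
  fix u x h k assume g: "h + k = g" and u: "u \<in> Vp V h" "u \<in> IV V h" and x: "x \<in> Mp M k"
  have k: "up h + k = up g" "h + up k = up g" by (simp_all add: g[symmetric] ac_simps)
  have "dif M (mmode M u (-1) x)
      = mmode M (dif V u) (-1) x + scl M ((-1) powi fst h) (mmode M u (-1) (dif M x))"
    using mode_dif[OF R.Vp_dgr[OF u(1)] Mp_car[OF x], of "-1"] by simp
  moreover have "mmode M (dif V u) (-1) x \<in> ker_rep (up g)"
    using ker_rep_product[OF R.Vp_dif[OF u(1)] _ x] adj.dif_JM[of u h] u(2) by (simp add: k)
  moreover have "mmode M u (-1) (dif M x) \<in> ker_rep (up g)"
    using ker_rep_product[OF u Mp_dif[OF x]] by (simp only: k)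
  ultimately show "dif M (mmode M u (-1) x) \<in> ker_rep (up g)"
    using M.vs.subspace_add[OF ker_rep_subspace] M.vs.subspace_scale[OF ker_rep_subspace] by simp
qed (auto intro: C2M_ker_rep dif_C2M Mp_dif)

text \<open>
  By associativity modulo \<open>C\<^sub>2(M)\<close> and since the kernel of \<open>\<eta>\<close> is an ideal of \<open>R(V)\<close>.
\<close>

lemma product_ker_rep:
  assumes v: "v \<in> Vp V h" and x: "x \<in> ker_rep k"
  shows "mmode M v (-1) x \<in> ker_rep (h + k)"
proof (rule ker_rep_into[OF mode_linear_right M.vector_space ker_rep_subspace _ _ x])
  fix u y i j assume k: "i + j = k" and u: "u \<in> Vp V i" "u \<in> IV V i" and y: "y \<in> Mp M j"
  have vu: "vmode V v (-1) u \<in> Vp V (h + i)" "vmode V v (-1) u \<in> IV V (h + i)"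
    using R.Vp_product[OF v u(1)] adj.product_JM[of v h u i] v u by simp_all
  have k': "h + i + j = h + k" by (simp add: k[symmetric] add.assoc)
  have 1: "mmode M (vmode V v (-1) u) (-1) y \<in> ker_rep (h + k)"
    using ker_rep_product[OF vu y] by (simp only: k')
  have 2: "mmode M (vmode V v (-1) u) (-1) y - mmode M v (-1) (mmode M u (-1) y) \<in> ker_rep (h + k)"
    using R.Mp_product[OF vu(1) y] R.Mp_product[OF v R.Mp_product[OF u(1) y]]
    by (intro C2M_ker_rep product_assoc_C2M[OF R.Vp_dgr[OF v] R.Vp_dgr[OF u(1)] Mp_car[OF y]]
        M.vs.subspace_diff[OF Mp_subspace]) (simp_all only: k' k)
  show "mmode M v (-1) (mmode M u (-1) y) \<in> ker_rep (h + k)"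
    using M.vs.subspace_diff[OF ker_rep_subspace 1 2] by simp
next
  show "mmode M v (-1) y \<in> ker_rep (h + k)" if "y \<in> C2M M" "y \<in> Mp M k" for y
    using that v by (intro C2M_ker_rep mode_C2M R.Mp_product) simp_all
qed

text \<open>
  By the derivation property and since the kernel of \<open>\<eta>\<close> is a Poisson ideal of \<open>R(V)\<close>.
\<close>

lemma bracket_ker_rep:
  assumes v: "v \<in> Vp V h" and x: "x \<in> ker_rep k"
  shows "mmode M v 0 x \<in> ker_rep (brdeg h k)"
proof (rule ker_rep_into[OF mode_linear_right M.vector_space ker_rep_subspace _ _ x])
  fix u y i j assume k: "i + j = k" and u: "u \<in> Vp V i" "u \<in> IV V i" and y: "y \<in> Mp M j"
  have vu: "vmode V v 0 u \<in> Vp V (brdeg h i)" "vmode V v 0 u \<in> IV V (brdeg h i)"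
    using R.Vp_bracket[OF v u(1)] adj.bracket_JM[of v h u i] v u by simp_all
  have k': "brdeg h i + j = brdeg h k" "i + brdeg h j = brdeg h k" by (simp_all add: k[symmetric] algebra_simps)
  have "mmode M (vmode V v 0 u) (-1) y \<in> ker_rep (brdeg h k)" "mmode M u (-1) (mmode M v 0 y) \<in> ker_rep (brdeg h k)"
    using ker_rep_product[OF vu y] ker_rep_product[OF u R.Mp_bracket[OF v y]] by (simp_all only: k')
  then show "mmode M v 0 (mmode M u (-1) y) \<in> ker_rep (brdeg h k)"
    using mode_0_commutator[OF R.Vp_dgr[OF v] R.Vp_dgr[OF u(1)] Mp_car[OF y], of "-1"]
      M.vs.subspace_add[OF ker_rep_subspace] M.vs.subspace_scale[OF ker_rep_subspace] by simp
next
  show "mmode M v 0 y \<in> ker_rep (brdeg h k)" if "y \<in> C2M M" "y \<in> Mp M k" for y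
    using that v by (intro C2M_ker_rep mode_C2M R.Mp_bracket) simp_all
qed

lemma elts_R_mod: "elts (R_mod V M) g = (\<lambda>x. x +o C2M M) ` Mp M g"
  by (rule R.mod.elts)

text \<open>
  Being a span in the sense of modules over a ring, the left hand side is an intersection of submodules.  The image on
  the right is one of them, and the preimage of any other in \<open>M\<close> is a subspace containing the generators of \<open>ker_rep\<close>.
\<close>

lemma KR_eq: "KR V M g = (\<lambda>x. x +o C2M M) ` ker_rep g"
proof
  interpret P: Module.module C_ring "piece (R_mod V M) g" by (rule R.mod.module)
  let ?\<rho> = "\<lambda>x. x +o C2M M"
  let ?S = "{act (R_mod V M) h k a x | h k a x. h + k = g \<and> a \<in> ker_eta V h \<and> x \<in> elts (R_mod V M) k}"
  have Mp: "x \<in> Mp M g" if "x \<in> ker_rep g" for x using ker_rep_Mp that by blast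
  have "submodule (?\<rho> ` ker_rep g) C_ring (piece (R_mod V M) g)"
  proof (rule P.submoduleI)
    show "?\<rho> ` ker_rep g \<subseteq> elts (R_mod V M) g" using Mp by (auto simp: elts_R_mod)
    show "\<zero>\<^bsub>piece (R_mod V M) g\<^esub> \<in> ?\<rho> ` ker_rep g"
      unfolding R.mod.class_zero[of g, symmetric] using M.vs.subspace_0[OF ker_rep_subspace] by blast
    show "\<ominus>\<^bsub>piece (R_mod V M) g\<^esub> a \<in> ?\<rho> ` ker_rep g" if a: "a \<in> ?\<rho> ` ker_rep g" for a
    proof -
      obtain x where x: "x \<in> ker_rep g" "a = ?\<rho> x" using a by blast
      have x': "- x \<in> ker_rep g" by (rule M.vs.subspace_neg[OF ker_rep_subspace x(1)])
      have "?\<rho> (- x) \<oplus>\<^bsub>piece (R_mod V M) g\<^esub> ?\<rho> x = \<zero>\<^bsub>piece (R_mod V M) g\<^esub>"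
        by (simp only: R.mod.class_add[OF Mp[OF x'] Mp[OF x(1)], symmetric] left_minus R.mod.class_zero)
      then have "\<ominus>\<^bsub>piece (R_mod V M) g\<^esub> ?\<rho> x = ?\<rho> (- x)"
        using Mp[OF x'] Mp[OF x(1)] by (intro P.minus_equality) (auto simp: elts_R_mod)
      then show ?thesis using x x' by blast
    qed
    show "a \<oplus>\<^bsub>piece (R_mod V M) g\<^esub> b \<in> ?\<rho> ` ker_rep g" if a: "a \<in> ?\<rho> ` ker_rep g" and b: "b \<in> ?\<rho> ` ker_rep g" for a b
    proof -
      obtain x y where "x \<in> ker_rep g" "a = ?\<rho> x" "y \<in> ker_rep g" "b = ?\<rho> y" using a b by blast
      then show ?thesis
        using R.mod.class_add[of x g y, symmetric] Mp M.vs.subspace_add[OF ker_rep_subspace] by auto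
    qed
    show "c \<odot>\<^bsub>piece (R_mod V M) g\<^esub> a \<in> ?\<rho> ` ker_rep g" if a: "a \<in> ?\<rho> ` ker_rep g" for c a
    proof -
      obtain x where "x \<in> ker_rep g" "a = ?\<rho> x" using a by blast
      then show ?thesis
        using R.mod.class_scale[of x g c, symmetric] Mp M.vs.subspace_scale[OF ker_rep_subspace] by auto
    qed
  qed
  moreover have "?S \<subseteq> ?\<rho> ` ker_rep g"
  proof
    fix b assume "b \<in> ?S"
    then obtain h k u x where "h + k = g" "u \<in> Vp V h" "u \<in> IV V h" "x \<in> Mp M k"
      "b = act (R_mod V M) h k (u +o C2V V) (x +o C2M M)"
      unfolding V.ker_eta_eq elts_R_mod by blast
    then show "b \<in> ?\<rho> ` ker_rep g"
      using ker_rep_product[of u h x k] by (auto simp: R.class_act simp del: split_paired_All)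
  qed
  ultimately show "KR V M g \<subseteq> ?\<rho> ` ker_rep g"
    unfolding KR_def module_span_def by blast
  show "?\<rho> ` ker_rep g \<subseteq> KR V M g"
    unfolding KR_def module_span_def
  proof (rule Inter_greatest, elim CollectE conjE)
    fix N assume N: "submodule N C_ring (piece (R_mod V M) g)" and S: "?S \<subseteq> N"
    interpret N: submodule N C_ring "piece (R_mod V M) g" by (rule N)
    have zero: "\<zero>\<^bsub>piece (R_mod V M) g\<^esub> \<in> N" using N.one_closed by simp
    have add: "a \<oplus>\<^bsub>piece (R_mod V M) g\<^esub> b \<in> N" if "a \<in> N" "b \<in> N" for a b using N.m_closed[OF that] by simp
    have \<rho>0: "?\<rho> 0 \<in> N" unfolding R.mod.class_zero[of g] by (rule zero)
    have "M.vs.subspace {x \<in> Mp M g. ?\<rho> x \<in> N}"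
    proof (rule M.vs.subspaceI; (elim CollectE conjE)?; intro CollectI conjI)
      fix x y assume x: "x \<in> Mp M g" "?\<rho> x \<in> N" and y: "y \<in> Mp M g" "?\<rho> y \<in> N"
      show "?\<rho> (x + y) \<in> N" unfolding R.mod.class_add[OF x(1) y(1)] by (rule add[OF x(2) y(2)])
    next
      fix c x assume x: "x \<in> Mp M g" "?\<rho> x \<in> N"
      show "?\<rho> (scl M c x) \<in> N"
        unfolding R.mod.class_scale[OF x(1)] by (rule N.smult_closed[OF _ x(2)]) (simp add: C_ring_def)
    qed (simp_all only: \<rho>0 R.mod.X_closed)
    moreover have "mmode M u (-1) x \<in> {x \<in> Mp M g. ?\<rho> x \<in> N}"
      if "h + k = g" "u \<in> Vp V h" "u \<in> IV V h" "x \<in> Mp M k" for u x h k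
    proof -
      have "act (R_mod V M) h k (u +o C2V V) (?\<rho> x) \<in> ?S"
        using that unfolding V.ker_eta_eq elts_R_mod by blast
      then have "act (R_mod V M) h k (u +o C2V V) (?\<rho> x) \<in> N" by (rule subsetD[OF S])
      then show ?thesis using R.class_act[OF that(2,4)] R.Mp_product[OF that(2,4)] that(1) by auto
    qed
    moreover have "x \<in> {x \<in> Mp M g. ?\<rho> x \<in> N}" if "x \<in> C2M M" "x \<in> Mp M g" for x
      using R.class_C2M[of x g] that zero R.mod.class_zero[of g] by simp
    ultimately have "ker_rep g \<subseteq> {x \<in> Mp M g. ?\<rho> x \<in> N}"
      unfolding ker_rep_def by (intro M.vs.span_minimal) auto
    then show "?\<rho> ` ker_rep g \<subseteq> N" by auto
  qed
qed

abbreviation eta_class :: "bideg \<Rightarrow> 'm \<Rightarrow> 'm set set" where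
  "eta_class g x \<equiv> (x +o C2M M) +o KR V M g"

lemma quotient_map_eta:
  "quotient_map (scl M) (\<lambda>c A. scl M c ` A + C2M M) (\<lambda>x. x +o C2M M) (Mp M g) (ker_rep g)"
proof -
  interpret Q: quotient_map "scl M" "scl M" "\<lambda>x. x" "Mp M g" "C2M M"
    by (rule quotient_map_coset[OF M.vector_space Mp_subspace C2M_subspace])
  show ?thesis
    using Q.cl_add Q.cl_scale
    by (simp add: quotient_map_def quotient_map_axioms_def M.vector_space Mp_subspace ker_rep_subspace Q.cl_def)
qed

text \<open>
  Equal classes have representatives that agree modulo \<open>C\<^sub>2(M)\<close>, and homogeneous elements of \<open>C\<^sub>2(M)\<close> are in \<open>ker_rep\<close>.
\<close>

lemma eta_class_eq_iff:
  assumes "x \<in> Mp M g" "y \<in> Mp M g"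
  shows "eta_class g x = eta_class g y \<longleftrightarrow> x - y \<in> ker_rep g"
proof -
  interpret Q: quotient_map "scl M" "\<lambda>c A. scl M c ` A + C2M M" "\<lambda>x. x +o C2M M" "Mp M g" "ker_rep g"
    by (rule quotient_map_eta)
  have cl: "Q.cl = eta_class g" by (simp add: Q.cl_def[abs_def] KR_eq)
  show ?thesis
  proof
    assume "eta_class g x = eta_class g y"
    then obtain l where l: "l \<in> ker_rep g" "x +o C2M M = (y + l) +o C2M M"
      using Q.cl_eqD unfolding cl by blast
    have "x - (y + l) \<in> ker_rep g"
      using l assms ker_rep_Mp[of g]
      by (intro C2M_ker_rep M.vs.subspace_diff[OF Mp_subspace] M.vs.subspace_add[OF Mp_subspace])
        (auto simp: M.vs.coset_eq_iff[OF C2M_subspace])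
    from M.vs.subspace_add[OF ker_rep_subspace this l(1)] show "x - y \<in> ker_rep g" by simp
  qed (use Q.cl_cong cl in metis)
qed

lemma eta_presented_complex:
  assumes W: "piece W = piece (eta_bigraded V M)" "dmap W = dmap (eta_bigraded V M)"
  shows "presented_complex (scl M) (Mp M) (dif M) W eta_class"
proof (rule presented_complex.intro)
  fix g
  interpret Q: quotient_map "scl M" "\<lambda>c A. scl M c ` A + C2M M" "\<lambda>x. x +o C2M M" "Mp M g" "ker_rep g"
    by (rule quotient_map_eta)
  have cl: "Q.cl = eta_class g" by (simp add: Q.cl_def[abs_def] KR_eq)
  have smult: "smult (piece (R_mod V M) g) = (\<lambda>c A. scl M c ` A + C2M M)"
    by (simp add: R_mod_def quot_def)
  have piece: "piece W g = Q.P"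
    by (simp add: W eta_bigraded_def smult elts_R_mod KR_eq)
  show "vector_space (scl M)" by (rule M.vector_space)
  show "M.vs.subspace (Mp M g)" by (rule Mp_subspace)
  show "module C_ring (piece W g)" using Q.quot_module by (simp add: piece)
  show "elts W g = eta_class g ` Mp M g" using Q.P_simps(1) by (simp add: piece cl)
  show "eta_class g (x + y) = eta_class g x \<oplus>\<^bsub>piece W g\<^esub> eta_class g y" for x y
    using Q.P_simps(3) Q.cl_add by (simp add: piece cl)
  show "eta_class g (scl M c x) = c \<odot>\<^bsub>piece W g\<^esub> eta_class g x" for c x
    using Q.P_simps(4) Q.cl_scale by (simp add: piece cl)
  show "dmap W g (eta_class g x) = eta_class (up g) (dif M x)" if x: "x \<in> Mp M g" for x
  proof -
    have "induced (elts (R_mod V M) g) (\<lambda>x. x +o KR V M g) (\<lambda>x. dmap (R_mod V M) g x +o KR V M (up g)) (eta_class g x)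
        = dmap (R_mod V M) g (x +o C2M M) +o KR V M (up g)"
    proof (rule induced_eq)
      show "x +o C2M M \<in> elts (R_mod V M) g" using x by (simp add: elts_R_mod)
      fix a assume "a \<in> elts (R_mod V M) g" "a +o KR V M g = eta_class g x"
      then obtain y where y: "a = y +o C2M M" "y \<in> Mp M g" "y - x \<in> ker_rep g"
        using x by (auto simp: elts_R_mod eta_class_eq_iff)
      have "dif M y - dif M x \<in> ker_rep (up g)"
        using ker_rep_dif[OF y(3)] x y
        by (simp add: linear_on_diff[OF M.vector_space M.dif_linear M.car_subspace] Mp_car)
      then show "dmap (R_mod V M) g a +o KR V M (up g) = dmap (R_mod V M) g (x +o C2M M) +o KR V M (up g)"
        using x y by (simp add: R.mod.class_dif eta_class_eq_iff Mp_dif)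
    qed
    then show ?thesis using x by (simp add: W eta_bigraded_def R.mod.class_dif)
  qed
qed

lemma eta_class_C2M: "\<lbrakk>x \<in> Mp M g; x \<in> C2M M\<rbrakk> \<Longrightarrow> eta_class g x = eta_class g 0"
  by (simp add: R.class_C2M[of x g])

text \<open>
  An operation of \<open>R(V)\<close> on \<open>R(M)\<close> descends along \<open>\<eta>\<close> and along the quotient map if it maps both kernels
  into the kernel.
\<close>

lemma eta_mod_operation:
  assumes op: "\<And>u x. \<lbrakk>u \<in> Vp V g; x \<in> Mp M h\<rbrakk> \<Longrightarrow> op (u +o C2V V) (x +o C2M M) = mmode M u n x +o C2M M"
    and closed: "\<And>u x. \<lbrakk>u \<in> Vp V g; x \<in> Mp M h\<rbrakk> \<Longrightarrow> mmode M u n x \<in> Mp M k"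
    and I: "\<And>u x. \<lbrakk>u \<in> Vp V g; u \<in> IV V g; x \<in> Mp M h\<rbrakk> \<Longrightarrow> mmode M u n x \<in> ker_rep k"
    and L: "\<And>u x. \<lbrakk>u \<in> Vp V g; x \<in> ker_rep h\<rbrakk> \<Longrightarrow> mmode M u n x \<in> ker_rep k"
    and u: "u \<in> Vp V g" and x: "x \<in> Mp M h"
  shows "induced2 (elts (R_alg V) g) (eta V g) (elts (R_mod V M) h) (\<lambda>x. x +o KR V M h)
    (\<lambda>a x. op a x +o KR V M k) (u +o IV V g) (eta_class h x) = eta_class k (mmode M u n x)"
proof -
  have "induced2 (elts (R_alg V) g) (eta V g) (elts (R_mod V M) h) (\<lambda>x. x +o KR V M h)
    (\<lambda>a x. op a x +o KR V M k) (eta V g (u +o C2V V)) (eta_class h x) = op (u +o C2V V) (x +o C2M M) +o KR V M k"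
  proof (rule induced2_eq)
    show "u +o C2V V \<in> elts (R_alg V) g" "x +o C2M M \<in> elts (R_mod V M) h"
      using u x by (auto simp: V.elts_R_alg elts_R_mod)
    fix a b assume "a \<in> elts (R_alg V) g" "b \<in> elts (R_mod V M) h"
      "eta V g a = eta V g (u +o C2V V)" "b +o KR V M h = eta_class h x"
    then obtain v y where v: "a = v +o C2V V" "v \<in> Vp V g" "v - u \<in> IV V g"
      and y: "b = y +o C2M M" "y \<in> Mp M h" "y - x \<in> ker_rep h"
      using u x by (auto simp: V.elts_R_alg elts_R_mod eta_class_eq_iff V.eta_coset V.vs.coset_eq_iff[OF V.IV_subspace])
    have "mmode M (v - u) n y + mmode M u n (y - x) \<in> ker_rep k"
      by (intro M.vs.subspace_add[OF ker_rep_subspace] I L V.vs.subspace_diff[OF Vp_subspace] u v y)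
    then show "op a b +o KR V M k = op (u +o C2V V) (x +o C2M M) +o KR V M k"
      using u x v y by (simp add: op eta_class_eq_iff closed mode_diff Mp_car)
  qed
  then show ?thesis by (simp add: V.eta_coset u op x)
qed

theorem eta_mod_presented:
  "presented_module V M (grA_alg V) (\<lambda>g u. u +o IV V g) (eta_mod V M) eta_class"
proof (intro presented_module.intro presented_action.intro presented_action_axioms.intro
    graded_dg_module_axioms V.grA_alg_presented eta_presented_complex eta_class_C2M)
  show "act (eta_mod V M) g h (u +o IV V g) (eta_class h x) = eta_class (g + h) (mmode M u (-1) x)"
    if "u \<in> Vp V g" "x \<in> Mp M h" for g h u x
    unfolding eta_mod_def bg_mod.simps pois_mod.simps bigraded.simps
    by (rule eta_mod_operation[OF R.class_act R.Mp_product ker_rep_product product_ker_rep that])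
qed (simp_all add: eta_mod_def)

text \<open>
  The hypothesis is the descent of the bracket along \<open>\<eta>\<close> in its first argument; descent in the second argument is
  \<open>bracket_ker_rep\<close>.
\<close>

theorem eta_mod_poisson_presented:
  assumes "eta_brackets_descend V M"
  shows "presented_poisson_module V M (grA_alg V) (\<lambda>g u. u +o IV V g) (eta_mod V M) eta_class"
proof -
  interpret E: presented_module V M "grA_alg V" "\<lambda>g u. u +o IV V g" "eta_mod V M" eta_class
    by (rule eta_mod_presented)
  have I: "mmode M u 0 x \<in> ker_rep (brdeg g h)" if u: "u \<in> Vp V g" "u \<in> IV V g" and x: "x \<in> Mp M h" for u x g h
  proof -
    have "mmode M u 0 x +o C2M M \<in> KR V M (brdeg g h)"
      using assms u x unfolding eta_brackets_descend_def V.ker_eta_eq elts_R_mod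
      by (metis IntI R.class_br imageI)
    then obtain y where y: "y \<in> ker_rep (brdeg g h)" "mmode M u 0 x +o C2M M = y +o C2M M"
      by (auto simp: KR_eq)
    then have "mmode M u 0 x - y \<in> ker_rep (brdeg g h)"
      using R.Mp_bracket[OF u(1) x] ker_rep_Mp[of "brdeg g h"]
      by (intro C2M_ker_rep M.vs.subspace_diff[OF Mp_subspace]) (auto simp: M.vs.coset_eq_iff[OF C2M_subspace])
    from M.vs.subspace_add[OF ker_rep_subspace this y(1)] show ?thesis by simp
  qed
  show ?thesis
  proof (intro presented_poisson_module.intro presented_poisson_action.intro presented_poisson_action_axioms.intro
      E.presented_action_axioms)
    show "mbrk (eta_mod V M) g h (u +o IV V g) (eta_class h x) = eta_class (brdeg g h) (mmode M u 0 x)"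
      if "u \<in> Vp V g" "x \<in> Mp M h" for g h u x
      unfolding eta_mod_def bg_mod.simps pois_mod.simps bigraded.simps
      by (rule eta_mod_operation[OF R.class_br R.Mp_bracket I bracket_ker_rep that])
  qed
qed

lemma eta_mod_R_operation:
  assumes op: "\<And>x. x \<in> Mp M h \<Longrightarrow> op (x +o C2M M) = mmode M u n x +o C2M M"
    and closed: "\<And>x. x \<in> Mp M h \<Longrightarrow> mmode M u n x \<in> Mp M k"
    and L: "\<And>x. x \<in> ker_rep h \<Longrightarrow> mmode M u n x \<in> ker_rep k" and x: "x \<in> Mp M h"
  shows "induced (elts (R_mod V M) h) (\<lambda>x. x +o KR V M h) (\<lambda>x. op x +o KR V M k) (eta_class h x)
    = eta_class k (mmode M u n x)"
proof -
  have "induced (elts (R_mod V M) h) (\<lambda>x. x +o KR V M h) (\<lambda>x. op x +o KR V M k) (eta_class h x)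
      = op (x +o C2M M) +o KR V M k"
  proof (rule induced_eq)
    show "x +o C2M M \<in> elts (R_mod V M) h" using x by (auto simp: elts_R_mod)
    fix b assume "b \<in> elts (R_mod V M) h" "b +o KR V M h = eta_class h x"
    then obtain y where y: "b = y +o C2M M" "y \<in> Mp M h" "y - x \<in> ker_rep h"
      using x by (auto simp: elts_R_mod eta_class_eq_iff)
    then show "op b +o KR V M k = op (x +o C2M M) +o KR V M k"
      using x L[OF y(3)] by (simp add: op eta_class_eq_iff closed mode_diff_right Mp_car)
  qed
  then show ?thesis by (simp add: op x)
qed

theorem eta_mod_R_presented:
  "presented_poisson_module V M (R_alg V) (\<lambda>g u. u +o C2V V) (eta_mod_R V M) eta_class"
proof (intro presented_poisson_module.intro presented_poisson_action.intro presented_action.intro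
    presented_action_axioms.intro presented_poisson_action_axioms.intro
    graded_dg_module_axioms V.R_alg_presented eta_presented_complex eta_class_C2M)
  fix g h u x assume ux: "u \<in> Vp V g" "x \<in> Mp M h"
  show "act (eta_mod_R V M) g h (u +o C2V V) (eta_class h x) = eta_class (g + h) (mmode M u (-1) x)"
    unfolding eta_mod_R_def bg_mod.simps pois_mod.simps bigraded.simps
    by (rule eta_mod_R_operation[OF R.class_act[OF ux(1)] R.Mp_product[OF ux(1)] product_ker_rep[OF ux(1)] ux(2)])
  show "mbrk (eta_mod_R V M) g h (u +o C2V V) (eta_class h x) = eta_class (brdeg g h) (mmode M u 0 x)"
    unfolding eta_mod_R_def bg_mod.simps pois_mod.simps bigraded.simps
    by (rule eta_mod_R_operation[OF R.class_br[OF ux(1)] R.Mp_bracket[OF ux(1)] bracket_ker_rep[OF ux(1)] ux(2)])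
qed (simp_all add: eta_mod_R_def)

end


section \<open>Functoriality and the natural transformation\<close>

context
  fixes V :: "'v::ab_group_add dgvoa" and M N :: "('v, 'm::ab_group_add) graded_mod" and f :: "'m \<Rightarrow> 'm"
  assumes f: "graded_dg_module_hom V M N f"
begin

interpretation M: graded_dg_module V M
  using f by (simp add: graded_dg_module_hom_def)

interpretation N: graded_dg_module V N
  using f by (simp add: graded_dg_module_hom_def)

lemma hom_linear: "linear_on (scl M) (scl N) (car M) f"
  and hom_mode: "w \<in> car M \<Longrightarrow> f (mmode M v n w) = mmode N v n (f w)"
  and hom_Mp: "x \<in> Mp M g \<Longrightarrow> f x \<in> Mp N g"
  using f by (auto simp: graded_dg_module_hom_def Mp_def image_subset_iff)

lemma hom_car: "x \<in> car M \<Longrightarrow> f x \<in> car N"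
  unfolding M.car_eq_span_Mp
  by (rule linear_on_span_into[where f = f, OF M.M.vector_space N.M.vector_space hom_linear M.M.car_subspace
        _ N.M.car_subspace]) (auto dest: M.Mp_car hom_Mp N.Mp_car)

lemma hom_zhu:
  assumes w: "w \<in> car M"
  shows "f (zhu (scl M) (mmode M) a r u w) = zhu (scl N) (mmode N) a r u (f w)"
  unfolding M.zhu_image[OF N.M.vector_space hom_linear w] by (simp add: zhu_def hom_mode[OF w])

lemma hom_C2M: "x \<in> C2M M \<Longrightarrow> f x \<in> C2M N"
  unfolding C2M_def[of M] C2_def
  by (rule linear_on_span_into[where f = f, OF M.M.vector_space N.M.vector_space hom_linear M.M.car_subspace
        _ N.C2M_subspace]) (auto simp: hom_mode intro: M.mode_car N.C2M_mode_minus_2[OF hom_car])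

lemma hom_JM: "x \<in> JM V M g \<Longrightarrow> f x \<in> JM V N g"
proof (rule M.JM_into[OF hom_linear N.M.vector_space N.JM_subspace])
  show "f y \<in> JM V N g" if "y \<in> OM V M" for y
    by (rule M.OM_into[OF hom_linear N.M.vector_space N.JM_subspace _ that])
      (auto simp: hom_zhu intro: N.OM_JM N.circ_OM hom_car)
  show "f y \<in> JM V N g" if "below k g" "y \<in> Mp M k" for k y
    by (rule N.lower_JM[OF N.Mp_lower[OF that(1) hom_Mp[OF that(2)]]])
qed

lemma hom_ker_rep: "x \<in> M.ker_rep g \<Longrightarrow> f x \<in> N.ker_rep g"
  by (rule M.ker_rep_into[OF hom_linear N.M.vector_space N.ker_rep_subspace])
    (auto simp: hom_mode M.Mp_car hom_Mp hom_C2M intro: N.ker_rep_product N.C2M_ker_rep)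

lemma grA_map_class:
  assumes x: "x \<in> Mp M g" shows "grA_map V M N f g (x +o JM V M g) = f x +o JM V N g"
  unfolding grA_map_def
proof (rule induced_eq[OF x])
  fix y assume y: "y \<in> Mp M g" "y +o JM V M g = x +o JM V M g"
  then have "f (y - x) \<in> JM V N g" by (intro hom_JM) (simp add: M.M.vs.coset_eq_iff[OF M.JM_subspace])
  then show "f y +o JM V N g = f x +o JM V N g"
    using x y(1) by (simp add: N.M.vs.coset_eq_iff[OF N.JM_subspace] M.Mp_car
        linear_on_diff[OF M.M.vector_space hom_linear M.M.car_subspace])
qed

lemma R_map_class:
  assumes x: "x \<in> Mp M g" shows "R_map M N f g (x +o C2M M) = f x +o C2M N"
  unfolding R_map_def
proof (rule induced_eq[OF x])
  fix y assume y: "y \<in> Mp M g" "y +o C2M M = x +o C2M M"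
  then have "f (y - x) \<in> C2M N" by (intro hom_C2M) (simp add: M.M.vs.coset_eq_iff[OF M.C2M_subspace])
  then show "f y +o C2M N = f x +o C2M N"
    using x y(1) by (simp add: N.M.vs.coset_eq_iff[OF N.C2M_subspace] M.Mp_car
        linear_on_diff[OF M.M.vector_space hom_linear M.M.car_subspace])
qed

lemma eta_map_class:
  assumes x: "x \<in> Mp M g" shows "eta_map V M N f g (M.eta_class g x) = N.eta_class g (f x)"
proof -
  have "eta_map V M N f g (M.eta_class g x) = R_map M N f g (x +o C2M M) +o KR V N g"
    unfolding eta_map_def
  proof (rule induced_eq)
    show "x +o C2M M \<in> elts (R_mod V M) g" using x by (auto simp: M.elts_R_mod)
    fix b assume "b \<in> elts (R_mod V M) g" "b +o KR V M g = M.eta_class g x"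
    then obtain y where y: "b = y +o C2M M" "y \<in> Mp M g" "y - x \<in> M.ker_rep g"
      using x by (auto simp: M.elts_R_mod M.eta_class_eq_iff)
    then show "R_map M N f g b +o KR V N g = R_map M N f g (x +o C2M M) +o KR V N g"
      using x hom_ker_rep[OF y(3)] by (simp add: R_map_class N.eta_class_eq_iff hom_Mp M.Mp_car
        linear_on_diff[OF M.M.vector_space hom_linear M.M.car_subspace])
  qed
  then show ?thesis by (simp add: R_map_class x)
qed

end

definition eta_to_grA ::
    "'v::ab_group_add dgvoa \<Rightarrow> ('v, 'm::ab_group_add) graded_mod \<Rightarrow> bideg \<Rightarrow> 'm set set \<Rightarrow> 'm set" where
  "eta_to_grA V M g = induced (Mp M g) (\<lambda>x. (x +o C2M M) +o KR V M g) (\<lambda>x. x +o JM V M g)"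

lemma (in graded_dg_module) eta_to_grA_class:
  assumes x: "x \<in> Mp M g" shows "eta_to_grA V M g (eta_class g x) = x +o JM V M g"
  unfolding eta_to_grA_def
proof (rule induced_eq[OF x])
  fix y assume "y \<in> Mp M g" "eta_class g y = eta_class g x"
  then have "y - x \<in> ker_rep g" using x by (simp add: eta_class_eq_iff)
  then show "y +o JM V M g = x +o JM V M g"
    by (simp add: M.vs.coset_eq_iff[OF JM_subspace] ker_rep_JM)
qed

text \<open>
  Functoriality is visible on representatives, where the induced map is the given morphism.
\<close>

lemma presented_functor:
  fixes Fo :: "('v::ab_group_add, 'm::ab_group_add) graded_mod \<Rightarrow> ('a, 'w, 'z) bg_mod_scheme"
  assumes pres: "\<And>M. graded_dg_module V M \<Longrightarrow> presented_module V M A \<alpha> (Fo M) (\<pi> M)"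
    and map: "\<And>M N f g x. graded_dg_module_hom V M N f \<Longrightarrow> x \<in> Mp M g \<Longrightarrow> Fm M N f g (\<pi> M g x) = \<pi> N g (f x)"
  shows "functor_to_modules V A Fo Fm"
  unfolding functor_to_modules_def
proof (intro conjI allI impI ballI; (elim conjE)?)
  fix M N :: "('v, 'm) graded_mod" and f assume f: "graded_dg_module_hom V M N f"
  then have "graded_dg_module V M" "graded_dg_module V N" by (simp_all add: graded_dg_module_hom_def)
  then show "wg_dg_module_hom A (Fo M) (Fo N) (Fm M N f)"
    by (intro presented_module_hom[OF pres pres f map[OF f]])
next
  fix M :: "('v, 'm) graded_mod" assume M: "graded_dg_module V M"
  then interpret M: presented_module V M A \<alpha> "Fo M" "\<pi> M" by (rule pres)
  show "wg_dg_module A (Fo M)" by (rule M.dg_module)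
  fix g x assume "x \<in> elts (Fo M) g"
  then show "Fm M M id g x = x"
    using map[OF graded_dg_module_hom_id[OF M], where g = g] by (auto simp: M.mod.elts)
next
  fix M N L :: "('v, 'm) graded_mod" and f k g x
  assume f: "graded_dg_module_hom V M N f" and k: "graded_dg_module_hom V N L k" and x: "x \<in> elts (Fo M) g"
  have M: "graded_dg_module V M" using f by (simp add: graded_dg_module_hom_def)
  interpret M: presented_module V M A \<alpha> "Fo M" "\<pi> M" by (rule pres[OF M])
  have kf: "graded_dg_module_hom V M L (k \<circ> f)"
  proof -
    have "k (f (mmode M v n w)) = mmode L v n (k (f w))" if "w \<in> car M" for v n w
      using that by (simp add: hom_mode[OF f] hom_mode[OF k] hom_car[OF f])
    moreover have "linear_on (scl M) (scl L) (car M) (k \<circ> f)"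
      using linear_on_add[OF hom_linear[OF f]] linear_on_scale[OF hom_linear[OF f]]
        linear_on_add[OF hom_linear[OF k]] linear_on_scale[OF hom_linear[OF k]] hom_car[OF f]
      by (simp add: linear_on_def)
    ultimately show ?thesis
      using f k hom_car[OF f] by (auto simp: graded_dg_module_hom_def image_subset_iff)
  qed
  show "Fm M L (k \<circ> f) g x = Fm N L k g (Fm M N f g x)"
    using x map[OF f, where g = g] map[OF k, where g = g, OF hom_Mp[OF f]] map[OF kf, where g = g]
    by (auto simp: M.mod.elts)
qed

theorem proposition8p6:
  fixes V :: "'v::ab_group_add dgvoa"
  assumes "dg_vertex_operator_algebra V"
  shows "\<exists>\<Psi> :: ('v, 'm::ab_group_add) graded_mod \<Rightarrow> bideg \<Rightarrow> 'm set set \<Rightarrow> 'm set.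
    natural_transformation V (grA_alg V) (eta_mod V) (eta_map V) (grA_mod V) (grA_map V) \<Psi> \<and>
    (\<forall>M. graded_dg_module V M \<longrightarrow>
       (\<forall>g. \<forall>m\<in>Mp M g. \<Psi> M g ((m +o C2M M) +o KR V M g) = m +o JM V M g) \<and>
       surjective_hom (eta_mod V M) (grA_mod V M) (\<Psi> M) \<and>
       wg_dg_poisson_module (grA_alg V) (grA_mod V M) \<and>
       wg_dg_poisson_module_hom (R_alg V) (eta_mod_R V M)
         (restrict_scalars (eta V) (grA_mod V M)) (\<Psi> M) \<and>
       (eta_brackets_descend V M \<longrightarrow>
          wg_dg_poisson_module_hom (grA_alg V) (eta_mod V M) (grA_mod V M) (\<Psi> M)))"
proof (intro exI[of _ "eta_to_grA V"] conjI allI impI)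
  note eta = graded_dg_module.eta_mod_presented
  note gr = graded_dg_module.grA_mod_presented
  have gr_mod: "presented_module V M (grA_alg V) (\<lambda>g u. u +o IV V g) (grA_mod V M) (\<lambda>g x. x +o JM V M g)"
    if "graded_dg_module V M" for M :: "('v, 'm) graded_mod"
  proof -
    interpret presented_poisson_module V M "grA_alg V" "\<lambda>g u. u +o IV V g" "grA_mod V M" "\<lambda>g x. x +o JM V M g"
      by (rule gr[OF that])
    show ?thesis by (rule presented_module_axioms)
  qed
  note \<Psi> = graded_dg_module.eta_to_grA_class
  show "natural_transformation V (grA_alg V) (eta_mod V) (eta_map V) (grA_mod V) (grA_map V)
      (eta_to_grA V :: ('v, 'm) graded_mod \<Rightarrow> _)"
    unfolding natural_transformation_def
  proof (intro conjI allI impI ballI)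
    show "functor_to_modules V (grA_alg V) (eta_mod V :: ('v, 'm) graded_mod \<Rightarrow> _) (eta_map V)"
      by (rule presented_functor[OF eta eta_map_class])
    show "functor_to_modules V (grA_alg V) (grA_mod V :: ('v, 'm) graded_mod \<Rightarrow> _) (grA_map V)"
      by (rule presented_functor[OF gr_mod grA_map_class])
    fix M :: "('v, 'm) graded_mod" assume M: "graded_dg_module V M"
    show "wg_dg_module_hom (grA_alg V) (eta_mod V M) (grA_mod V M) (eta_to_grA V M)"
      by (rule presented_module_hom[OF eta[OF M] gr_mod[OF M] graded_dg_module_hom_id[OF M]])
        (simp add: \<Psi>[OF M])
  next
    fix M N :: "('v, 'm) graded_mod" and f g x
    assume f: "graded_dg_module_hom V M N f" and x: "x \<in> elts (eta_mod V M) g"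
    then have M: "graded_dg_module V M" "graded_dg_module V N" by (simp_all add: graded_dg_module_hom_def)
    interpret eta: presented_module V M "grA_alg V" "\<lambda>g u. u +o IV V g" "eta_mod V M"
        "graded_dg_module.eta_class V M"
      by (rule eta[OF M(1)])
    show "eta_to_grA V N g (eta_map V M N f g x) = grA_map V M N f g (eta_to_grA V M g x)"
    proof -
      obtain y where "x = (y +o C2M M) +o KR V M g" "y \<in> Mp M g"
        using x unfolding eta.mod.elts by blast
      then show ?thesis
        using eta_map_class[OF f, of y g] grA_map_class[OF f, of y g] hom_Mp[OF f, of y g]
          \<Psi>[OF M(1), of y g] \<Psi>[OF M(2), of "f y" g] by simp
    qed
  qed
  fix M :: "('v, 'm) graded_mod" assume M: "graded_dg_module V M"
  interpret graded_dg_module V M by (rule M)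
  show "\<forall>m\<in>Mp M g. eta_to_grA V M g ((m +o C2M M) +o KR V M g) = m +o JM V M g" for g
    using eta_to_grA_class by blast
  interpret eta: presented_module V M "grA_alg V" "\<lambda>g u. u +o IV V g" "eta_mod V M" eta_class
    by (rule eta_mod_presented)
  interpret gr: presented_poisson_module V M "grA_alg V" "\<lambda>g u. u +o IV V g" "grA_mod V M" "\<lambda>g x. x +o JM V M g"
    by (rule grA_mod_presented)
  show "surjective_hom (eta_mod V M) (grA_mod V M) (eta_to_grA V M)"
    by (simp add: surjective_hom_def eta.mod.elts gr.mod.elts image_image eta_to_grA_class cong: image_cong)
  show "wg_dg_poisson_module (grA_alg V) (grA_mod V M)" by (rule gr.poisson_module)
  show "wg_dg_poisson_module_hom (R_alg V) (eta_mod_R V M) (restrict_scalars (eta V) (grA_mod V M)) (eta_to_grA V M)"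
    by (rule presented_poisson_module_hom[OF eta_mod_R_presented grA_mod_restricted_presented eta_to_grA_class])
  show "wg_dg_poisson_module_hom (grA_alg V) (eta_mod V M) (grA_mod V M) (eta_to_grA V M)"
    if "eta_brackets_descend V M"
    by (rule presented_poisson_module_hom[OF eta_mod_poisson_presented[OF that] grA_mod_presented eta_to_grA_class])
qed

end
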